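(* There are the following isomorphisms of weight posets. 1) For all $n,m\ge1$, $$\mathcal P(\mathbf A_n,m\varpi_1)\simeq\mathcal P(\mathbf A_{n+m-1},\varpi_n)\simeq\mathcal P(\mathbf A_{n+m-1},\varpi_m)\simeq\mathcal P(\mathbf A_m,n\varpi_1).$$ In particular, for $m=2$, $\mathcal P(\mathbf A_2,n\varpi_1)\simeq\mathcal P(\mathbf A_n,2\varpi_1)\simeq\mathcal P(\mathbf A_{n+1},\varpi_2)$. 2) $\mathcal P(\mathbf B_n,\varpi_n)\simeq\mathcal P(\mathbf D_{n+1},\varpi_{n+1})$.
   Context: For a simple Lie algebra $\mathfrak g$ (over an algebraically closed field of characteristic zero) with a fixed Cartan subalgebra and a fixed set of simple roots, and a dominant weight $\lambda$, $\mathcal P(\mathfrak g,\lambda)$ is the set of weights of the simple $\mathfrak g$-module with highest weight $\lambda$, with the root order: $\mu$ covers $\gamma$ if and only if $\mu-\gamma$ is a simple root (the order being generated by these relations). Here $\mathfrak g$ is denoted by its Cartan type $\mathbf X_n$. Fundamental weights: $\mathbf A_n=\mathfrak{sl}_{n+1}$ with simple roots $\alpha_i=\varepsilon_i-\varepsilon_{i+1}$, where $\varepsilon_1,\dots,\varepsilon_{n+1}$ ($\sum_i\varepsilon_i=0$) are the weights of the tautological representation, and $\varpi_m=\varepsilon_1+\dots+\varepsilon_m$. For $\mathbf B_n=\mathfrak{so}_{2n+1}$, simple roots are $\varepsilon_1-\varepsilon_2,\dots,\varepsilon_{n-1}-\varepsilon_n,\varepsilon_n$ and $\varpi_n=\frac12(\varepsilon_1+\dots+\varepsilon_n)$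 (spinor representation). For $\mathbf D_n=\mathfrak{so}_{2n}$, simple roots are $\varepsilon_1-\varepsilon_2,\dots,\varepsilon_{n-1}-\varepsilon_n,\varepsilon_{n-1}+\varepsilon_n$ and $\varpi_n=\frac12(\varepsilon_1+\dots+\varepsilon_n)$ (a half-spinor representation). In part 2, $n\ge2$, with $\mathbf D_3$ understood as $\mathfrak{so}_6$. *)

theory Defs
  imports "Jordan_Normal_Form.VS_Connect" "HOL-Library.FuncSet"
begin

(* Weights are functions on matrices; only their values on the Cartan subalgebra matter. *)
type_synonym 'k weight = "'k mat \<Rightarrow> 'k"

record 'k lie_datum =
  lie_algebra :: "'k mat set"
  cartan :: "'k mat set"
  simple_roots :: "'k weight set"

definition lie_bracket :: "'k::field mat \<Rightarrow> 'k mat \<Rightarrow> 'k mat" where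
  "lie_bracket x y = x * y - y * x"

definition root_space :: "'k::field lie_datum \<Rightarrow> 'k weight \<Rightarrow> 'k mat set" where
  "root_space L \<beta> = {x \<in> lie_algebra L. \<forall>h\<in>cartan L. lie_bracket h x = \<beta> h \<cdot>\<^sub>m x}"

definition positive_roots :: "'k::field lie_datum \<Rightarrow> 'k weight set" where
  "positive_roots L =
    {\<beta>. (\<exists>c :: 'k weight \<Rightarrow> nat. (\<exists>\<alpha>\<in>simple_roots L. c \<alpha> \<noteq> 0) \<and>
            \<beta> = (\<lambda>h. \<Sum>\<alpha>\<in>simple_roots L. of_nat (c \<alpha>) * \<alpha> h)) \<and>
         (\<exists>x\<in>root_space L \<beta>. x \<noteq> 0\<^sub>m (dim_row x) (dim_col x))}"

(* A module of dimension d is given on column vectors of length d. *)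
definition representation :: "'k::field lie_datum \<Rightarrow> nat \<Rightarrow> ('k mat \<Rightarrow> 'k mat) \<Rightarrow> bool" where
  "representation L d \<rho> \<longleftrightarrow>
    (\<forall>x\<in>lie_algebra L. \<rho> x \<in> carrier_mat d d) \<and>
    (\<forall>x\<in>lie_algebra L. \<forall>y\<in>lie_algebra L. \<rho> (x + y) = \<rho> x + \<rho> y) \<and>
    (\<forall>a. \<forall>x\<in>lie_algebra L. \<rho> (a \<cdot>\<^sub>m x) = a \<cdot>\<^sub>m \<rho> x) \<and>
    (\<forall>x\<in>lie_algebra L. \<forall>y\<in>lie_algebra L.
        \<rho> (lie_bracket x y) = lie_bracket (\<rho> x) (\<rho> y))"

definition simple_representation ::
  "'k::field lie_datum \<Rightarrow> nat \<Rightarrow> ('k mat \<Rightarrow> 'k mat) \<Rightarrow> bool" where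
  "simple_representation L d \<rho> \<longleftrightarrow>
    representation L d \<rho> \<and> d > 0 \<and>
    (\<forall>W. subspace class_ring W (module_vec TYPE('k) d) \<longrightarrow>
         (\<forall>x\<in>lie_algebra L. \<forall>w\<in>W. \<rho> x *\<^sub>v w \<in> W) \<longrightarrow>
         W = {0\<^sub>v d} \<or> W = carrier_vec d)"

definition weight_space ::
  "'k::field lie_datum \<Rightarrow> nat \<Rightarrow> ('k mat \<Rightarrow> 'k mat) \<Rightarrow> 'k weight \<Rightarrow> 'k vec set" where
  "weight_space L d \<rho> \<mu> = {v \<in> carrier_vec d. \<forall>h\<in>cartan L. \<rho> h *\<^sub>v v = \<mu> h \<cdot>\<^sub>v v}"

definition has_highest_weight ::
  "'k::field lie_datum \<Rightarrow> nat \<Rightarrow> ('k mat \<Rightarrow> 'k mat) \<Rightarrow> 'k weight \<Rightarrow> bool" where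
  "has_highest_weight L d \<rho> lam \<longleftrightarrow>
    (\<exists>v\<in>weight_space L d \<rho> lam. v \<noteq> 0\<^sub>v d \<and>
       (\<forall>\<beta>\<in>positive_roots L. \<forall>x\<in>root_space L \<beta>. \<rho> x *\<^sub>v v = 0\<^sub>v d))"

(* Restricting to functions that are extensional on the Cartan subalgebra makes each
   linear form on it correspond to a single function. The simple module with dominant
   highest weight is finite-dimensional and unique up to isomorphism, so that the
   existential quantifier over d and \<rho> selects its weights. *)
definition weights :: "'k::field lie_datum \<Rightarrow> 'k weight \<Rightarrow> 'k weight set" where
  "weights L lam =
    {\<mu> \<in> extensional (cartan L).
       \<exists>d \<rho>. simple_representation L d \<rho> \<and> has_highest_weight L d \<rho> lam \<and>
             (\<exists>v\<in>weight_space L d \<rho> \<mu>. v \<noteq> 0\<^sub>v d)}"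

definition covers :: "'k::field lie_datum \<Rightarrow> 'k weight \<Rightarrow> 'k weight rel" where
  "covers L lam =
    {(\<gamma>, \<mu>). \<gamma> \<in> weights L lam \<and> \<mu> \<in> weights L lam \<and>
             (\<exists>\<alpha>\<in>simple_roots L. \<forall>h\<in>cartan L. \<mu> h - \<gamma> h = \<alpha> h)}"

(* The poset as its order relation: a pair (\<gamma>, \<mu>) means that \<gamma> is below \<mu>.
   Its field is the set of weights. *)
definition weight_poset :: "'k::field lie_datum \<Rightarrow> 'k weight \<Rightarrow> 'k weight rel" where
  "weight_poset L lam = (covers L lam)\<^sup>* \<inter> weights L lam \<times> weights L lam"

definition poset_iso :: "'a rel \<Rightarrow> 'a rel \<Rightarrow> bool" (infix "\<simeq>" 50) where
  "r \<simeq> s \<longleftrightarrow>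
    (\<exists>f. bij_betw f (Field r) (Field s) \<and>
         (\<forall>x\<in>Field r. \<forall>y\<in>Field r. (x, y) \<in> r \<longleftrightarrow> (f x, f y) \<in> s))"

(* Matrix indices start at 0. *)
definition eps :: "nat \<Rightarrow> 'k::field weight" where
  "eps i h = h $$ (i - 1, i - 1)"

definition sl :: "nat \<Rightarrow> 'k::field mat set" where
  "sl N = {x \<in> carrier_mat N N. (\<Sum>i<N. x $$ (i, i)) = 0}"

(* The orthogonal Lie algebra of the symmetric form with antidiagonal Gram matrix: over an
   algebraically closed field all nondegenerate symmetric forms are equivalent, and for
   this one the diagonal matrices diag(t1, t2, ..., -t2, -t1) form a Cartan subalgebra. *)
definition antidiag :: "nat \<Rightarrow> 'k::field mat" where
  "antidiag N = mat N N (\<lambda>(i, j). if i + j = N - 1 then 1 else 0)"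

definition so :: "nat \<Rightarrow> 'k::field mat set" where
  "so N = {x \<in> carrier_mat N N.
             transpose_mat x * antidiag N + antidiag N * x = 0\<^sub>m N N}"

definition type_A :: "nat \<Rightarrow> 'k::field lie_datum" where
  "type_A n =
    \<lparr>lie_algebra = sl (n + 1),
     cartan = {h \<in> sl (n + 1). diagonal_mat h},
     simple_roots = {(\<lambda>h. eps i h - eps (i + 1) h) | i. 1 \<le> i \<and> i \<le> n}\<rparr>"

definition type_B :: "nat \<Rightarrow> 'k::field lie_datum" where
  "type_B n =
    \<lparr>lie_algebra = so (2 * n + 1),
     cartan = {h \<in> so (2 * n + 1). diagonal_mat h},
     simple_roots = {(\<lambda>h. eps i h - eps (i + 1) h) | i. 1 \<le> i \<and> i < n} \<union> {eps n}\<rparr>"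

definition type_D :: "nat \<Rightarrow> 'k::field lie_datum" where
  "type_D n =
    \<lparr>lie_algebra = so (2 * n),
     cartan = {h \<in> so (2 * n). diagonal_mat h},
     simple_roots = {(\<lambda>h. eps i h - eps (i + 1) h) | i. 1 \<le> i \<and> i < n}
                    \<union> {\<lambda>h. eps (n - 1) h + eps n h}\<rparr>"

definition varpi_A :: "nat \<Rightarrow> 'k::field weight" where
  "varpi_A m h = (\<Sum>i=1..m. eps i h)"

(* Only the last fundamental weight of types B and D. *)
definition varpi_spin :: "nat \<Rightarrow> 'k::field weight" where
  "varpi_spin n h = (\<Sum>i=1..n. eps i h) / 2"

definition weight_mult :: "nat \<Rightarrow> 'k::field weight \<Rightarrow> 'k weight" (infixr "\<odot>" 75) where
  "(m \<odot> \<mu>) h = of_nat m * \<mu> h"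

end

theory Submission
  imports Defs
begin

text \<open>
  All the modules in question are multiplicity free: their weights are the labels of a basis, and the
  basis is a set of combinatorial states.  For the symmetric power with highest weight
  \<open>m \<odot> varpi_A 1\<close> the states are occupation numbers of \<open>n + 1\<close> places with total \<open>m\<close>; for the exterior
  power with highest weight \<open>varpi_A m\<close> they are subsets of size \<open>m\<close>; for the spinor modules they are
  subsets of \<open>{0..n}\<close> of a fixed parity.  In type A a weight covers another one if a single
  particle has moved from place \<open>i + 1\<close> to place \<open>i\<close>.

  The isomorphisms are then elementary.  Reading a subset as a row of stars and bars turns it into a
  sequence of occupation numbers (the numbers of stars between consecutive bars); moving a star one
  place down across a bar moves one particle to the preceding gap, so that covers correspond
  (\<open>raises_gap_counts\<close>).  Taking complements reverses the order of subsets and so does reflecting the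
  places; together they identify the exterior powers of complementary degree (\<open>raises_dual_state\<close>).
  For the spinors of types B and D the same subsets serve as labels: the short root of type B adds
  or omits the place \<open>n\<close> as the parity demands, which in type D is the work of the last two simple
  roots (\<open>spin_covers_agree\<close>).

  What remains is to compute the weights of a module that is given only by its highest weight.
  A concrete simple module with that highest weight is enough, because any two such modules have the
  same weights (\<open>weight_transfer\<close>): the submodule of their direct sum that is generated by the pair of
  highest weight vectors is the graph of an isomorphism.  The argument uses only
  that the Lie algebra consists of matrices, is graded by the distance from the diagonal, and has its
  strictly upper triangular part spanned by root vectors of positive roots.

  The concrete modules are Fock spaces.  Bosonic and fermionic creation and annihilation operators
  represent the matrix units of the general linear Lie algebra, and quadratic expressions in operators
  that satisfy the Clifford relations represent the orthogonal Lie algebra (\<open>clifford.E_comm\<close>).  Since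
  the basis vectors have distinct weights, an invariant subspace is spanned by basis vectors
  (\<open>weight_model.invariant_contains_basis\<close>), and simplicity is the statement that all states are
  connected to the highest one.
\<close>

section \<open>Isomorphisms of relations\<close>

lemma poset_iso_sym:
  assumes "r \<simeq> s"
  shows "s \<simeq> r"
proof -
  from assms obtain f where f: "bij_betw f (Field r) (Field s)"
    and rel: "\<And>x y. x \<in> Field r \<Longrightarrow> y \<in> Field r \<Longrightarrow> (x, y) \<in> r \<longleftrightarrow> (f x, f y) \<in> s"
    unfolding poset_iso_def by blast
  let ?g = "inv_into (Field r) f"
  have g: "bij_betw ?g (Field s) (Field r)"
    using f by (rule bij_betw_inv_into)
  have "(x, y) \<in> s \<longleftrightarrow> (?g x, ?g y) \<in> r" if "x \<in> Field s" "y \<in> Field s" for x y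
    using rel[of "?g x" "?g y"] that g f
    by (simp add: bij_betw_apply bij_betw_inv_into_right)
  with g show ?thesis
    unfolding poset_iso_def by blast
qed

lemma poset_iso_trans:
  assumes "r \<simeq> s" "s \<simeq> t"
  shows "r \<simeq> t"
proof -
  from assms obtain f g where f: "bij_betw f (Field r) (Field s)"
    and rel: "\<And>x y. x \<in> Field r \<Longrightarrow> y \<in> Field r \<Longrightarrow> (x, y) \<in> r \<longleftrightarrow> (f x, f y) \<in> s"
    and g: "bij_betw g (Field s) (Field t)"
    and rel': "\<And>x y. x \<in> Field s \<Longrightarrow> y \<in> Field s \<Longrightarrow> (x, y) \<in> s \<longleftrightarrow> (g x, g y) \<in> t"
    unfolding poset_iso_def by blast
  have "bij_betw (g \<circ> f) (Field r) (Field t)"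
    using f g by (rule bij_betw_trans)
  moreover have "(x, y) \<in> r \<longleftrightarrow> ((g \<circ> f) x, (g \<circ> f) y) \<in> t" if "x \<in> Field r" "y \<in> Field r" for x y
    using that f by (simp add: rel rel' bij_betw_apply)
  ultimately show ?thesis
    unfolding poset_iso_def by blast
qed

lemma rtrancl_image:
  assumes "(x, y) \<in> r\<^sup>*"
    and "\<And>x y. (x, y) \<in> r \<Longrightarrow> (f x, f y) \<in> s"
  shows "(f x, f y) \<in> s\<^sup>*"
  using assms(1) by induction (auto intro: rtrancl_into_rtrancl assms(2))

lemma poset_iso_closure:
  assumes r: "r \<subseteq> A \<times> A" and s: "s \<subseteq> B \<times> B" and f: "bij_betw f A B"
    and rel: "\<And>x y. x \<in> A \<Longrightarrow> y \<in> A \<Longrightarrow> (x, y) \<in> r \<longleftrightarrow> (f x, f y) \<in> s"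
  shows "r\<^sup>* \<inter> A \<times> A \<simeq> s\<^sup>* \<inter> B \<times> B"
proof -
  let ?g = "inv_into A f"
  have fld: "Field (q\<^sup>* \<inter> C \<times> C) = C" for q :: "'c rel" and C
    unfolding Field_def by auto
  have gf: "?g (f x) = x" if "x \<in> A" for x
    using f that by (rule bij_betw_inv_into_left)
  have fg: "f (?g x) = x" if "x \<in> B" for x
    using f that by (rule bij_betw_inv_into_right)
  have g: "?g x \<in> A" if "x \<in> B" for x
    using bij_betw_apply[OF bij_betw_inv_into[OF f] that] .
  have to: "(f x, f y) \<in> s\<^sup>*" if "(x, y) \<in> r\<^sup>*" for x y
    using that by (rule rtrancl_image) (use r rel in blast)
  have fro: "(?g x, ?g y) \<in> r\<^sup>*" if "(x, y) \<in> s\<^sup>*" for x y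
    using that by (rule rtrancl_image) (use s rel g fg in auto)
  have "(x, y) \<in> r\<^sup>* \<longleftrightarrow> (f x, f y) \<in> s\<^sup>*" if "x \<in> A" "y \<in> A" for x y
    using to[of x y] fro[of "f x" "f y"] that by (auto simp: gf)
  with f show ?thesis
    unfolding poset_iso_def fld
    by (intro exI[of _ f]) (auto simp: bij_betw_apply)
qed

text \<open>The weights of each module are labelled by combinatorial indices; this moves the comparison
  of two posets to the indices.\<close>

lemma weight_poset_iso:
  assumes W: "weights L lam = w ` I" and W': "weights L' lam' = w' ` I'"
    and w: "inj_on w I" and w': "inj_on w' I'" and f: "bij_betw f I I'"
    and cov: "\<And>s t. s \<in> I \<Longrightarrow> t \<in> I \<Longrightarrow>
      (w s, w t) \<in> covers L lam \<longleftrightarrow> (w' (f s), w' (f t)) \<in> covers L' lam'"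
  shows "weight_poset L lam \<simeq> weight_poset L' lam'"
proof -
  let ?g = "w' \<circ> f \<circ> inv_into I w"
  have "bij_betw ?g (w ` I) (w' ` I')"
    using bij_betw_trans[OF bij_betw_trans[OF bij_betw_inv_into f] inj_on_imp_bij_betw[OF w']]
      inj_on_imp_bij_betw[OF w] by (simp add: comp_assoc)
  moreover have "(x, y) \<in> covers L lam \<longleftrightarrow> (?g x, ?g y) \<in> covers L' lam'"
    if "x \<in> w ` I" "y \<in> w ` I" for x y
    using that cov w by auto
  ultimately show ?thesis
    unfolding weight_poset_def W W'
    by (intro poset_iso_closure[where f = ?g]) (auto simp: covers_def W W')
qed

section \<open>Representations\<close>

lemma smult_zero_vec_eq [simp]: "(a :: 'k::field) \<cdot>\<^sub>v 0\<^sub>v d = 0\<^sub>v d"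
  by (intro eq_vecI) auto

lemma zero_smult_vec_eq: "u \<in> carrier_vec d \<Longrightarrow> (0 :: 'k::field) \<cdot>\<^sub>v u = 0\<^sub>v d"
  by (intro eq_vecI) auto

lemma mult_mat_zero_vec_eq: "(A :: 'k::field mat) \<in> carrier_mat d d \<Longrightarrow> A *\<^sub>v 0\<^sub>v d = 0\<^sub>v d"
  by (intro eq_vecI) auto

lemma representationD:
  assumes "representation L d \<rho>" "x \<in> lie_algebra L"
  shows "\<rho> x \<in> carrier_mat d d"
  using assms unfolding representation_def by blast

lemma representation_add_vec:
  assumes "representation L d \<rho>" "x \<in> lie_algebra L" "y \<in> lie_algebra L" "u \<in> carrier_vec d"
  shows "\<rho> (x + y) *\<^sub>v u = \<rho> x *\<^sub>v u + \<rho> y *\<^sub>v u"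
proof -
  have "\<rho> (x + y) = \<rho> x + \<rho> y" "\<rho> x \<in> carrier_mat d d" "\<rho> y \<in> carrier_mat d d"
    using assms unfolding representation_def by blast+
  then show ?thesis
    using assms(4) by (simp add: add_mult_distrib_mat_vec)
qed

lemma representation_smult_vec:
  assumes "representation L d \<rho>" "x \<in> lie_algebra L" "u \<in> carrier_vec d"
  shows "\<rho> (a \<cdot>\<^sub>m x) *\<^sub>v u = a \<cdot>\<^sub>v (\<rho> x *\<^sub>v u)"
proof -
  have "\<rho> (a \<cdot>\<^sub>m x) = a \<cdot>\<^sub>m \<rho> x" "\<rho> x \<in> carrier_mat d d"
    using assms(1,2) unfolding representation_def by blast+
  then show ?thesis
    using assms(3) by auto
qed

lemma representation_bracket_vec:
  assumes rep: "representation L d \<rho>"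
    and x: "x \<in> lie_algebra L" and y: "y \<in> lie_algebra L" and u: "u \<in> carrier_vec d"
  shows "\<rho> x *\<^sub>v (\<rho> y *\<^sub>v u) = \<rho> y *\<^sub>v (\<rho> x *\<^sub>v u) + \<rho> (lie_bracket x y) *\<^sub>v u"
proof -
  have c: "\<rho> x \<in> carrier_mat d d" "\<rho> y \<in> carrier_mat d d"
    using rep x y by (auto dest: representationD)
  have "\<rho> (lie_bracket x y) = \<rho> x * \<rho> y - \<rho> y * \<rho> x"
    using rep x y unfolding representation_def lie_bracket_def by blast
  then have "\<rho> (lie_bracket x y) *\<^sub>v u = \<rho> x *\<^sub>v (\<rho> y *\<^sub>v u) - \<rho> y *\<^sub>v (\<rho> x *\<^sub>v u)"
    using c u by (simp add: minus_mult_distrib_mat_vec[of _ d d])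
  then show ?thesis
    using c u by auto
qed

lemma subspace_module_vecI:
  fixes W :: "'k::field vec set"
  assumes "W \<subseteq> carrier_vec d" "0\<^sub>v d \<in> W"
    and "\<And>u w. u \<in> W \<Longrightarrow> w \<in> W \<Longrightarrow> u + w \<in> W"
    and "\<And>c u. u \<in> W \<Longrightarrow> c \<cdot>\<^sub>v u \<in> W"
  shows "subspace class_ring W (module_vec TYPE('k) d)"
proof -
  interpret v: vec_space "TYPE('k)" d .
  show ?thesis
    using assms v.vectorspace_axioms v.module_axioms
    by (auto simp: subspace_def submodule_def module_vec_simps)
qed

lemma subspace_module_vecD:
  fixes W :: "'k::field vec set"
  assumes "subspace class_ring W (module_vec TYPE('k) d)"
  shows "W \<subseteq> carrier_vec d" "0\<^sub>v d \<in> W"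
    "u \<in> W \<Longrightarrow> w \<in> W \<Longrightarrow> u + w \<in> W"
    "u \<in> W \<Longrightarrow> c \<cdot>\<^sub>v u \<in> W"
  using assms by (auto simp: subspace_def submodule_def module_vec_simps)

lemma simple_representation_invariant:
  fixes W :: "'k::field vec set"
  assumes "simple_representation L d \<rho>"
    and "W \<subseteq> carrier_vec d" "0\<^sub>v d \<in> W"
    and "\<And>u w. u \<in> W \<Longrightarrow> w \<in> W \<Longrightarrow> u + w \<in> W"
    and "\<And>c u. u \<in> W \<Longrightarrow> c \<cdot>\<^sub>v u \<in> W"
    and "\<And>x u. x \<in> lie_algebra L \<Longrightarrow> u \<in> W \<Longrightarrow> \<rho> x *\<^sub>v u \<in> W"
  shows "W = {0\<^sub>v d} \<or> W = carrier_vec d"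
  using assms(1,6) subspace_module_vecI[OF assms(2-5)] unfolding simple_representation_def by blast

section \<open>Triangular decomposition\<close>

text \<open>Removing pieces one at a time, each of which clears at least one entry, exhausts a matrix. This takes
  the place of writing a matrix as a finite sum of homogeneous components or of root vectors.\<close>

lemma peel_induct:
  fixes x :: "'k::ab_group_add mat"
  assumes x: "x \<in> S" and S: "S \<subseteq> carrier_mat N N"
    and zero: "P (0\<^sub>m N N)"
    and add: "\<And>y z. y \<in> S \<Longrightarrow> z \<in> S \<Longrightarrow> piece y \<Longrightarrow> P z \<Longrightarrow> P (y + z)"
    and peel: "\<And>x a b. x \<in> S \<Longrightarrow> a < N \<Longrightarrow> b < N \<Longrightarrow> x $$ (a, b) \<noteq> 0 \<Longrightarrow>
      \<exists>y\<in>S. piece y \<and> x - y \<in> S \<and> y $$ (a, b) = x $$ (a, b) \<and>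
        (\<forall>i<N. \<forall>j<N. y $$ (i, j) \<in> {0, x $$ (i, j)})"
  shows "P x"
  using x
proof (induction "card {(i, j). i < N \<and> j < N \<and> x $$ (i, j) \<noteq> 0}" arbitrary: x rule: less_induct)
  case less
  have cx: "x \<in> carrier_mat N N"
    using less.prems S by blast
  show ?case
  proof (cases "\<exists>a<N. \<exists>b<N. x $$ (a, b) \<noteq> 0")
    case False
    then have "x = 0\<^sub>m N N"
      using cx by (intro eq_matI) auto
    then show ?thesis
      using zero by simp
  next
    case True
    then obtain a b where ab: "a < N" "b < N" "x $$ (a, b) \<noteq> 0"
      by blast
    from peel[OF less.prems ab] obtain y where y: "y \<in> S" "piece y" "x - y \<in> S"
      "y $$ (a, b) = x $$ (a, b)" "\<And>i j. i < N \<Longrightarrow> j < N \<Longrightarrow> y $$ (i, j) \<in> {0, x $$ (i, j)}"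
      by blast
    have cy: "y \<in> carrier_mat N N"
      using y(1) S by blast
    have *: "(x - y) $$ (i, j) = x $$ (i, j) - y $$ (i, j)" if "i < N" "j < N" for i j
      using cx cy that by simp
    have "{(i, j). i < N \<and> j < N \<and> (x - y) $$ (i, j) \<noteq> 0}
        \<subseteq> {(i, j). i < N \<and> j < N \<and> x $$ (i, j) \<noteq> 0}"
      using * y(5) by force
    moreover have "(a, b) \<in> {(i, j). i < N \<and> j < N \<and> x $$ (i, j) \<noteq> 0}"
      "(a, b) \<notin> {(i, j). i < N \<and> j < N \<and> (x - y) $$ (i, j) \<noteq> 0}"
      using ab y(4) * by auto
    ultimately have "{(i, j). i < N \<and> j < N \<and> (x - y) $$ (i, j) \<noteq> 0}
        \<subset> {(i, j). i < N \<and> j < N \<and> x $$ (i, j) \<noteq> 0}"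
      by blast
    then have "card {(i, j). i < N \<and> j < N \<and> (x - y) $$ (i, j) \<noteq> 0}
        < card {(i, j). i < N \<and> j < N \<and> x $$ (i, j) \<noteq> 0}"
      by (intro psubset_card_mono finite_subset[OF _ finite_cartesian_product, of _ "{..<N}" "{..<N}"])
        auto
    then have "P (x - y)"
      using less.hyps y(3) by blast
    then have "P (y + (x - y))"
      using add y by blast
    also have "y + (x - y) = x"
      using cx cy by (intro eq_matI) auto
    finally show ?thesis .
  qed
qed

text \<open>The degree of the entry in row \<open>a\<close> and column \<open>b\<close> is \<open>b - a\<close>, so that the positive degrees are the
  strictly upper triangular ones.\<close>

definition homogeneous :: "int \<Rightarrow> 'k::zero mat \<Rightarrow> bool" where
  "homogeneous j x \<longleftrightarrow>
    (\<forall>a<dim_row x. \<forall>b<dim_col x. x $$ (a, b) \<noteq> 0 \<longrightarrow> int b - int a = j)"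

definition band :: "int \<Rightarrow> 'k::zero mat \<Rightarrow> 'k mat" where
  "band j x = mat (dim_row x) (dim_col x) (\<lambda>(a, b). if int b - int a = j then x $$ (a, b) else 0)"

definition strictly_upper :: "'k::zero mat \<Rightarrow> bool" where
  "strictly_upper x \<longleftrightarrow> (\<forall>a<dim_row x. \<forall>b<dim_col x. x $$ (a, b) \<noteq> 0 \<longrightarrow> a < b)"

text \<open>Twice the half sum of the positive coroots of the special linear Lie algebra. It also lies in the
  orthogonal Lie algebra of the antidiagonal form, so that a single element serves all types.\<close>

definition grading :: "nat \<Rightarrow> 'k::ring_1 mat" where
  "grading N = mat_diag N (\<lambda>a. of_int (int N - 1 - 2 * int a))"

lemma lie_bracket_diag:
  fixes x :: "'k::field mat"
  assumes "x \<in> carrier_mat N N" "a < N" "b < N"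
  shows "lie_bracket (mat_diag N f) x $$ (a, b) = (f a - f b) * x $$ (a, b)"
  using assms by (simp add: lie_bracket_def mat_diag_mult_left mat_diag_mult_right algebra_simps)

lemma lie_bracket_carrier:
  "x \<in> carrier_mat N N \<Longrightarrow> y \<in> carrier_mat N N \<Longrightarrow> lie_bracket x y \<in> carrier_mat N N"
  by (auto simp: lie_bracket_def)

lemma lie_bracket_grading:
  fixes x :: "'k::field mat"
  assumes "x \<in> carrier_mat N N" "homogeneous j x"
  shows "lie_bracket (grading N) x = of_int (2 * j) \<cdot>\<^sub>m x"
proof (rule eq_matI)
  fix a b
  assume "a < dim_row (of_int (2 * j) \<cdot>\<^sub>m x)" "b < dim_col (of_int (2 * j) \<cdot>\<^sub>m x)"
  then have ab: "a < N" "b < N"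
    using assms(1) by auto
  have "of_int (int N - 1 - 2 * int a) - of_int (int N - 1 - 2 * int b) = (of_int (2 * (int b - int a)) :: 'k)"
    by simp
  then show "lie_bracket (grading N) x $$ (a, b) = (of_int (2 * j) \<cdot>\<^sub>m x) $$ (a, b)"
    using assms ab unfolding grading_def homogeneous_def
    by (cases "x $$ (a, b) = 0") (auto simp: lie_bracket_diag)
next
  have "lie_bracket (grading N) x \<in> carrier_mat N N"
    using assms(1) by (intro lie_bracket_carrier) (auto simp: grading_def)
  then show "dim_row (lie_bracket (grading N) x) = dim_row (of_int (2 * j) \<cdot>\<^sub>m x)"
    "dim_col (lie_bracket (grading N) x) = dim_col (of_int (2 * j) \<cdot>\<^sub>m x)"
    using assms(1) by auto
qed

text \<open>What the uniqueness of highest weight modules needs to know about the Lie algebra. The last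
  assumption says that an upper triangular element can be peeled by positive root vectors; hence a
  vector that they annihilate is annihilated by the whole strictly upper triangular part. The
  lower triangular part is handled through the grading.\<close>

locale triangular_datum =
  fixes L :: "'k::field_char_0 lie_datum" and N :: nat
  assumes carrier: "lie_algebra L \<subseteq> carrier_mat N N"
    and add_closed: "x \<in> lie_algebra L \<Longrightarrow> y \<in> lie_algebra L \<Longrightarrow> x + y \<in> lie_algebra L"
    and smult_closed: "x \<in> lie_algebra L \<Longrightarrow> c \<cdot>\<^sub>m x \<in> lie_algebra L"
    and bracket_closed: "x \<in> lie_algebra L \<Longrightarrow> y \<in> lie_algebra L \<Longrightarrow> lie_bracket x y \<in> lie_algebra L"
    and band_closed: "x \<in> lie_algebra L \<Longrightarrow> band j x \<in> lie_algebra L"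
    and grading_mem: "grading N \<in> lie_algebra L"
    and cartan_eq: "cartan L = {h \<in> lie_algebra L. diagonal_mat h}"
    and finite_simple_roots: "finite (simple_roots L)"
    and simple_root_grading: "\<alpha> \<in> simple_roots L \<Longrightarrow> \<exists>c>0. \<alpha> (grading N) = of_nat c"
    and upper_root_part: "x \<in> lie_algebra L \<Longrightarrow> strictly_upper x \<Longrightarrow> a < N \<Longrightarrow> b < N \<Longrightarrow>
      x $$ (a, b) \<noteq> 0 \<Longrightarrow> \<exists>\<beta>\<in>positive_roots L. \<exists>y\<in>root_space L \<beta>.
        y $$ (a, b) = x $$ (a, b) \<and> (\<forall>i<N. \<forall>j<N. y $$ (i, j) \<in> {0, x $$ (i, j)})"
begin

lemma minus_closed:
  assumes "x \<in> lie_algebra L" "y \<in> lie_algebra L"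
  shows "x - y \<in> lie_algebra L"
proof -
  have "x - y = x + (- 1) \<cdot>\<^sub>m y"
    using assms carrier by (intro eq_matI) auto
  then show ?thesis
    using assms by (simp add: add_closed smult_closed)
qed

lemma zero_mem: "0\<^sub>m N N \<in> lie_algebra L"
proof -
  have "0 \<cdot>\<^sub>m grading N = (0\<^sub>m N N :: 'k mat)"
    by (intro eq_matI) (auto simp: grading_def mat_diag_def)
  then show ?thesis
    using smult_closed[OF grading_mem, of 0] by simp
qed

lemma grading_cartan: "grading N \<in> cartan L"
  using grading_mem by (auto simp: cartan_eq diagonal_mat_def grading_def mat_diag_def)

text \<open>A positive root takes a positive value on the grading element, and this value is twice the degree
  of the entries of its root vectors.\<close>

lemma positive_root_strictly_upper:
  assumes \<beta>: "\<beta> \<in> positive_roots L" and x: "x \<in> root_space L \<beta>"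
  shows "strictly_upper x"
proof -
  obtain c \<alpha> where c: "\<alpha> \<in> simple_roots L" "c \<alpha> \<noteq> (0::nat)"
    and \<beta>_eq: "\<beta> = (\<lambda>h. \<Sum>\<alpha>\<in>simple_roots L. of_nat (c \<alpha>) * \<alpha> h)"
    using \<beta> by (auto simp: positive_roots_def)
  obtain g where g: "\<And>\<alpha>. \<alpha> \<in> simple_roots L \<Longrightarrow> g \<alpha> > 0 \<and> \<alpha> (grading N) = of_nat (g \<alpha>)"
    using simple_root_grading by metis
  define s where "s = (\<Sum>\<alpha>\<in>simple_roots L. c \<alpha> * g \<alpha>)"
  have "\<beta> (grading N) = of_nat s"
    unfolding \<beta>_eq s_def by (simp add: g)
  moreover have "c \<alpha> * g \<alpha> \<le> s"
    unfolding s_def by (rule member_le_sum) (use c finite_simple_roots in auto)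
  then have "s > 0"
    using c g[of \<alpha>] by (auto intro: gr0I)
  ultimately have br: "lie_bracket (grading N) x = of_nat s \<cdot>\<^sub>m x"
    using x grading_cartan unfolding root_space_def by auto
  have cx: "x \<in> carrier_mat N N"
    using x carrier unfolding root_space_def by auto
  have "a < b" if ab: "a < N" "b < N" "x $$ (a, b) \<noteq> 0" for a b
  proof -
    have "of_int (int N - 1 - 2 * int a) - of_int (int N - 1 - 2 * int b) = (of_nat s :: 'k)"
      using arg_cong[OF br, of "\<lambda>m. m $$ (a, b)"] cx ab by (simp add: grading_def lie_bracket_diag)
    then have "(of_int (2 * (int b - int a)) :: 'k) = of_int (int s)"
      by simp
    then have "2 * (int b - int a) = int s"
      by (simp only: of_int_eq_iff)
    with \<open>s > 0\<close> show "a < b"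
      by simp
  qed
  then show ?thesis
    using cx by (auto simp: strictly_upper_def)
qed

lemma band_induct:
  assumes x: "x \<in> lie_algebra L"
    and zero: "P (0\<^sub>m N N)"
    and add: "\<And>y z j. y \<in> lie_algebra L \<Longrightarrow> z \<in> lie_algebra L \<Longrightarrow> homogeneous j y \<Longrightarrow> P z \<Longrightarrow> P (y + z)"
  shows "P x"
proof (rule peel_induct[where piece = "\<lambda>y. \<exists>j. homogeneous j y", OF x carrier])
  fix x a b
  assume x: "x \<in> lie_algebra L" and ab: "a < N" "b < N" "x $$ (a, b) \<noteq> 0"
  let ?y = "band (int b - int a) x"
  have "x \<in> carrier_mat N N"
    using x carrier by blast
  moreover have "?y \<in> lie_algebra L" "x - ?y \<in> lie_algebra L"
    using x by (simp_all add: band_closed minus_closed)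
  moreover have "homogeneous (int b - int a) ?y"
    by (auto simp: homogeneous_def band_def split: if_splits)
  ultimately show "\<exists>y\<in>lie_algebra L. (\<exists>j. homogeneous j y) \<and> x - y \<in> lie_algebra L \<and>
      y $$ (a, b) = x $$ (a, b) \<and> (\<forall>i<N. \<forall>j<N. y $$ (i, j) \<in> {0, x $$ (i, j)})"
    using ab by (intro bexI[of _ ?y]) (auto simp: band_def)
qed (use zero add in blast)+

lemma highest_weight_vector_killed:
  assumes rep: "representation L d \<rho>" and v: "v \<in> carrier_vec d"
    and kill: "\<And>\<beta> x. \<beta> \<in> positive_roots L \<Longrightarrow> x \<in> root_space L \<beta> \<Longrightarrow> \<rho> x *\<^sub>v v = 0\<^sub>v d"
    and x: "x \<in> lie_algebra L" "strictly_upper x"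
  shows "\<rho> x *\<^sub>v v = 0\<^sub>v d"
proof -
  let ?U = "{x \<in> lie_algebra L. strictly_upper x}"
  let ?piece = "\<lambda>y. \<exists>\<beta>\<in>positive_roots L. y \<in> root_space L \<beta>"
  show ?thesis
  proof (rule peel_induct[where piece = ?piece and S = ?U and N = N and P = "\<lambda>x. \<rho> x *\<^sub>v v = 0\<^sub>v d"])
    show "x \<in> ?U" "?U \<subseteq> carrier_mat N N"
      using x carrier by auto
    have "\<rho> (0 \<cdot>\<^sub>m grading N) *\<^sub>v v = 0 \<cdot>\<^sub>v (\<rho> (grading N) *\<^sub>v v)"
      using rep grading_mem v by (rule representation_smult_vec)
    moreover have "0 \<cdot>\<^sub>m grading N = (0\<^sub>m N N :: 'k mat)"
      by (intro eq_matI) (auto simp: grading_def mat_diag_def)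
    ultimately show "\<rho> (0\<^sub>m N N) *\<^sub>v v = 0\<^sub>v d"
      using representationD[OF rep grading_mem] v by auto
  next
    fix y z
    assume "y \<in> ?U" "z \<in> ?U" "?piece y" "\<rho> z *\<^sub>v v = 0\<^sub>v d"
    then show "\<rho> (y + z) *\<^sub>v v = 0\<^sub>v d"
      using kill rep v by (auto simp: representation_add_vec)
  next
    fix x a b
    assume x: "x \<in> ?U" and ab: "a < N" "b < N" "x $$ (a, b) \<noteq> 0"
    then obtain \<beta> y where \<beta>: "\<beta> \<in> positive_roots L" and y: "y \<in> root_space L \<beta>"
      and ent: "y $$ (a, b) = x $$ (a, b)" "\<forall>i<N. \<forall>j<N. y $$ (i, j) \<in> {0, x $$ (i, j)}"
      using upper_root_part[of x a b] by auto
    have yL: "y \<in> lie_algebra L"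
      using y by (simp add: root_space_def)
    have c: "x \<in> carrier_mat N N" "y \<in> carrier_mat N N"
      using x yL carrier by auto
    have up: "strictly_upper y" "strictly_upper x"
      using \<beta> y x positive_root_strictly_upper by auto
    have "strictly_upper (x - y)"
      unfolding strictly_upper_def
    proof (intro allI impI)
      fix i j
      assume "i < dim_row (x - y)" "j < dim_col (x - y)" and nz: "(x - y) $$ (i, j) \<noteq> 0"
      then have ij: "i < N" "j < N"
        using c by simp_all
      then have "x $$ (i, j) \<noteq> 0 \<or> y $$ (i, j) \<noteq> 0"
        using c nz by auto
      then show "i < j"
        using ij c up[unfolded strictly_upper_def] by (metis carrier_matD)
    qed
    moreover have "x - y \<in> lie_algebra L"
      using x yL by (simp add: minus_closed)
    moreover have "?piece y"
      using \<beta> y by blast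
    ultimately have "y \<in> ?U" "x - y \<in> ?U" "?piece y"
      using yL up by simp_all
    with ent show "\<exists>y\<in>?U. ?piece y \<and> x - y \<in> ?U \<and> y $$ (a, b) = x $$ (a, b) \<and>
        (\<forall>i<N. \<forall>j<N. y $$ (i, j) \<in> {0, x $$ (i, j)})"
      by blast
  qed
qed

end

section \<open>Uniqueness of the weights\<close>

text \<open>Sums of eigenvectors of the grading element whose eigenvalues lie strictly below that of the highest
  weight vector.\<close>

inductive lower_sum :: "nat \<Rightarrow> 'k::field mat \<Rightarrow> 'k \<Rightarrow> 'k vec \<Rightarrow> bool" for d H c where
  lower_zero: "lower_sum d H c (0\<^sub>v d)"
| lower_step: "lower_sum d H c n \<Longrightarrow> w \<in> carrier_vec d \<Longrightarrow> k > 0 \<Longrightarrow>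
    H *\<^sub>v w = (c - of_nat k) \<cdot>\<^sub>v w \<Longrightarrow> lower_sum d H c (w + n)"

lemma lower_sum_carrier: "lower_sum d H c n \<Longrightarrow> n \<in> carrier_vec d"
  by (induction rule: lower_sum.induct) auto

lemma lower_sum_add:
  assumes "lower_sum d H c n" "lower_sum d H c m"
  shows "lower_sum d H c (n + m)"
  using assms(1)
proof induction
  case lower_zero
  then show ?case
    using assms(2) lower_sum_carrier by (metis left_zero_vec)
next
  case (lower_step n w k)
  have "w + n + m = w + (n + m)"
    using lower_step assms(2) by (intro assoc_add_vec[of _ d]) (auto dest: lower_sum_carrier)
  then show ?case
    using lower_step by (metis lower_sum.lower_step)
qed

lemma lower_sum_smult:
  assumes "lower_sum d H c n" and H: "H \<in> carrier_mat d d"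
  shows "lower_sum d H c (a \<cdot>\<^sub>v n)"
  using assms(1)
proof induction
  case lower_zero
  then show ?case
    by (simp add: lower_sum.lower_zero)
next
  case (lower_step n w k)
  have "a \<cdot>\<^sub>v (w + n) = a \<cdot>\<^sub>v w + a \<cdot>\<^sub>v n"
    using lower_step by (intro smult_add_distrib_vec[of _ d]) (auto dest: lower_sum_carrier)
  moreover have "H *\<^sub>v (a \<cdot>\<^sub>v w) = (c - of_nat k) \<cdot>\<^sub>v (a \<cdot>\<^sub>v w)"
    using lower_step H by (simp add: mult_mat_vec smult_smult_assoc mult.commute)
  ultimately show ?case
    using lower_step by (auto intro: lower_sum.lower_step)
qed

text \<open>The product of the operators \<open>H - (c - i)\<close> for \<open>i = 1, ..., K\<close>. It annihilates a given sum of lower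
  eigenvectors once \<open>K\<close> is large, but multiplies the highest weight vector by the factorial of \<open>K\<close>.\<close>

fun descent :: "'k::field mat \<Rightarrow> 'k \<Rightarrow> nat \<Rightarrow> 'k vec \<Rightarrow> 'k vec" where
  "descent H c 0 u = u"
| "descent H c (Suc K) u =
    H *\<^sub>v descent H c K u + (of_nat (Suc K) - c) \<cdot>\<^sub>v descent H c K u"

lemma descent_carrier:
  "H \<in> carrier_mat d d \<Longrightarrow> u \<in> carrier_vec d \<Longrightarrow> descent H c K u \<in> carrier_vec d"
  by (induction K) auto

lemma descent_add:
  assumes "H \<in> carrier_mat d d" "u \<in> carrier_vec d" "w \<in> carrier_vec d"
  shows "descent H c K (u + w) = descent H c K u + descent H c K w"
proof (induction K)
  case (Suc K)
  have "descent H c K u \<in> carrier_vec d" "descent H c K w \<in> carrier_vec d"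
    using assms by (simp_all add: descent_carrier)
  with assms(1) Suc show ?case
    by (simp add: mult_add_distrib_mat_vec[of _ d d] smult_add_distrib_vec[of _ d])
      (intro eq_vecI, auto simp: algebra_simps)
qed simp

lemma descent_eigenvector:
  assumes H: "H \<in> carrier_mat d d" and u: "u \<in> carrier_vec d"
    and eig: "H *\<^sub>v u = (c - of_nat k) \<cdot>\<^sub>v u"
  shows "descent H c K u = (\<Prod>i=1..K. of_nat i - of_nat k) \<cdot>\<^sub>v u"
proof (induction K)
  case (Suc K)
  have "H *\<^sub>v (a \<cdot>\<^sub>v u) = (a * (c - of_nat k)) \<cdot>\<^sub>v u" for a
    using H u eig by (simp add: mult_mat_vec smult_smult_assoc)
  with Suc u show ?case
    by (simp add: smult_smult_assoc flip: add_smult_distrib_vec) (simp add: algebra_simps)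
qed (use u in auto)

lemma lower_sum_descent:
  assumes "lower_sum d H c n" and H: "H \<in> carrier_mat d d"
  shows "\<exists>K0. \<forall>K\<ge>K0. descent H c K n = 0\<^sub>v d"
  using assms(1)
proof induction
  case lower_zero
  have "descent H c K (0\<^sub>v d) = 0\<^sub>v d" for K
    using H descent_eigenvector[of H d "0\<^sub>v d" c 0 K] by (simp add: mult_mat_zero_vec_eq)
  then show ?case
    by blast
next
  case (lower_step n w k)
  then obtain K0 where K0: "\<And>K. K \<ge> K0 \<Longrightarrow> descent H c K n = 0\<^sub>v d"
    by blast
  have "descent H c K (w + n) = 0\<^sub>v d" if "K \<ge> max K0 k" for K
  proof -
    have "(\<Prod>i=1..K. of_nat i - of_nat k) = (0 :: 'a)"
      using that lower_step by (intro prod_zero) auto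
    then have "descent H c K w = 0 \<cdot>\<^sub>v w"
      using lower_step H descent_eigenvector by metis
    then have "descent H c K w = 0\<^sub>v d"
      using lower_step by (simp add: zero_smult_vec_eq)
    then show ?thesis
      using K0 that lower_step H by (simp add: descent_add lower_sum_carrier)
  qed
  then show ?case
    by blast
qed

text \<open>Independence of eigenvectors; characteristic zero enters through the factorial.\<close>

lemma eigenvector_not_lower_sum:
  fixes H :: "'k::field_char_0 mat"
  assumes H: "H \<in> carrier_mat d d" and v: "v \<in> carrier_vec d" "v \<noteq> 0\<^sub>v d"
    and eig: "H *\<^sub>v v = c \<cdot>\<^sub>v v"
  shows "\<not> lower_sum d H c v"
proof
  assume "lower_sum d H c v"
  then obtain K where "descent H c K v = 0\<^sub>v d"
    using lower_sum_descent[OF _ H] by blast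
  moreover have "descent H c K v = of_nat (fact K) \<cdot>\<^sub>v v"
    using descent_eigenvector[OF H v(1), of c 0 K] eig by (simp add: fact_prod)
  ultimately show False
    using v by (auto simp: vec_eq_iff)
qed

text \<open>The submodule of the direct sum of two modules that is generated by a pair of highest weight vectors.
  Only lowering elements occur in the definition: that the rest of the Lie algebra preserves
  the result is a consequence (as in the theorem of Poincare, Birkhoff and Witt, but without any
  basis of the enveloping algebra).\<close>

inductive joint_orbit ::
    "'k::field lie_datum \<Rightarrow> ('k mat \<Rightarrow> 'k mat) \<Rightarrow> ('k mat \<Rightarrow> 'k mat) \<Rightarrow> 'k vec \<Rightarrow> 'k vec \<Rightarrow>
      'k vec \<Rightarrow> 'k vec \<Rightarrow> bool"
  for L \<rho> \<rho>' v v' where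
  orbit_base: "joint_orbit L \<rho> \<rho>' v v' v v'"
| orbit_lower: "joint_orbit L \<rho> \<rho>' v v' u u' \<Longrightarrow> y \<in> lie_algebra L \<Longrightarrow> homogeneous j y \<Longrightarrow> j < 0 \<Longrightarrow>
    joint_orbit L \<rho> \<rho>' v v' (\<rho> y *\<^sub>v u) (\<rho>' y *\<^sub>v u')"
| orbit_add: "joint_orbit L \<rho> \<rho>' v v' u u' \<Longrightarrow> joint_orbit L \<rho> \<rho>' v v' w w' \<Longrightarrow>
    joint_orbit L \<rho> \<rho>' v v' (u + w) (u' + w')"
| orbit_smult: "joint_orbit L \<rho> \<rho>' v v' u u' \<Longrightarrow> joint_orbit L \<rho> \<rho>' v v' (a \<cdot>\<^sub>v u) (a \<cdot>\<^sub>v u')"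

context triangular_datum
begin

text \<open>The bracket of the grading element with \<open>y\<close> is a negative multiple of \<open>y\<close>.\<close>

lemma lower_sum_lower:
  assumes rep: "representation L d \<rho>"
    and y: "y \<in> lie_algebra L" "homogeneous j y" "j < 0"
    and n: "lower_sum d (\<rho> (grading N)) c n \<or> n \<in> carrier_vec d \<and> \<rho> (grading N) *\<^sub>v n = c \<cdot>\<^sub>v n"
  shows "lower_sum d (\<rho> (grading N)) c (\<rho> y *\<^sub>v n)"
proof -
  have cy: "\<rho> y \<in> carrier_mat d d"
    using rep y by (auto dest: representationD)
  have br: "lie_bracket (grading N) y = of_int (2 * j) \<cdot>\<^sub>m y"
    using y carrier by (intro lie_bracket_grading) auto
  have eig: "\<rho> (grading N) *\<^sub>v (\<rho> y *\<^sub>v w) = (c - of_nat (k + nat (- 2 * j))) \<cdot>\<^sub>v (\<rho> y *\<^sub>v w)"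
    if "w \<in> carrier_vec d" "\<rho> (grading N) *\<^sub>v w = (c - of_nat k) \<cdot>\<^sub>v w" for w k
  proof -
    have "\<rho> (grading N) *\<^sub>v (\<rho> y *\<^sub>v w) =
        \<rho> y *\<^sub>v ((c - of_nat k) \<cdot>\<^sub>v w) + of_int (2 * j) \<cdot>\<^sub>v (\<rho> y *\<^sub>v w)"
      using representation_bracket_vec[OF rep grading_mem y(1) that(1)] rep y that
      by (simp add: br representation_smult_vec del: of_int_mult)
    also have "\<dots> = (c - of_nat k + of_int (2 * j)) \<cdot>\<^sub>v (\<rho> y *\<^sub>v w)"
      using cy that by (simp add: mult_mat_vec add_smult_distrib_vec)
    also have "c - of_nat k + of_int (2 * j) = c - of_nat (k + nat (- 2 * j))"
      using y(3) by (simp add: of_nat_nat)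
    finally show ?thesis .
  qed
  from n show ?thesis
  proof
    assume "lower_sum d (\<rho> (grading N)) c n"
    then show ?thesis
    proof induction
      case lower_zero
      then show ?case
        using cy by (simp add: lower_sum.lower_zero mult_mat_zero_vec_eq)
    next
      case (lower_step n w k)
      have "\<rho> y *\<^sub>v (w + n) = \<rho> y *\<^sub>v w + \<rho> y *\<^sub>v n"
        using cy lower_step by (intro mult_add_distrib_mat_vec) (auto dest: lower_sum_carrier)
      then show ?case
        using lower_step eig[of w k] cy by (auto intro!: lower_sum.lower_step[of _ _ _ _ _ "k + nat (- 2 * j)"])
    qed
  next
    assume n: "n \<in> carrier_vec d \<and> \<rho> (grading N) *\<^sub>v n = c \<cdot>\<^sub>v n"
    have "lower_sum d (\<rho> (grading N)) c (\<rho> y *\<^sub>v n + 0\<^sub>v d)"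
      using n eig[of n 0] cy y(3)
      by (intro lower_sum.lower_step[where k = "nat (- 2 * j)"] lower_sum.lower_zero) auto
    then show ?thesis
      using cy n by simp
  qed
qed

text \<open>Lowering elements move both components below the generator, and linear combinations treat the two
  components alike; hence the common factor \<open>a\<close>.\<close>

lemma lower_sum_decomposition:
  assumes rep: "representation L d \<rho>" "representation L d' \<rho>'"
    and v: "v \<in> carrier_vec d" "\<rho> (grading N) *\<^sub>v v = c \<cdot>\<^sub>v v"
    and v': "v' \<in> carrier_vec d'" "\<rho>' (grading N) *\<^sub>v v' = c \<cdot>\<^sub>v v'"
    and "joint_orbit L \<rho> \<rho>' v v' u u'"
  shows "\<exists>a n n'. lower_sum d (\<rho> (grading N)) c n \<and> lower_sum d' (\<rho>' (grading N)) c n' \<and>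
    u = a \<cdot>\<^sub>v v + n \<and> u' = a \<cdot>\<^sub>v v' + n'"
  using assms(7)
proof induction
  case orbit_base
  then show ?case
    using v v' lower_zero[of d "\<rho> (grading N)" c] lower_zero[of d' "\<rho>' (grading N)" c]
    by (intro exI[of _ 1] exI[of _ "0\<^sub>v d"] exI[of _ "0\<^sub>v d'"]) auto
next
  case (orbit_lower u u' y j)
  then obtain a n n' where n: "lower_sum d (\<rho> (grading N)) c n" "lower_sum d' (\<rho>' (grading N)) c n'"
    and u: "u = a \<cdot>\<^sub>v v + n" "u' = a \<cdot>\<^sub>v v' + n'"
    by blast
  have step: "lower_sum e (\<sigma> (grading N)) c (\<sigma> y *\<^sub>v (a \<cdot>\<^sub>v w + m))"
    if "representation L e \<sigma>" "w \<in> carrier_vec e" "\<sigma> (grading N) *\<^sub>v w = c \<cdot>\<^sub>v w"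
      "lower_sum e (\<sigma> (grading N)) c m" for e \<sigma> w m
  proof -
    have cy: "\<sigma> y \<in> carrier_mat e e" and cg: "\<sigma> (grading N) \<in> carrier_mat e e"
      using that(1) orbit_lower grading_mem by (auto dest: representationD)
    have "\<sigma> y *\<^sub>v (a \<cdot>\<^sub>v w + m) = a \<cdot>\<^sub>v (\<sigma> y *\<^sub>v w) + \<sigma> y *\<^sub>v m"
      using cy that(2) lower_sum_carrier[OF that(4)]
      by (simp add: mult_add_distrib_mat_vec[of _ e e] mult_mat_vec)
    then show ?thesis
      using that orbit_lower cg
      by (auto intro!: lower_sum_add lower_sum_smult lower_sum_lower)
  qed
  have "\<rho> y \<in> carrier_mat d d" "\<rho>' y \<in> carrier_mat d' d'"
    using rep orbit_lower by (auto dest: representationD)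
  then show ?case
    using step[OF rep(1) v n(1)] step[OF rep(2) v' n(2)] v(1) v'(1) n unfolding u
    by (intro exI[of _ 0] exI[of _ "\<rho> y *\<^sub>v (a \<cdot>\<^sub>v v + n)"] exI[of _ "\<rho>' y *\<^sub>v (a \<cdot>\<^sub>v v' + n')"])
      (auto dest!: lower_sum_carrier)
next
  case (orbit_add u u' w w')
  then obtain a n n' b m m' where n: "lower_sum d (\<rho> (grading N)) c n" "lower_sum d' (\<rho>' (grading N)) c n'"
    and u: "u = a \<cdot>\<^sub>v v + n" "u' = a \<cdot>\<^sub>v v' + n'"
    and m: "lower_sum d (\<rho> (grading N)) c m" "lower_sum d' (\<rho>' (grading N)) c m'"
    and w: "w = b \<cdot>\<^sub>v v + m" "w' = b \<cdot>\<^sub>v v' + m'"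
    by blast
  have "u + w = (a + b) \<cdot>\<^sub>v v + (n + m)" "u' + w' = (a + b) \<cdot>\<^sub>v v' + (n' + m')"
    unfolding u w using v(1) v'(1) n[THEN lower_sum_carrier] m[THEN lower_sum_carrier]
    by (auto intro!: eq_vecI simp: algebra_simps)
  then show ?case
    using n m by (blast intro: lower_sum_add)
next
  case (orbit_smult u u' b)
  then obtain a n n' where n: "lower_sum d (\<rho> (grading N)) c n" "lower_sum d' (\<rho>' (grading N)) c n'"
    and u: "u = a \<cdot>\<^sub>v v + n" "u' = a \<cdot>\<^sub>v v' + n'"
    by blast
  have "b \<cdot>\<^sub>v u = (b * a) \<cdot>\<^sub>v v + b \<cdot>\<^sub>v n" "b \<cdot>\<^sub>v u' = (b * a) \<cdot>\<^sub>v v' + b \<cdot>\<^sub>v n'"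
    unfolding u using v(1) v'(1) n[THEN lower_sum_carrier]
    by (auto intro!: eq_vecI simp: algebra_simps)
  then show ?case
    using n lower_sum_smult representationD[OF rep(1) grading_mem] representationD[OF rep(2) grading_mem]
    by blast
qed

text \<open>Any element of the Lie algebra may be commuted past the lowering elements until it reaches the highest
  weight vectors, where its homogeneous components lower, rescale or annihilate. The invariance is
  proved for all elements at once because the commutators are arbitrary.\<close>

lemma joint_orbit_invariant:
  assumes rep: "representation L d \<rho>" "representation L d' \<rho>'"
    and v: "v \<in> weight_space L d \<rho> lam" "v' \<in> weight_space L d' \<rho>' lam"
    and up: "\<And>x. x \<in> lie_algebra L \<Longrightarrow> strictly_upper x \<Longrightarrow> \<rho> x *\<^sub>v v = 0\<^sub>v d \<and> \<rho>' x *\<^sub>v v' = 0\<^sub>v d'"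
    and "joint_orbit L \<rho> \<rho>' v v' u u'"
  shows "u \<in> carrier_vec d \<and> u' \<in> carrier_vec d' \<and>
    (\<forall>x\<in>lie_algebra L. joint_orbit L \<rho> \<rho>' v v' (\<rho> x *\<^sub>v u) (\<rho>' x *\<^sub>v u'))"
  using assms(6)
proof induction
  case orbit_base
  have cv: "v \<in> carrier_vec d" "v' \<in> carrier_vec d'"
    using v by (auto simp: weight_space_def)
  have zero: "joint_orbit L \<rho> \<rho>' v v' (0\<^sub>v d) (0\<^sub>v d')"
    using orbit_smult[OF joint_orbit.orbit_base, of L \<rho> \<rho>' v v' 0] cv
    by (simp add: zero_smult_vec_eq[of _ d] zero_smult_vec_eq[of _ d'])
  have "joint_orbit L \<rho> \<rho>' v v' (\<rho> x *\<^sub>v v) (\<rho>' x *\<^sub>v v')" if "x \<in> lie_algebra L" for x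
    using that
  proof (rule band_induct)
    have "strictly_upper (0\<^sub>m N N :: 'k mat)"
      by (simp add: strictly_upper_def)
    then show "joint_orbit L \<rho> \<rho>' v v' (\<rho> (0\<^sub>m N N) *\<^sub>v v) (\<rho>' (0\<^sub>m N N) *\<^sub>v v')"
      using up zero_mem zero by simp
  next
    fix y z j
    assume y: "y \<in> lie_algebra L" and z: "z \<in> lie_algebra L" and hom: "homogeneous j y"
      and IH: "joint_orbit L \<rho> \<rho>' v v' (\<rho> z *\<^sub>v v) (\<rho>' z *\<^sub>v v')"
    have "joint_orbit L \<rho> \<rho>' v v' (\<rho> y *\<^sub>v v) (\<rho>' y *\<^sub>v v')"
    proof -
      consider "j < 0" | "j = 0" | "j > 0"
        by linarith
      then show ?thesis
      proof cases
        case 1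
        then show ?thesis
          using y hom by (blast intro: orbit_lower joint_orbit.orbit_base)
      next
        case 2
        then have "diagonal_mat y"
          using hom by (auto simp: homogeneous_def diagonal_mat_def)
        then have "y \<in> cartan L"
          using y by (simp add: cartan_eq)
        then have "\<rho> y *\<^sub>v v = lam y \<cdot>\<^sub>v v" "\<rho>' y *\<^sub>v v' = lam y \<cdot>\<^sub>v v'"
          using v by (auto simp: weight_space_def)
        then show ?thesis
          by (simp add: joint_orbit.orbit_base joint_orbit.orbit_smult)
      next
        case 3
        then have "strictly_upper y"
          using hom by (fastforce simp: homogeneous_def strictly_upper_def)
        then show ?thesis
          using up y zero by simp
      qed
    qed
    then show "joint_orbit L \<rho> \<rho>' v v' (\<rho> (y + z) *\<^sub>v v) (\<rho>' (y + z) *\<^sub>v v')"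
      using representation_add_vec[OF rep(1) y z cv(1)] representation_add_vec[OF rep(2) y z cv(2)] IH
      by (simp add: orbit_add)
  qed
  with cv show ?case
    by blast
next
  case (orbit_lower u u' y j)
  have "joint_orbit L \<rho> \<rho>' v v' (\<rho> x *\<^sub>v (\<rho> y *\<^sub>v u)) (\<rho>' x *\<^sub>v (\<rho>' y *\<^sub>v u'))"
    if x: "x \<in> lie_algebra L" for x
  proof -
    have "joint_orbit L \<rho> \<rho>' v v' (\<rho> y *\<^sub>v (\<rho> x *\<^sub>v u)) (\<rho>' y *\<^sub>v (\<rho>' x *\<^sub>v u'))"
      using orbit_lower x by (blast intro: joint_orbit.orbit_lower)
    moreover have "joint_orbit L \<rho> \<rho>' v v' (\<rho> (lie_bracket x y) *\<^sub>v u) (\<rho>' (lie_bracket x y) *\<^sub>v u')"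
      using orbit_lower x bracket_closed by blast
    ultimately show ?thesis
      using representation_bracket_vec[OF rep(1) x orbit_lower(2), of u]
        representation_bracket_vec[OF rep(2) x orbit_lower(2), of u'] orbit_lower.IH
      by (simp add: orbit_add)
  qed
  moreover have "\<rho> y \<in> carrier_mat d d" "\<rho>' y \<in> carrier_mat d' d'"
    using rep orbit_lower by (auto dest: representationD)
  ultimately show ?case
    using orbit_lower.IH by auto
next
  case (orbit_add u u' w w')
  have "joint_orbit L \<rho> \<rho>' v v' (\<rho> x *\<^sub>v (u + w)) (\<rho>' x *\<^sub>v (u' + w'))" if "x \<in> lie_algebra L" for x
  proof -
    have "\<rho> x \<in> carrier_mat d d" "\<rho>' x \<in> carrier_mat d' d'"
      using rep that by (auto dest: representationD)
    then show ?thesis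
      using orbit_add.IH that
      by (simp add: mult_add_distrib_mat_vec[of _ d d] mult_add_distrib_mat_vec[of _ d' d'] joint_orbit.orbit_add)
  qed
  then show ?case
    using orbit_add.IH by auto
next
  case (orbit_smult u u' a)
  have "joint_orbit L \<rho> \<rho>' v v' (\<rho> x *\<^sub>v (a \<cdot>\<^sub>v u)) (\<rho>' x *\<^sub>v (a \<cdot>\<^sub>v u'))" if "x \<in> lie_algebra L" for x
  proof -
    have "\<rho> x \<in> carrier_mat d d" "\<rho>' x \<in> carrier_mat d' d'"
      using rep that by (auto dest: representationD)
    then show ?thesis
      using orbit_smult.IH that
      by (simp add: mult_mat_vec[of _ d d] mult_mat_vec[of _ d' d'] joint_orbit.orbit_smult)
  qed
  then show ?case
    using orbit_smult.IH by auto
qed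

text \<open>The generated submodule is the graph of an isomorphism. If it contained \<open>(0, w')\<close> with \<open>w'\<close> nonzero,
  then by simplicity it would contain \<open>(0, v')\<close>; but modulo lower eigenvectors it consists of the
  multiples of \<open>(v, v')\<close>. If it contained \<open>(w, 0)\<close> with \<open>w\<close> nonzero, it would contain \<open>(v, 0)\<close> and
  hence the difference \<open>(0, v')\<close>. Its projection to the first module is a nonzero submodule, hence
  everything, and the partner of a weight vector is a weight vector.\<close>

proposition weight_transfer:
  assumes simple: "simple_representation L d \<rho>" "simple_representation L d' \<rho>'"
    and high: "has_highest_weight L d \<rho> lam" "has_highest_weight L d' \<rho>' lam"
    and u: "u \<in> weight_space L d \<rho> \<mu>" "u \<noteq> 0\<^sub>v d"
  shows "\<exists>u'\<in>weight_space L d' \<rho>' \<mu>. u' \<noteq> 0\<^sub>v d'"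
proof -
  have rep: "representation L d \<rho>" "representation L d' \<rho>'"
    using simple by (simp_all add: simple_representation_def)
  obtain v where v: "v \<in> weight_space L d \<rho> lam" "v \<noteq> 0\<^sub>v d"
    and vk: "\<And>\<beta> x. \<beta> \<in> positive_roots L \<Longrightarrow> x \<in> root_space L \<beta> \<Longrightarrow> \<rho> x *\<^sub>v v = 0\<^sub>v d"
    using high(1) unfolding has_highest_weight_def by blast
  obtain v' where v': "v' \<in> weight_space L d' \<rho>' lam" "v' \<noteq> 0\<^sub>v d'"
    and vk': "\<And>\<beta> x. \<beta> \<in> positive_roots L \<Longrightarrow> x \<in> root_space L \<beta> \<Longrightarrow> \<rho>' x *\<^sub>v v' = 0\<^sub>v d'"
    using high(2) unfolding has_highest_weight_def by blast
  have cv: "v \<in> carrier_vec d" "v' \<in> carrier_vec d'"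
    using v v' by (auto simp: weight_space_def)
  let ?M = "joint_orbit L \<rho> \<rho>' v v'"
  have up: "\<rho> x *\<^sub>v v = 0\<^sub>v d \<and> \<rho>' x *\<^sub>v v' = 0\<^sub>v d'" if "x \<in> lie_algebra L" "strictly_upper x" for x
    using highest_weight_vector_killed[OF rep(1) cv(1) _ that] vk
      highest_weight_vector_killed[OF rep(2) cv(2) _ that] vk' by blast
  have M: "w \<in> carrier_vec d" "w' \<in> carrier_vec d'"
    "x \<in> lie_algebra L \<Longrightarrow> ?M (\<rho> x *\<^sub>v w) (\<rho>' x *\<^sub>v w')" if "?M w w'" for w w' x
    using joint_orbit_invariant[OF rep v(1) v'(1) up that] by blast+
  have zero: "?M (0\<^sub>v d) (0\<^sub>v d')"
    using orbit_smult[OF orbit_base, of L \<rho> \<rho>' v v' 0] cv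
    by (simp add: zero_smult_vec_eq[of _ d] zero_smult_vec_eq[of _ d'])
  have eig: "\<rho> (grading N) *\<^sub>v v = lam (grading N) \<cdot>\<^sub>v v"
    "\<rho>' (grading N) *\<^sub>v v' = lam (grading N) \<cdot>\<^sub>v v'"
    using v v' grading_cartan by (auto simp: weight_space_def)
  \<comment> \<open>The grading element separates the generator from everything below it.\<close>
  have not_vertical: "\<not> ?M (0\<^sub>v d) v'"
  proof
    assume "?M (0\<^sub>v d) v'"
    then obtain a n n' where n: "lower_sum d (\<rho> (grading N)) (lam (grading N)) n"
      "lower_sum d' (\<rho>' (grading N)) (lam (grading N)) n'"
      and eq: "0\<^sub>v d = a \<cdot>\<^sub>v v + n" "v' = a \<cdot>\<^sub>v v' + n'"
      using lower_sum_decomposition[OF rep cv(1) eig(1) cv(2) eig(2)] by blast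
    have cn: "n \<in> carrier_vec d" "n' \<in> carrier_vec d'"
      using n by (auto dest: lower_sum_carrier)
    show False
    proof (cases "a = 0")
      case True
      then have "v' = n'"
        using eq(2) cv(2) cn(2) zero_smult_vec_eq[OF cv(2)] by simp
      then show False
        using n(2) eigenvector_not_lower_sum[OF representationD[OF rep(2) grading_mem] cv(2) v'(2) eig(2)]
        by simp
    next
      case False
      have "v = (- 1 / a) \<cdot>\<^sub>v n"
      proof (rule eq_vecI)
        fix i assume "i < dim_vec ((- 1 / a) \<cdot>\<^sub>v n)"
        then have i: "i < d"
          using cn by simp
        have "0 = a * v $ i + n $ i"
          using arg_cong[OF eq(1), of "\<lambda>w. w $ i"] i cv cn by simp
        then show "v $ i = ((- 1 / a) \<cdot>\<^sub>v n) $ i"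
          using False i cn by (simp add: field_simps eq_neg_iff_add_eq_0)
      qed (use cv cn in auto)
      then show False
        using lower_sum_smult[OF n(1) representationD[OF rep(1) grading_mem], of "- 1 / a"]
          eigenvector_not_lower_sum[OF representationD[OF rep(1) grading_mem] cv(1) v(2) eig(1)]
        by simp
    qed
  qed
  have "{w'. ?M (0\<^sub>v d) w'} = {0\<^sub>v d'} \<or> {w'. ?M (0\<^sub>v d) w'} = carrier_vec d'"
  proof (rule simple_representation_invariant[OF simple(2)])
    show "w + w' \<in> {w'. ?M (0\<^sub>v d) w'}" if "w \<in> {w'. ?M (0\<^sub>v d) w'}" "w' \<in> {w'. ?M (0\<^sub>v d) w'}" for w w'
      using orbit_add[of L \<rho> \<rho>' v v' "0\<^sub>v d" w "0\<^sub>v d" w'] that by simp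
    show "a \<cdot>\<^sub>v w \<in> {w'. ?M (0\<^sub>v d) w'}" if "w \<in> {w'. ?M (0\<^sub>v d) w'}" for a w
      using orbit_smult[of L \<rho> \<rho>' v v' "0\<^sub>v d" w a] that by simp
    show "\<rho>' x *\<^sub>v w \<in> {w'. ?M (0\<^sub>v d) w'}" if "x \<in> lie_algebra L" "w \<in> {w'. ?M (0\<^sub>v d) w'}" for x w
    proof -
      have "\<rho> x *\<^sub>v 0\<^sub>v d = 0\<^sub>v d"
        using representationD[OF rep(1) that(1)] by auto
      then show ?thesis
        using M(3)[of "0\<^sub>v d" w x] that by simp
    qed
  qed (use zero M(2) in auto)
  then have vertical: "w' = 0\<^sub>v d'" if "?M (0\<^sub>v d) w'" for w'
    using that not_vertical cv by auto
  have "{w. ?M w (0\<^sub>v d')} = {0\<^sub>v d} \<or> {w. ?M w (0\<^sub>v d')} = carrier_vec d"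
  proof (rule simple_representation_invariant[OF simple(1)])
    show "w + w' \<in> {w. ?M w (0\<^sub>v d')}" if "w \<in> {w. ?M w (0\<^sub>v d')}" "w' \<in> {w. ?M w (0\<^sub>v d')}" for w w'
      using orbit_add[of L \<rho> \<rho>' v v' w "0\<^sub>v d'" w' "0\<^sub>v d'"] that by simp
    show "a \<cdot>\<^sub>v w \<in> {w. ?M w (0\<^sub>v d')}" if "w \<in> {w. ?M w (0\<^sub>v d')}" for a w
      using orbit_smult[of L \<rho> \<rho>' v v' w "0\<^sub>v d'" a] that by simp
    show "\<rho> x *\<^sub>v w \<in> {w. ?M w (0\<^sub>v d')}" if "x \<in> lie_algebra L" "w \<in> {w. ?M w (0\<^sub>v d')}" for x w
    proof -
      have "\<rho>' x *\<^sub>v 0\<^sub>v d' = 0\<^sub>v d'"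
        using representationD[OF rep(2) that(1)] by auto
      then show ?thesis
        using M(3)[of w "0\<^sub>v d'" x] that by simp
    qed
  qed (use zero M(1) in auto)
  moreover have "\<not> ?M v (0\<^sub>v d')"
  proof
    assume "?M v (0\<^sub>v d')"
    then have "?M (v + (- 1) \<cdot>\<^sub>v v) (v' + (- 1) \<cdot>\<^sub>v 0\<^sub>v d')"
      by (intro orbit_add orbit_smult orbit_base)
    moreover have "v + (- 1) \<cdot>\<^sub>v v = 0\<^sub>v d" "v' + (- 1) \<cdot>\<^sub>v 0\<^sub>v d' = v'"
      using cv by auto
    ultimately show False
      using not_vertical by simp
  qed
  ultimately have horizontal: "w = 0\<^sub>v d" if "?M w (0\<^sub>v d')" for w
    using that cv by auto
  have "{w. \<exists>w'. ?M w w'} = {0\<^sub>v d} \<or> {w. \<exists>w'. ?M w w'} = carrier_vec d"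
  proof (rule simple_representation_invariant[OF simple(1)])
    show "w + w' \<in> {w. \<exists>w'. ?M w w'}" if "w \<in> {w. \<exists>w'. ?M w w'}" "w' \<in> {w. \<exists>w'. ?M w w'}" for w w'
      using that by (auto intro: orbit_add)
    show "a \<cdot>\<^sub>v w \<in> {w. \<exists>w'. ?M w w'}" if "w \<in> {w. \<exists>w'. ?M w w'}" for a w
      using that by (auto intro: orbit_smult)
    show "\<rho> x *\<^sub>v w \<in> {w. \<exists>w'. ?M w w'}" if "x \<in> lie_algebra L" "w \<in> {w. \<exists>w'. ?M w w'}" for x w
      using that M(3) by blast
  qed (use zero M(1) in auto)
  moreover have "v \<in> {w. \<exists>w'. ?M w w'}"
    using orbit_base by blast
  moreover have cu: "u \<in> carrier_vec d"
    using u by (simp add: weight_space_def)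
  ultimately obtain u' where u': "?M u u'"
    using v(2) by blast
  have cu': "u' \<in> carrier_vec d'"
    using M(2)[OF u'] .
  have "u' \<noteq> 0\<^sub>v d'"
    using horizontal u' u(2) by blast
  moreover have "\<rho>' h *\<^sub>v u' = \<mu> h \<cdot>\<^sub>v u'" if h: "h \<in> cartan L" for h
  proof -
    have hL: "h \<in> lie_algebra L"
      using h by (simp add: cartan_eq)
    have ch: "\<rho>' h *\<^sub>v u' \<in> carrier_vec d'"
      using representationD[OF rep(2) hL] cu' by auto
    \<comment> \<open>Apply \<open>h - \<mu> h\<close> to the pair: the first component vanishes, hence so does the second.\<close>
    have "?M (\<rho> h *\<^sub>v u + (- \<mu> h) \<cdot>\<^sub>v u) (\<rho>' h *\<^sub>v u' + (- \<mu> h) \<cdot>\<^sub>v u')"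
      using u' hL by (intro orbit_add orbit_smult M(3))
    moreover have "\<rho> h *\<^sub>v u + (- \<mu> h) \<cdot>\<^sub>v u = 0\<^sub>v d"
      using u(1) h cu by (auto simp: weight_space_def)
    ultimately have eq: "\<rho>' h *\<^sub>v u' + (- \<mu> h) \<cdot>\<^sub>v u' = 0\<^sub>v d'"
      using vertical by simp
    show ?thesis
    proof (rule eq_vecI)
      fix i assume "i < dim_vec (\<mu> h \<cdot>\<^sub>v u')"
      then have i: "i < d'"
        using cu' by simp
      show "(\<rho>' h *\<^sub>v u') $ i = (\<mu> h \<cdot>\<^sub>v u') $ i"
        using arg_cong[OF eq, of "\<lambda>w. w $ i"] i cu' ch by (simp del: index_mult_mat_vec)
    qed (use carrier_vecD[OF ch] cu' in \<open>simp del: dim_mult_mat_vec\<close>)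
  qed
  ultimately show ?thesis
    using cu' by (auto simp: weight_space_def)
qed

end

section \<open>Multiplicity-free models\<close>

text \<open>The basis vector of the function space that belongs to a state.\<close>

definition delta :: "'i \<Rightarrow> 'i \<Rightarrow> 'k::zero_neq_one" where
  "delta t s = of_bool (s = t)"

text \<open>A module on the functions with support in a finite set of states, given by operators on all
  functions; working with all functions keeps the operators free of side conditions. The states
  have distinct weights, and every state is linked in both directions to one that is closer to the
  highest state.\<close>

locale weight_model = triangular_datum L N
  for L :: "'k::field_char_0 lie_datum" and N :: nat +
  fixes I :: "'i set" and X :: "'k mat \<Rightarrow> ('i \<Rightarrow> 'k) \<Rightarrow> 'i \<Rightarrow> 'k"
    and wt :: "'i \<Rightarrow> 'k weight" and top :: 'i and depth :: "'i \<Rightarrow> nat"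
  assumes finite_I: "finite I" and top_mem: "top \<in> I"
    and X_add_fun: "x \<in> lie_algebra L \<Longrightarrow> X x (\<lambda>s. f s + g s) s = X x f s + X x g s"
    and X_smult_fun: "x \<in> lie_algebra L \<Longrightarrow> X x (\<lambda>s. c * f s) s = c * X x f s"
    and X_support: "x \<in> lie_algebra L \<Longrightarrow> (\<And>s. s \<notin> I \<Longrightarrow> f s = 0) \<Longrightarrow> s \<notin> I \<Longrightarrow> X x f s = 0"
    and X_add: "x \<in> lie_algebra L \<Longrightarrow> y \<in> lie_algebra L \<Longrightarrow> X (x + y) f s = X x f s + X y f s"
    and X_smult: "x \<in> lie_algebra L \<Longrightarrow> X (c \<cdot>\<^sub>m x) f s = c * X x f s"
    and X_bracket: "x \<in> lie_algebra L \<Longrightarrow> y \<in> lie_algebra L \<Longrightarrow>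
      X (lie_bracket x y) f s = X x (X y f) s - X y (X x f) s"
    and X_cartan: "h \<in> cartan L \<Longrightarrow> (\<And>s. s \<notin> I \<Longrightarrow> f s = 0) \<Longrightarrow> s \<in> I \<Longrightarrow> X h f s = wt s h * f s"
    and X_top: "x \<in> lie_algebra L \<Longrightarrow> strictly_upper x \<Longrightarrow> s \<in> I \<Longrightarrow> X x (delta top) s = 0"
    and wt_separated: "s \<in> I \<Longrightarrow> t \<in> I \<Longrightarrow> s \<noteq> t \<Longrightarrow> \<exists>h\<in>cartan L. wt s h \<noteq> wt t h"
    and connected: "s \<in> I \<Longrightarrow> s \<noteq> top \<Longrightarrow> \<exists>t\<in>I. depth t < depth s \<and>
      (\<exists>x\<in>lie_algebra L. X x (delta s) t \<noteq> 0) \<and> (\<exists>x\<in>lie_algebra L. X x (delta t) s \<noteq> 0)"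
begin

definition dim :: nat where
  "dim = card I"

definition enum :: "nat \<Rightarrow> 'i" where
  "enum = (SOME e. bij_betw e {..<dim} I)"

definition vec_of :: "('i \<Rightarrow> 'k) \<Rightarrow> 'k vec" where
  "vec_of f = vec dim (\<lambda>i. f (enum i))"

definition fun_of :: "'k vec \<Rightarrow> 'i \<Rightarrow> 'k" where
  "fun_of v s = (\<Sum>i<dim. v $ i * delta (enum i) s)"

definition model_rep :: "'k mat \<Rightarrow> 'k mat" where
  "model_rep x = mat dim dim (\<lambda>(i, j). X x (delta (enum j)) (enum i))"

lemma enum_bij: "bij_betw enum {..<dim} I"
proof -
  have "\<exists>e. bij_betw e {..<dim} I"
    using ex_bij_betw_nat_finite[OF finite_I] by (simp add: dim_def atLeast0LessThan)
  then show ?thesis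
    unfolding enum_def by (rule someI_ex)
qed

lemma enum_mem: "i < dim \<Longrightarrow> enum i \<in> I"
  using enum_bij by (auto simp: bij_betw_def)

lemma enum_inj: "i < dim \<Longrightarrow> j < dim \<Longrightarrow> enum i = enum j \<longleftrightarrow> i = j"
  using enum_bij by (auto simp: bij_betw_def inj_on_def)

lemma enum_surj:
  assumes "s \<in> I"
  obtains i where "i < dim" "s = enum i"
  using assms enum_bij by (auto simp: bij_betw_def)

lemma vec_of_carrier [simp]: "vec_of f \<in> carrier_vec dim"
  by (simp add: vec_of_def)

lemma fun_of_enum:
  assumes "i < dim"
  shows "fun_of v (enum i) = v $ i"
proof -
  have "fun_of v (enum i) = (\<Sum>j<dim. if j = i then v $ j else 0)"
    unfolding fun_of_def by (rule sum.cong) (auto simp: delta_def enum_inj assms)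
  then show ?thesis
    using assms by simp
qed

lemma fun_of_support: "s \<notin> I \<Longrightarrow> fun_of v s = 0"
  unfolding fun_of_def by (rule sum.neutral) (auto simp: delta_def dest: enum_mem)

lemma fun_of_vec_of:
  assumes "\<And>s. s \<notin> I \<Longrightarrow> f s = 0"
  shows "fun_of (vec_of f) = f"
proof
  fix s
  show "fun_of (vec_of f) s = f s"
  proof (cases "s \<in> I")
    case True
    then obtain i where "i < dim" "s = enum i"
      by (rule enum_surj)
    then show ?thesis
      by (simp add: fun_of_enum vec_of_def)
  qed (simp add: assms fun_of_support)
qed

lemma X_sum:
  assumes "x \<in> lie_algebra L" "finite J"
  shows "X x (\<lambda>s. \<Sum>j\<in>J. c j * f j s) s = (\<Sum>j\<in>J. c j * X x (f j) s)"
  using assms(2)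
proof (induction J arbitrary: s rule: finite_induct)
  case empty
  then show ?case
    using X_smult_fun[OF assms(1), of 0 "\<lambda>s. 0" s] by simp
next
  case (insert j J)
  then show ?case
    by (simp add: X_add_fun X_smult_fun assms(1))
qed

lemma model_rep_vec:
  assumes x: "x \<in> lie_algebra L" and v: "v \<in> carrier_vec dim"
  shows "model_rep x *\<^sub>v v = vec_of (X x (fun_of v))"
proof (rule eq_vecI)
  fix i assume "i < dim_vec (vec_of (X x (fun_of v)))"
  then have i: "i < dim"
    by (simp add: vec_of_def)
  have "X x (fun_of v) s = (\<Sum>j<dim. v $ j * X x (delta (enum j)) s)" for s
    unfolding fun_of_def using x by (intro X_sum) auto
  with i v show "(model_rep x *\<^sub>v v) $ i = vec_of (X x (fun_of v)) $ i"
    by (simp add: model_rep_def vec_of_def scalar_prod_def atLeast0LessThan mult.commute)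
qed (simp add: model_rep_def vec_of_def)

lemma delta_support: "t \<in> I \<Longrightarrow> s \<notin> I \<Longrightarrow> delta t s = 0"
  by (auto simp: delta_def)

lemma model_rep_vec_of:
  assumes "x \<in> lie_algebra L" "\<And>s. s \<notin> I \<Longrightarrow> f s = 0"
  shows "model_rep x *\<^sub>v vec_of f = vec_of (X x f)"
  using assms by (simp add: model_rep_vec fun_of_vec_of)

lemma model_rep_carrier [simp]: "model_rep x \<in> carrier_mat dim dim"
  by (simp add: model_rep_def)

lemma model_rep_mult:
  assumes x: "x \<in> lie_algebra L" and y: "y \<in> lie_algebra L" and ij: "i < dim" "j < dim"
  shows "(model_rep x * model_rep y) $$ (i, j) = X x (X y (delta (enum j))) (enum i)"
proof -
  have "col (model_rep y) j = vec_of (X y (delta (enum j)))"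
    using ij by (intro eq_vecI) (auto simp: model_rep_def vec_of_def)
  moreover have "(model_rep x * model_rep y) $$ (i, j) = (model_rep x *\<^sub>v col (model_rep y) j) $ i"
    using ij by (simp add: model_rep_def)
  moreover have "X y (delta (enum j)) s = 0" if "s \<notin> I" for s
    by (rule X_support[OF y _ that]) (use enum_mem[OF ij(2)] in \<open>simp add: delta_support\<close>)
  ultimately show ?thesis
    using ij by (simp add: model_rep_vec_of[OF x]) (simp add: vec_of_def)
qed

lemma model_representation: "representation L dim model_rep"
  unfolding representation_def
proof (intro conjI ballI allI)
  fix x y
  assume x: "x \<in> lie_algebra L" and y: "y \<in> lie_algebra L"
  show "model_rep (x + y) = model_rep x + model_rep y"
    by (rule eq_matI) (auto simp: model_rep_def X_add x y)
  show "model_rep (lie_bracket x y) = lie_bracket (model_rep x) (model_rep y)"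
  proof (rule eq_matI)
    fix i j
    assume "i < dim_row (lie_bracket (model_rep x) (model_rep y))"
      "j < dim_col (lie_bracket (model_rep x) (model_rep y))"
    then have ij: "i < dim" "j < dim"
      by (simp_all add: lie_bracket_def model_rep_def)
    have "lie_bracket (model_rep x) (model_rep y) $$ (i, j) =
        (model_rep x * model_rep y) $$ (i, j) - (model_rep y * model_rep x) $$ (i, j)"
      using ij by (simp add: lie_bracket_def model_rep_def)
    then show "model_rep (lie_bracket x y) $$ (i, j) = lie_bracket (model_rep x) (model_rep y) $$ (i, j)"
      using ij x y by (simp add: model_rep_mult) (simp add: model_rep_def X_bracket)
  qed (simp_all add: lie_bracket_def model_rep_def)
next
  fix a x
  assume x: "x \<in> lie_algebra L"
  show "model_rep (a \<cdot>\<^sub>m x) = a \<cdot>\<^sub>m model_rep x"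
    by (rule eq_matI) (auto simp: model_rep_def X_smult x)
qed simp

lemma model_cartan:
  assumes h: "h \<in> cartan L" and v: "v \<in> carrier_vec dim" and i: "i < dim"
  shows "(model_rep h *\<^sub>v v) $ i = wt (enum i) h * v $ i"
proof -
  have "h \<in> lie_algebra L"
    using h by (simp add: cartan_eq)
  then have "model_rep h *\<^sub>v v = vec_of (X h (fun_of v))"
    using v by (rule model_rep_vec)
  then show ?thesis
    using i X_cartan[OF h _ enum_mem[OF i], of "fun_of v"] fun_of_support
    by (simp add: vec_of_def fun_of_enum)
qed

text \<open>Weights separate the states, so a suitable \<open>h - wt t h\<close> removes one state from the support of a vector
  while keeping another; induction on the size of the support isolates a single state.\<close>

lemma invariant_contains_basis:
  assumes W: "W \<subseteq> carrier_vec dim"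
    and add: "\<And>u w. u \<in> W \<Longrightarrow> w \<in> W \<Longrightarrow> u + w \<in> W"
    and smult: "\<And>c u. u \<in> W \<Longrightarrow> c \<cdot>\<^sub>v u \<in> W"
    and inv: "\<And>x u. x \<in> lie_algebra L \<Longrightarrow> u \<in> W \<Longrightarrow> model_rep x *\<^sub>v u \<in> W"
    and w: "w \<in> W" and s: "s \<in> I" and nz: "fun_of w s \<noteq> 0"
  shows "vec_of (delta s) \<in> W"
proof -
  obtain i where i: "i < dim" "s = enum i"
    using s by (rule enum_surj)
  have "w $ i \<noteq> 0"
    using nz i by (simp add: fun_of_enum)
  with w show ?thesis
  proof (induction "card {j. j < dim \<and> w $ j \<noteq> 0}" arbitrary: w rule: less_induct)
    case less
    have cw: "w \<in> carrier_vec dim"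
      using less.prems W by blast
    show ?case
    proof (cases "\<exists>j<dim. j \<noteq> i \<and> w $ j \<noteq> 0")
      case True
      then obtain j where j: "j < dim" "j \<noteq> i" "w $ j \<noteq> 0"
        by blast
      then obtain h where h: "h \<in> cartan L" "wt (enum i) h \<noteq> wt (enum j) h"
        using wt_separated[of "enum i" "enum j"] i(1) by (auto simp: enum_mem enum_inj)
      have hL: "h \<in> lie_algebra L"
        using h by (simp add: cartan_eq)
      define u where "u = model_rep h *\<^sub>v w + (- wt (enum j) h) \<cdot>\<^sub>v w"
      have uW: "u \<in> W"
        unfolding u_def using less.prems hL by (intro add smult inv)
      have u: "u $ k = (wt (enum k) h - wt (enum j) h) * w $ k" if "k < dim" for k
        using that cw model_cartan[OF h(1) cw that]
        by (simp add: u_def algebra_simps del: index_mult_mat_vec)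
      have "{k. k < dim \<and> u $ k \<noteq> 0} \<subseteq> {k. k < dim \<and> w $ k \<noteq> 0}"
        using u by auto
      moreover have "j \<in> {k. k < dim \<and> w $ k \<noteq> 0}" "j \<notin> {k. k < dim \<and> u $ k \<noteq> 0}"
        using j u by auto
      ultimately have "{k. k < dim \<and> u $ k \<noteq> 0} \<subset> {k. k < dim \<and> w $ k \<noteq> 0}"
        by blast
      then have "card {k. k < dim \<and> u $ k \<noteq> 0} < card {k. k < dim \<and> w $ k \<noteq> 0}"
        by (intro psubset_card_mono) auto
      moreover have "u $ i \<noteq> 0"
        using u i less.prems h by simp
      ultimately show ?thesis
        using less.hyps uW by blast
    next
      case False
      have "vec_of (delta s) = (1 / w $ i) \<cdot>\<^sub>v w"
        using cw False i less.prems
        by (intro eq_vecI) (auto simp: vec_of_def delta_def enum_inj)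
      then show ?thesis
        using smult less.prems by simp
    qed
  qed
qed

text \<open>From any basis vector in an invariant subspace one reaches the highest state along the links, and from
  there all others.\<close>

lemma model_simple: "simple_representation L dim model_rep"
  unfolding simple_representation_def
proof (intro conjI allI impI)
  show "representation L dim model_rep"
    by (rule model_representation)
  show "dim > 0"
    using top_mem finite_I by (auto simp: dim_def card_gt_0_iff)
  fix W :: "'k vec set"
  assume "subspace class_ring W (module_vec TYPE('k) dim)"
    and inv: "\<forall>x\<in>lie_algebra L. \<forall>w\<in>W. model_rep x *\<^sub>v w \<in> W"
  note W = subspace_module_vecD[OF this(1)]
  have basis: "vec_of (delta s) \<in> W" if "w \<in> W" "s \<in> I" "fun_of w s \<noteq> 0" for w s
    using W inv that by (intro invariant_contains_basis[of W w s]) auto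
  have step: "vec_of (delta t) \<in> W"
    if "vec_of (delta s) \<in> W" "s \<in> I" "t \<in> I" "x \<in> lie_algebra L" "X x (delta s) t \<noteq> 0" for s t x
  proof (rule basis)
    have supp: "X x (delta s) r = 0" if "r \<notin> I" for r
      by (rule X_support[OF \<open>x \<in> lie_algebra L\<close> _ that]) (simp add: \<open>s \<in> I\<close> delta_support)
    have "vec_of (X x (delta s)) = model_rep x *\<^sub>v vec_of (delta s)"
      using that by (simp add: model_rep_vec_of delta_support)
    then show "vec_of (X x (delta s)) \<in> W"
      using that inv by simp
    show "fun_of (vec_of (X x (delta s))) t \<noteq> 0"
      using that by (subst fun_of_vec_of) (auto intro: supp)
  qed fact
  have top: "vec_of (delta s) \<in> W \<longleftrightarrow> vec_of (delta top) \<in> W" if "s \<in> I" for s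
    using that
  proof (induction "depth s" arbitrary: s rule: less_induct)
    case less
    show ?case
    proof (cases "s = top")
      case False
      then obtain t x y where t: "t \<in> I" "depth t < depth s" and x: "x \<in> lie_algebra L" "X x (delta s) t \<noteq> 0"
        and y: "y \<in> lie_algebra L" "X y (delta t) s \<noteq> 0"
        using connected less.prems by blast
      have "vec_of (delta s) \<in> W \<longleftrightarrow> vec_of (delta t) \<in> W"
        using step[OF _ less.prems t(1) x] step[OF _ t(1) less.prems y] by blast
      with less.hyps t show ?thesis
        by blast
    qed simp
  qed
  show "W = {0\<^sub>v dim} \<or> W = carrier_vec dim"
  proof (cases "W = {0\<^sub>v dim}")
    case False
    then obtain w where w: "w \<in> W" "w \<noteq> 0\<^sub>v dim"
      using W(2) by blast
    then obtain i where i: "i < dim" "w $ i \<noteq> 0"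
      using W(1) by (metis carrier_vecD eq_vecI index_zero_vec subsetD)
    then have "vec_of (delta (enum i)) \<in> W"
      using basis w by (simp add: enum_mem fun_of_enum)
    then have all: "vec_of (delta s) \<in> W" if "s \<in> I" for s
      using top enum_mem i that by blast
    have "v \<in> W" if v: "v \<in> carrier_vec dim" for v
    proof -
      have "vec dim (\<lambda>i. if i < k then v $ i else 0) \<in> W" if "k \<le> dim" for k
        using that
      proof (induction k)
        case 0
        then show ?case
          using W(2) by (simp add: zero_vec_def)
      next
        case (Suc k)
        have "vec dim (\<lambda>i. if i < Suc k then v $ i else 0) =
            vec dim (\<lambda>i. if i < k then v $ i else 0) + v $ k \<cdot>\<^sub>v vec_of (delta (enum k))"
          using Suc.prems by (intro eq_vecI) (auto simp: vec_of_def delta_def enum_inj less_Suc_eq)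
        then show ?case
          using Suc W all enum_mem by simp
      qed
      from this[of dim] have "vec dim (\<lambda>i. if i < dim then v $ i else 0) \<in> W"
        by simp
      moreover have "vec dim (\<lambda>i. if i < dim then v $ i else 0) = v"
        using v by (intro eq_vecI) auto
      ultimately show ?thesis
        by simp
    qed
    with W(1) show ?thesis
      by blast
  qed simp
qed

lemma model_weight_vector:
  assumes "s \<in> I" "\<And>h. h \<in> cartan L \<Longrightarrow> \<mu> h = wt s h"
  shows "vec_of (delta s) \<in> weight_space L dim model_rep \<mu>" "vec_of (delta s) \<noteq> 0\<^sub>v dim"
proof -
  obtain i where i: "i < dim" "s = enum i"
    using assms(1) by (rule enum_surj)
  have "model_rep h *\<^sub>v vec_of (delta s) = \<mu> h \<cdot>\<^sub>v vec_of (delta s)" if h: "h \<in> cartan L" for h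
  proof (rule eq_vecI)
    fix j assume "j < dim_vec (\<mu> h \<cdot>\<^sub>v vec_of (delta s))"
    then have "j < dim"
      by (simp add: vec_of_def)
    then show "(model_rep h *\<^sub>v vec_of (delta s)) $ j = (\<mu> h \<cdot>\<^sub>v vec_of (delta s)) $ j"
      using model_cartan[OF h, of "vec_of (delta s)" j] assms(2)[OF h] i
      by (auto simp: vec_of_def delta_def enum_inj simp del: index_mult_mat_vec)
  qed (simp add: model_rep_def vec_of_def)
  then show "vec_of (delta s) \<in> weight_space L dim model_rep \<mu>"
    by (simp add: weight_space_def)
  have "vec_of (delta s) $ i = 1"
    using i by (simp add: vec_of_def delta_def)
  then show "vec_of (delta s) \<noteq> 0\<^sub>v dim"
    using i(1) by auto
qed

text \<open>An arbitrary simple module with this highest weight has the weights of the model by the transfer of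
  weights, and in the model every weight vector has a nonzero coordinate at some state.\<close>

proposition weights_eq:
  assumes lam: "\<And>h. h \<in> cartan L \<Longrightarrow> lam h = wt top h"
  shows "weights L lam = (\<lambda>s. restrict (wt s) (cartan L)) ` I"
proof -
  have high: "has_highest_weight L dim model_rep lam"
    unfolding has_highest_weight_def
  proof (intro bexI conjI ballI)
    show "vec_of (delta top) \<in> weight_space L dim model_rep lam" "vec_of (delta top) \<noteq> 0\<^sub>v dim"
      using model_weight_vector[OF top_mem lam] by auto
    fix \<beta> x
    assume "\<beta> \<in> positive_roots L" "x \<in> root_space L \<beta>"
    then have x: "x \<in> lie_algebra L" "strictly_upper x"
      using positive_root_strictly_upper by (auto simp: root_space_def)
    have "model_rep x *\<^sub>v vec_of (delta top) = vec_of (X x (delta top))"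
      using x by (simp add: model_rep_vec_of delta_support top_mem)
    also have "\<dots> = 0\<^sub>v dim"
      using x by (intro eq_vecI) (auto simp: vec_of_def X_top enum_mem)
    finally show "model_rep x *\<^sub>v vec_of (delta top) = 0\<^sub>v dim" .
  qed
  show ?thesis
  proof (intro equalityI subsetI)
    fix \<mu> assume "\<mu> \<in> weights L lam"
    then obtain d \<rho> u where ext: "\<mu> \<in> extensional (cartan L)"
      and \<rho>: "simple_representation L d \<rho>" "has_highest_weight L d \<rho> lam"
      and u: "u \<in> weight_space L d \<rho> \<mu>" "u \<noteq> 0\<^sub>v d"
      by (auto simp: weights_def)
    obtain u' where u': "u' \<in> weight_space L dim model_rep \<mu>" "u' \<noteq> 0\<^sub>v dim"
      using weight_transfer[OF \<rho>(1) model_simple \<rho>(2) high u] by blast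
    then have cu: "u' \<in> carrier_vec dim"
      by (simp add: weight_space_def)
    then obtain i where i: "i < dim" "u' $ i \<noteq> 0"
      using u'(2) by (metis carrier_vecD eq_vecI index_zero_vec)
    have "\<mu> h = wt (enum i) h" if h: "h \<in> cartan L" for h
    proof -
      have "model_rep h *\<^sub>v u' = \<mu> h \<cdot>\<^sub>v u'"
        using u'(1) h by (simp add: weight_space_def)
      then have "wt (enum i) h * u' $ i = \<mu> h * u' $ i"
        using model_cartan[OF h cu i(1)] i cu by simp
      then show ?thesis
        using i by simp
    qed
    then have "\<mu> = restrict (wt (enum i)) (cartan L)"
      using ext by (intro extensionalityI[of _ "cartan L"]) auto
    then show "\<mu> \<in> (\<lambda>s. restrict (wt s) (cartan L)) ` I"
      using enum_mem i by blast
  next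
    fix \<mu> assume "\<mu> \<in> (\<lambda>s. restrict (wt s) (cartan L)) ` I"
    then obtain s where "s \<in> I" "\<mu> = restrict (wt s) (cartan L)"
      by blast
    then show "\<mu> \<in> weights L lam"
      using model_simple high model_weight_vector[of s \<mu>] unfolding weights_def by auto
  qed
qed

lemma restricted_weights_inj: "inj_on (\<lambda>s. restrict (wt s) (cartan L)) I"
proof (rule inj_onI, rule ccontr)
  fix s t
  assume st: "s \<in> I" "t \<in> I" "restrict (wt s) (cartan L) = restrict (wt t) (cartan L)" "s \<noteq> t"
  then obtain h where "h \<in> cartan L" "wt s h \<noteq> wt t h"
    using wt_separated by blast
  then show False
    using fun_cong[OF st(3), of h] by simp
qed

lemma covers_iff:
  assumes "\<And>h. h \<in> cartan L \<Longrightarrow> lam h = wt top h" and "s \<in> I" "t \<in> I"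
  shows "(restrict (wt s) (cartan L), restrict (wt t) (cartan L)) \<in> covers L lam \<longleftrightarrow>
    (\<exists>\<alpha>\<in>simple_roots L. \<forall>h\<in>cartan L. wt t h - wt s h = \<alpha> h)"
proof -
  have "weights L lam = (\<lambda>s. restrict (wt s) (cartan L)) ` I"
    using assms(1) by (rule weights_eq)
  with assms(2,3) show ?thesis
    unfolding covers_def by auto
qed

end

section \<open>The classical Lie algebras are triangular\<close>

text \<open>The part of the definition of a positive root that does not mention root vectors, isolated because it is
  closed under addition.\<close>

definition positive_combination :: "'k::field weight set \<Rightarrow> 'k weight \<Rightarrow> bool" where
  "positive_combination R \<beta> \<longleftrightarrow>
    (\<exists>c :: 'k weight \<Rightarrow> nat. (\<exists>\<alpha>\<in>R. c \<alpha> \<noteq> 0) \<and> \<beta> = (\<lambda>h. \<Sum>\<alpha>\<in>R. of_nat (c \<alpha>) * \<alpha> h))"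

lemma positive_combination_base:
  assumes "finite R" "\<alpha> \<in> R"
  shows "positive_combination R \<alpha>"
  unfolding positive_combination_def
proof (intro exI conjI bexI)
  show "\<alpha> = (\<lambda>h. \<Sum>\<gamma>\<in>R. of_nat (of_bool (\<gamma> = \<alpha>)) * \<gamma> h)"
  proof
    fix h
    have "(\<Sum>\<gamma>\<in>R. of_nat (of_bool (\<gamma> = \<alpha>)) * \<gamma> h) = (\<Sum>\<gamma>\<in>R. if \<gamma> = \<alpha> then \<gamma> h else 0)"
      by (rule sum.cong) auto
    then show "\<alpha> h = (\<Sum>\<gamma>\<in>R. of_nat (of_bool (\<gamma> = \<alpha>)) * \<gamma> h)"
      using assms by simp
  qed
qed (use assms in auto)

lemma positive_combination_add:
  assumes "positive_combination R \<beta>" "positive_combination R \<gamma>"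
  shows "positive_combination R (\<lambda>h. \<beta> h + \<gamma> h)"
proof -
  obtain b c :: "'a weight \<Rightarrow> nat" where "\<exists>\<alpha>\<in>R. b \<alpha> \<noteq> 0"
    and eq: "\<beta> = (\<lambda>h. \<Sum>\<alpha>\<in>R. of_nat (b \<alpha>) * \<alpha> h)" "\<gamma> = (\<lambda>h. \<Sum>\<alpha>\<in>R. of_nat (c \<alpha>) * \<alpha> h)"
    using assms unfolding positive_combination_def by auto
  then have "\<exists>\<alpha>\<in>R. b \<alpha> + c \<alpha> \<noteq> 0"
    by auto
  then show ?thesis
    unfolding positive_combination_def eq
    by (intro exI[of _ "\<lambda>\<alpha>. b \<alpha> + c \<alpha>"]) (simp add: distrib_right sum.distrib)
qed

text \<open>Roots of the classical types are differences \<open>f a - f b\<close> of diagonal entries, and the consecutive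
  differences are simple roots. The summand \<open>\<gamma>\<close> allows the chain of differences to be empty.\<close>

lemma positive_combination_telescope_add:
  assumes "a \<le> b" "positive_combination R \<gamma>"
    and "\<And>i. a \<le> i \<Longrightarrow> i < b \<Longrightarrow> positive_combination R (\<lambda>h. f i h - f (Suc i) h)"
  shows "positive_combination R (\<lambda>h. f a h - f b h + \<gamma> h)"
  using assms(1,3)
proof (induction b rule: dec_induct)
  case base
  then show ?case
    using assms(2) by simp
next
  case (step b)
  have "positive_combination R (\<lambda>h. f a h - f b h + \<gamma> h)"
    by (rule step.IH) (auto intro: step.prems)
  moreover have "positive_combination R (\<lambda>h. f b h - f (Suc b) h)"
    using step by auto
  ultimately have "positive_combination R (\<lambda>h. (f a h - f b h + \<gamma> h) + (f b h - f (Suc b) h))"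
    by (rule positive_combination_add)
  then show ?case
    by (simp add: algebra_simps)
qed

lemma positive_combination_telescope:
  assumes "a < b"
    and step: "\<And>i. a \<le> i \<Longrightarrow> i < b \<Longrightarrow> positive_combination R (\<lambda>h. f i h - f (Suc i) h)"
  shows "positive_combination R (\<lambda>h. f a h - f b h)"
proof -
  have "positive_combination R (\<lambda>h. f (Suc a) h - f b h + (f a h - f (Suc a) h))"
    using assms by (intro positive_combination_telescope_add) auto
  then show ?thesis
    by simp
qed

lemma positive_rootI:
  assumes "positive_combination (simple_roots L) \<beta>" "x \<in> root_space L \<beta>"
    and "x \<in> carrier_mat N N" "x $$ (a, b) \<noteq> 0" "a < N" "b < N"
  shows "\<beta> \<in> positive_roots L"
proof -
  have "x \<noteq> 0\<^sub>m (dim_row x) (dim_col x)"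
    using assms(3-6) by (metis carrier_matD index_zero_mat(1))
  then show ?thesis
    using assms(1,2) unfolding positive_roots_def positive_combination_def by blast
qed

lemma diagonal_mat_eq:
  assumes "h \<in> carrier_mat N N" "diagonal_mat h"
  shows "h = mat_diag N (\<lambda>i. h $$ (i, i))"
  using assms by (intro eq_matI) (auto simp: mat_diag_def diagonal_mat_def)

lemma lie_bracket_cartan:
  fixes x :: "'k::field mat"
  assumes "h \<in> carrier_mat N N" "diagonal_mat h" "x \<in> carrier_mat N N" "a < N" "b < N"
  shows "lie_bracket h x $$ (a, b) = (h $$ (a, a) - h $$ (b, b)) * x $$ (a, b)"
  by (subst diagonal_mat_eq[OF assms(1,2)]) (use assms in \<open>simp add: lie_bracket_diag\<close>)

text \<open>Diagonal matrices act on the entry in row \<open>a\<close> and column \<open>b\<close> by the difference of their diagonal entries.\<close>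

lemma root_spaceI:
  fixes x :: "'k::field mat"
  assumes x: "x \<in> lie_algebra L" and c: "lie_algebra L \<subseteq> carrier_mat N N"
    and cartan: "cartan L = {h \<in> lie_algebra L. diagonal_mat h}"
    and ent: "\<And>h a b. h \<in> cartan L \<Longrightarrow> a < N \<Longrightarrow> b < N \<Longrightarrow> x $$ (a, b) \<noteq> 0 \<Longrightarrow>
      \<beta> h = h $$ (a, a) - h $$ (b, b)"
  shows "x \<in> root_space L \<beta>"
proof -
  have "lie_bracket h x = \<beta> h \<cdot>\<^sub>m x" if h: "h \<in> cartan L" for h
  proof -
    have ch: "h \<in> carrier_mat N N" "diagonal_mat h" "x \<in> carrier_mat N N"
      using h x c cartan by auto
    have "lie_bracket h x \<in> carrier_mat N N"
      using ch by (simp add: lie_bracket_carrier)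
    moreover have "lie_bracket h x $$ (i, j) = \<beta> h * x $$ (i, j)" if "i < N" "j < N" for i j
      using ch ent[OF h that] that by (cases "x $$ (i, j) = 0") (auto simp: lie_bracket_cartan)
    ultimately show ?thesis
      using ch by (intro eq_matI) auto
  qed
  with x show ?thesis
    by (simp add: root_space_def)
qed

subsection \<open>Special linear Lie algebras\<close>

lemma trace_mult_comm:
  fixes x y :: "'k::field mat"
  assumes "x \<in> carrier_mat N N" "y \<in> carrier_mat N N"
  shows "(\<Sum>i<N. (x * y) $$ (i, i)) = (\<Sum>i<N. (y * x) $$ (i, i))"
proof -
  have "(\<Sum>i<N. (x * y) $$ (i, i)) = (\<Sum>i<N. \<Sum>j<N. x $$ (i, j) * y $$ (j, i))"
    using assms by (simp add: scalar_prod_def atLeast0LessThan)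
  also have "\<dots> = (\<Sum>j<N. \<Sum>i<N. y $$ (j, i) * x $$ (i, j))"
    by (subst sum.swap) (simp add: mult.commute)
  also have "\<dots> = (\<Sum>i<N. (y * x) $$ (i, i))"
    using assms by (simp add: scalar_prod_def atLeast0LessThan)
  finally show ?thesis .
qed

lemma grading_entry: "i < N \<Longrightarrow> grading N $$ (i, i) = of_nat N - 1 - 2 * of_nat i"
  by (simp add: grading_def mat_diag_def)

lemma sum_grading: "(\<Sum>i<N. of_int (int N - 1 - 2 * int i)) = (0 :: 'k::field_char_0)"
proof -
  have "(\<Sum>i<M. 2 * int i) = int M * (int M - 1)" for M
    by (induction M) (auto simp: algebra_simps)
  then have "(\<Sum>i<N. int N - 1 - 2 * int i) = 0"
    by (simp add: sum_subtractf algebra_simps)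
  then show ?thesis
    by (simp only: of_int_sum[symmetric] of_int_0)
qed

lemma triangular_type_A: "triangular_datum (type_A n :: 'k::field_char_0 lie_datum) (n + 1)"
proof
  let ?L = "type_A n :: 'k lie_datum"
  let ?N = "n + 1"
  show c: "lie_algebra ?L \<subseteq> carrier_mat ?N ?N"
    by (auto simp: type_A_def sl_def)
  show cartan: "cartan ?L = {h \<in> lie_algebra ?L. diagonal_mat h}"
    by (auto simp: type_A_def)
  show "x + y \<in> lie_algebra ?L" if "x \<in> lie_algebra ?L" "y \<in> lie_algebra ?L" for x y
    using that by (auto simp: type_A_def sl_def sum.distrib simp del: sum.lessThan_Suc)
  show "a \<cdot>\<^sub>m x \<in> lie_algebra ?L" if "x \<in> lie_algebra ?L" for a x
    using that by (auto simp: type_A_def sl_def simp del: sum.lessThan_Suc simp flip: sum_distrib_left)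
  show "lie_bracket x y \<in> lie_algebra ?L" if "x \<in> lie_algebra ?L" "y \<in> lie_algebra ?L" for x y
  proof -
    have xy: "x \<in> carrier_mat ?N ?N" "y \<in> carrier_mat ?N ?N"
      using that c by auto
    have "(\<Sum>i<?N. lie_bracket x y $$ (i, i)) = (\<Sum>i<?N. (x * y) $$ (i, i)) - (\<Sum>i<?N. (y * x) $$ (i, i))"
      using xy by (simp add: lie_bracket_def flip: sum_subtractf)
    then show ?thesis
      using trace_mult_comm[OF xy] lie_bracket_carrier[OF xy] by (simp add: type_A_def sl_def)
  qed
  show "band j x \<in> lie_algebra ?L" if "x \<in> lie_algebra ?L" for j x
    using that by (cases "j = 0") (auto simp: type_A_def sl_def band_def simp del: sum.lessThan_Suc)
  show "grading ?N \<in> lie_algebra ?L"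
    using sum_grading[of ?N]
    by (auto simp: type_A_def sl_def grading_def mat_diag_def simp del: sum.lessThan_Suc)
  show fin: "finite (simple_roots ?L)"
    by (simp add: type_A_def)
  show "\<exists>k>0. \<alpha> (grading ?N) = of_nat k" if "\<alpha> \<in> simple_roots ?L" for \<alpha>
    using that by (intro exI[of _ 2]) (auto simp: type_A_def eps_def grading_entry of_nat_diff)
  fix x a b
  assume x: "x \<in> lie_algebra ?L" "strictly_upper x" and ab: "a < ?N" "b < ?N" "x $$ (a, b) \<noteq> 0"
  have "a < b"
    using x ab c by (auto simp: strictly_upper_def)
  define y where "y = mat ?N ?N (\<lambda>(i, j). if i = a \<and> j = b then x $$ (a, b) else 0)"
  define \<beta> :: "'k weight" where "\<beta> = (\<lambda>h. eps (Suc a) h - eps (Suc b) h)"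
  have yL: "y \<in> lie_algebra ?L"
    using ab \<open>a < b\<close> by (auto simp: type_A_def sl_def y_def intro!: sum.neutral simp del: sum.lessThan_Suc)
  then have root: "y \<in> root_space ?L \<beta>"
    using c cartan by (rule root_spaceI) (auto simp: y_def \<beta>_def eps_def split: if_splits)
  have "positive_combination (simple_roots ?L) \<beta>"
    unfolding \<beta>_def
  proof (rule positive_combination_telescope[where f = "\<lambda>i. eps (Suc i)", OF \<open>a < b\<close>])
    fix i assume "a \<le> i" "i < b"
    then show "positive_combination (simple_roots ?L) (\<lambda>h. eps (Suc i) h - eps (Suc (Suc i)) h)"
      using ab by (intro positive_combination_base[OF fin]) (auto simp: type_A_def intro!: exI[of _ "Suc i"])
  qed
  then have "\<beta> \<in> positive_roots ?L"
    using root by (rule positive_rootI[where a = a and b = b and N = ?N]) (use ab in \<open>auto simp: y_def\<close>)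
  with root show "\<exists>\<beta>\<in>positive_roots ?L. \<exists>y\<in>root_space ?L \<beta>.
      y $$ (a, b) = x $$ (a, b) \<and> (\<forall>i<?N. \<forall>j<?N. y $$ (i, j) \<in> {0, x $$ (i, j)})"
    using ab by (intro bexI[of _ \<beta>] bexI[of _ y]) (auto simp: y_def)
qed

subsection \<open>Orthogonal Lie algebras\<close>

text \<open>The antidiagonal Gram matrix turns transposition into reflection in the antidiagonal.\<close>

lemma so_iff:
  fixes x :: "'k::field mat"
  shows "x \<in> so N \<longleftrightarrow> x \<in> carrier_mat N N \<and>
    (\<forall>a<N. \<forall>b<N. x $$ (a, b) = - x $$ (N - 1 - b, N - 1 - a))"
proof (cases "x \<in> carrier_mat N N")
  case True
  have ent: "(transpose_mat x * antidiag N + antidiag N * x) $$ (a, b) =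
      x $$ (N - 1 - b, a) + x $$ (N - 1 - a, b)" if ab: "a < N" "b < N" for a b
  proof -
    have J: "antidiag N $$ (c, b) = (if c = N - 1 - b then 1 else (0 :: 'k))"
      "antidiag N $$ (a, c) = (if c = N - 1 - a then 1 else (0 :: 'k))" if "c < N" for c
      using that ab by (auto simp: antidiag_def)
    have cJ: "(antidiag N :: 'k mat) \<in> carrier_mat N N"
      by (simp add: antidiag_def)
    have "(transpose_mat x * antidiag N) $$ (a, b) = (\<Sum>c<N. x $$ (c, a) * antidiag N $$ (c, b))"
      using True ab cJ by (simp add: scalar_prod_def atLeast0LessThan)
    also have "\<dots> = (\<Sum>c<N. if c = N - 1 - b then x $$ (c, a) else 0)"
      by (rule sum.cong) (auto simp: J)
    finally have "(transpose_mat x * antidiag N) $$ (a, b) = x $$ (N - 1 - b, a)"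
      using ab by simp
    moreover have "(antidiag N * x) $$ (a, b) = (\<Sum>c<N. antidiag N $$ (a, c) * x $$ (c, b))"
      using True ab cJ by (simp add: scalar_prod_def atLeast0LessThan)
    moreover have "\<dots> = (\<Sum>c<N. if c = N - 1 - a then x $$ (c, b) else 0)"
      by (rule sum.cong) (auto simp: J)
    moreover have "\<dots> = x $$ (N - 1 - a, b)"
      using ab by simp
    moreover have "transpose_mat x * antidiag N \<in> carrier_mat N N" "antidiag N * x \<in> carrier_mat N N"
      using True by (auto simp: antidiag_def)
    ultimately show ?thesis
      using ab by (subst index_add_mat(1)) (auto simp del: index_mult_mat)
  qed
  have "x \<in> so N \<longleftrightarrow> (\<forall>a<N. \<forall>b<N. (transpose_mat x * antidiag N + antidiag N * x) $$ (a, b) = 0)"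
    using True by (auto simp: so_def antidiag_def mat_eq_iff)
  also have "\<dots> \<longleftrightarrow> (\<forall>a<N. \<forall>b<N. x $$ (N - 1 - b, a) + x $$ (N - 1 - a, b) = 0)"
    using ent by simp
  also have "\<dots> \<longleftrightarrow> (\<forall>a<N. \<forall>b<N. x $$ (a, b) = - x $$ (N - 1 - b, N - 1 - a))"
  proof
    assume *: "\<forall>a<N. \<forall>b<N. x $$ (N - 1 - b, a) + x $$ (N - 1 - a, b) = 0"
    show "\<forall>a<N. \<forall>b<N. x $$ (a, b) = - x $$ (N - 1 - b, N - 1 - a)"
    proof (intro allI impI)
      fix a b assume "a < N" "b < N"
      then show "x $$ (a, b) = - x $$ (N - 1 - b, N - 1 - a)"
        using *[rule_format, of "N - 1 - a" b] by (simp add: eq_neg_iff_add_eq_0 add.commute)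
    qed
  next
    assume *: "\<forall>a<N. \<forall>b<N. x $$ (a, b) = - x $$ (N - 1 - b, N - 1 - a)"
    show "\<forall>a<N. \<forall>b<N. x $$ (N - 1 - b, a) + x $$ (N - 1 - a, b) = 0"
    proof (intro allI impI)
      fix a b assume "a < N" "b < N"
      then show "x $$ (N - 1 - b, a) + x $$ (N - 1 - a, b) = 0"
        using *[rule_format, of "N - 1 - a" b] by simp
    qed
  qed
  finally show ?thesis
    using True by blast
qed (simp add: so_def)

lemma so_lie_bracket:
  fixes x y :: "'k::field mat"
  assumes x: "x \<in> so N" and y: "y \<in> so N"
  shows "lie_bracket x y \<in> so N"
proof -
  have c: "x \<in> carrier_mat N N" "y \<in> carrier_mat N N"
    using x y by (simp_all add: so_iff)
  have prod: "(u * w) $$ (a, b) = (\<Sum>i<N. u $$ (a, i) * w $$ (i, b))"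
    if "u \<in> carrier_mat N N" "w \<in> carrier_mat N N" "a < N" "b < N" for u w :: "'k mat" and a b
    using that by (simp add: scalar_prod_def atLeast0LessThan)
  have flip: "(u * w) $$ (N - 1 - b, N - 1 - a) = (w * u) $$ (a, b)"
    if u: "u \<in> so N" and w: "w \<in> so N" and ab: "a < N" "b < N" for u w :: "'k mat" and a b
  proof -
    have c: "u \<in> carrier_mat N N" "w \<in> carrier_mat N N"
      and su: "\<And>i j. i < N \<Longrightarrow> j < N \<Longrightarrow> u $$ (i, j) = - u $$ (N - 1 - j, N - 1 - i)"
      and sw: "\<And>i j. i < N \<Longrightarrow> j < N \<Longrightarrow> w $$ (i, j) = - w $$ (N - 1 - j, N - 1 - i)"
      using u w unfolding so_iff by blast+
    have "(u * w) $$ (N - 1 - b, N - 1 - a) = (\<Sum>i<N. u $$ (N - 1 - b, i) * w $$ (i, N - 1 - a))"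
      using c ab by (intro prod) auto
    also have "\<dots> = (\<Sum>i<N. w $$ (a, i) * u $$ (i, b))"
    proof (rule sum.reindex_bij_witness[of _ "\<lambda>i. N - 1 - i" "\<lambda>i. N - 1 - i"])
      fix i assume i: "i \<in> {..<N}"
      have "u $$ (N - 1 - i, b) = - u $$ (N - 1 - b, N - 1 - (N - 1 - i))"
        "w $$ (a, N - 1 - i) = - w $$ (N - 1 - (N - 1 - i), N - 1 - a)"
        by (rule su sw; use ab i in auto)+
      then show "w $$ (a, N - 1 - i) * u $$ (N - 1 - i, b) = u $$ (N - 1 - b, i) * w $$ (i, N - 1 - a)"
        using i by simp
    qed auto
    also have "\<dots> = (w * u) $$ (a, b)"
      using prod[of w u a b] c ab by simp
    finally show ?thesis .
  qed
  have "lie_bracket x y $$ (a, b) = - lie_bracket x y $$ (N - 1 - b, N - 1 - a)" if "a < N" "b < N" for a b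
  proof -
    have "lie_bracket x y $$ (i, j) = (x * y) $$ (i, j) - (y * x) $$ (i, j)" if "i < N" "j < N" for i j
      using that c by (simp add: lie_bracket_def)
    then show ?thesis
      using that flip[OF x y that] flip[OF y x that] by simp
  qed
  then show ?thesis
    using lie_bracket_carrier[OF c] unfolding so_iff by blast
qed

text \<open>The root vectors are supported on an entry and its mirror image. The functions \<open>f i\<close> agree with the
  diagonal entries on the Cartan subalgebra only: simple roots are functions on all matrices, and
  expressing a root by them requires a formula that is valid on all matrices, so that the lower half of
  the diagonal has to be written in terms of the upper half.\<close>

lemma triangular_orthogonal:
  fixes L :: "'k::field_char_0 lie_datum"
  assumes L: "lie_algebra L = so N" and cartan: "cartan L = {h \<in> so N. diagonal_mat h}"
    and fin: "finite (simple_roots L)"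
    and grad: "\<And>\<alpha>. \<alpha> \<in> simple_roots L \<Longrightarrow> \<exists>k>0. \<alpha> (grading N) = of_nat k"
    and f: "\<And>h i. h \<in> cartan L \<Longrightarrow> i < N \<Longrightarrow> f i h = h $$ (i, i)"
    and comb: "\<And>a b. a < b \<Longrightarrow> b < N \<Longrightarrow> a + b \<noteq> N - 1 \<Longrightarrow>
      positive_combination (simple_roots L) (\<lambda>h. f a h - f b h)"
  shows "triangular_datum L N"
proof
  show c: "lie_algebra L \<subseteq> carrier_mat N N"
    by (auto simp: L so_iff)
  show cartan': "cartan L = {h \<in> lie_algebra L. diagonal_mat h}"
    by (simp add: L cartan)
  show "x + y \<in> lie_algebra L" if "x \<in> lie_algebra L" "y \<in> lie_algebra L" for x y
    unfolding L so_iff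
  proof (intro conjI allI impI)
    show "x + y \<in> carrier_mat N N"
      using that c by auto
    fix a b assume ab: "a < N" "b < N"
    have "x $$ (a, b) = - x $$ (N - 1 - b, N - 1 - a)" "y $$ (a, b) = - y $$ (N - 1 - b, N - 1 - a)"
      using that ab unfolding L so_iff by blast+
    then show "(x + y) $$ (a, b) = - (x + y) $$ (N - 1 - b, N - 1 - a)"
      using that ab c by auto
  qed
  show "e \<cdot>\<^sub>m x \<in> lie_algebra L" if "x \<in> lie_algebra L" for e x
    unfolding L so_iff
  proof (intro conjI allI impI)
    show "e \<cdot>\<^sub>m x \<in> carrier_mat N N"
      using that c by auto
    fix a b assume ab: "a < N" "b < N"
    have "x $$ (a, b) = - x $$ (N - 1 - b, N - 1 - a)"
      using that ab unfolding L so_iff by blast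
    then show "(e \<cdot>\<^sub>m x) $$ (a, b) = - (e \<cdot>\<^sub>m x) $$ (N - 1 - b, N - 1 - a)"
      using that ab c by auto
  qed
  show "lie_bracket x y \<in> lie_algebra L" if "x \<in> lie_algebra L" "y \<in> lie_algebra L" for x y
    using that so_lie_bracket by (simp add: L)
  show "band j x \<in> lie_algebra L" if "x \<in> lie_algebra L" for j x
    unfolding L so_iff
  proof (intro conjI allI impI)
    have cx: "x \<in> carrier_mat N N"
      using that c by blast
    then show "band j x \<in> carrier_mat N N"
      by (auto simp: band_def)
    fix a b assume ab: "a < N" "b < N"
    have "x $$ (a, b) = - x $$ (N - 1 - b, N - 1 - a)"
      using that ab unfolding L so_iff by blast
    moreover have "int (N - 1 - a) - int (N - 1 - b) = int b - int a"
      using ab by linarith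
    ultimately show "band j x $$ (a, b) = - band j x $$ (N - 1 - b, N - 1 - a)"
      using cx ab by (simp add: band_def)
  qed
  show "grading N \<in> lie_algebra L"
    by (auto simp: L so_iff grading_def mat_diag_def of_nat_diff algebra_simps)
  show "finite (simple_roots L)"
    by (rule fin)
  show "\<exists>k>0. \<alpha> (grading N) = of_nat k" if "\<alpha> \<in> simple_roots L" for \<alpha>
    using that by (rule grad)
  fix x a b
  assume x: "x \<in> lie_algebra L" "strictly_upper x" and ab: "a < N" "b < N" "x $$ (a, b) \<noteq> 0"
  have "a < b"
    using x ab c by (auto simp: strictly_upper_def)
  have sym: "x $$ (i, j) = - x $$ (N - 1 - j, N - 1 - i)" if "i < N" "j < N" for i j
    using x(1) that unfolding L so_iff by blast
  have "a + b \<noteq> N - 1"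
  proof
    assume *: "a + b = N - 1"
    then have "N - 1 - b = a" "N - 1 - a = b"
      by linarith+
    then have "x $$ (a, b) = - x $$ (a, b)"
      using sym[of a b] ab by simp
    then show False
      using ab(3) by (simp add: eq_neg_iff_add_eq_0 flip: mult_2)
  qed
  define y where "y = mat N N (\<lambda>(i, j).
    if i = a \<and> j = b \<or> i = N - 1 - b \<and> j = N - 1 - a then x $$ (i, j) else 0)"
  define \<beta> :: "'k weight" where "\<beta> = (\<lambda>h. f a h - f b h)"
  have yL: "y \<in> lie_algebra L"
    unfolding L so_iff
  proof (intro conjI allI impI)
    fix i j assume ij: "i < N" "j < N"
    have "(N - 1 - j = a \<and> N - 1 - i = b \<or> N - 1 - j = N - 1 - b \<and> N - 1 - i = N - 1 - a) \<longleftrightarrow>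
        (i = a \<and> j = b \<or> i = N - 1 - b \<and> j = N - 1 - a)"
    proof -
      have "N - 1 - j = a \<longleftrightarrow> j = N - 1 - a" "N - 1 - i = b \<longleftrightarrow> i = N - 1 - b"
        "N - 1 - j = N - 1 - b \<longleftrightarrow> j = b" "N - 1 - i = N - 1 - a \<longleftrightarrow> i = a"
        using ij ab by linarith+
      then show ?thesis
        by blast
    qed
    then show "y $$ (i, j) = - y $$ (N - 1 - j, N - 1 - i)"
      using ij sym[OF ij] by (simp add: y_def)
  qed (simp add: y_def)
  then have root: "y \<in> root_space L \<beta>"
    using c cartan'
  proof (rule root_spaceI)
    fix h i j
    assume h: "h \<in> cartan L" and ij: "i < N" "j < N" "y $$ (i, j) \<noteq> 0"
    have hsym: "h $$ (k, k) = - h $$ (N - 1 - k, N - 1 - k)" if "k < N" for k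
      using h that unfolding cartan so_iff by blast
    have "i = a \<and> j = b \<or> i = N - 1 - b \<and> j = N - 1 - a"
      using ij by (auto simp: y_def split: if_splits)
    then show "\<beta> h = h $$ (i, i) - h $$ (j, j)"
      using f[OF h] ab hsym[of a] hsym[of b] by (auto simp: \<beta>_def)
  qed
  have "positive_combination (simple_roots L) \<beta>"
    unfolding \<beta>_def using \<open>a < b\<close> ab \<open>a + b \<noteq> N - 1\<close> by (intro comb)
  then have "\<beta> \<in> positive_roots L"
    using root by (rule positive_rootI[where a = a and b = b and N = N]) (use ab in \<open>auto simp: y_def\<close>)
  with root show "\<exists>\<beta>\<in>positive_roots L. \<exists>y\<in>root_space L \<beta>.
      y $$ (a, b) = x $$ (a, b) \<and> (\<forall>i<N. \<forall>j<N. y $$ (i, j) \<in> {0, x $$ (i, j)})"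
    using ab by (intro bexI[of _ \<beta>] bexI[of _ y]) (auto simp: y_def)
qed

lemma cartan_so_reflect:
  assumes "h \<in> so N" "i < N"
  shows "h $$ (N - 1 - i, N - 1 - i) = - (h :: 'k::field mat) $$ (i, i)"
  using assms unfolding so_iff by (metis minus_minus)

text \<open>All consecutive differences of diagonal entries are simple roots: those around the middle entry,
  which vanishes on the Cartan subalgebra, are the short root, and those below it mirror those above.\<close>

lemma triangular_type_B:
  assumes "1 \<le> n"
  shows "triangular_datum (type_B n :: 'k::field_char_0 lie_datum) (2 * n + 1)"
proof -
  let ?L = "type_B n :: 'k lie_datum"
  define f :: "nat \<Rightarrow> 'k weight" where
    "f i h = (if i < n then eps (Suc i) h else if i = n then 0 else - eps (2 * n + 1 - i) h)" for i h
  have fin: "finite (simple_roots ?L)"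
    by (simp add: type_B_def)
  show ?thesis
  proof (rule triangular_orthogonal[where f = f])
    show "\<exists>k>0. \<alpha> (grading (2 * n + 1)) = of_nat k" if "\<alpha> \<in> simple_roots ?L" for \<alpha>
      using that assms by (intro exI[of _ 2]) (auto simp: type_B_def eps_def grading_entry of_nat_diff)
    show "f i h = h $$ (i, i)" if h: "h \<in> cartan ?L" and i: "i < 2 * n + 1" for h i
    proof -
      have r: "h $$ (2 * n - i, 2 * n - i) = - h $$ (i, i)"
        using cartan_so_reflect[of h "2 * n + 1" i] h i by (simp add: type_B_def)
      consider "i < n" | "i = n" | "i > n"
        by linarith
      then show ?thesis
      proof cases
        case 2
        then have "h $$ (n, n) + h $$ (n, n) = 0"
          using r by (simp add: eq_neg_iff_add_eq_0)
        then show ?thesis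
          using 2 by (simp add: f_def flip: mult_2)
      qed (use r in \<open>auto simp: f_def eps_def\<close>)
    qed
    fix a b assume "a < b" "b < 2 * n + 1" "a + b \<noteq> 2 * n + 1 - 1"
    show "positive_combination (simple_roots ?L) (\<lambda>h. f a h - f b h)"
      using \<open>a < b\<close>
    proof (rule positive_combination_telescope)
      fix i assume "a \<le> i" "i < b"
      have "\<exists>k. 1 \<le> k \<and> k < n \<and> (\<lambda>h. f i h - f (Suc i) h) = (\<lambda>h. eps k h - eps (k + 1) h) \<or>
          (\<lambda>h. f i h - f (Suc i) h) = eps n"
      proof -
        consider "Suc i < n" | "Suc i = n" | "i = n" | "i > n"
          by linarith
        then show ?thesis
        proof cases
          case 4
          then have "2 * n + 1 - i = 2 * n - i + 1" "2 * n + 1 - Suc i = 2 * n - i"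
            using \<open>i < b\<close> \<open>b < 2 * n + 1\<close> by linarith+
          with 4 show ?thesis
            using \<open>i < b\<close> \<open>b < 2 * n + 1\<close> by (intro exI[of _ "2 * n - i"]) (auto simp: f_def)
        qed (auto simp: f_def fun_eq_iff intro: exI[of _ "Suc i"])
      qed
      then have "(\<lambda>h. f i h - f (Suc i) h) \<in> simple_roots ?L"
        unfolding type_B_def by auto
      then show "positive_combination (simple_roots ?L) (\<lambda>h. f i h - f (Suc i) h)"
        by (rule positive_combination_base[OF fin])
    qed
  qed (simp_all add: type_B_def)
qed

text \<open>Of the consecutive differences of diagonal entries, only the middle one is not a simple root. A root across the
  middle is a sum \<open>f p + f q\<close> with \<open>p < q < n\<close>, which the last simple root reduces to differences.\<close>

lemma triangular_type_D:
  assumes "2 \<le> n"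
  shows "triangular_datum (type_D n :: 'k::field_char_0 lie_datum) (2 * n)"
proof -
  let ?L = "type_D n :: 'k lie_datum"
  define f :: "nat \<Rightarrow> 'k weight" where
    "f i h = (if i < n then eps (Suc i) h else - eps (2 * n - i) h)" for i h
  have fin: "finite (simple_roots ?L)"
    by (simp add: type_D_def)
  have step: "positive_combination (simple_roots ?L) (\<lambda>h. f i h - f (Suc i) h)"
    if "Suc i < 2 * n" "Suc i \<noteq> n" for i
  proof -
    have "\<exists>k. 1 \<le> k \<and> k < n \<and> (\<lambda>h. f i h - f (Suc i) h) = (\<lambda>h. eps k h - eps (k + 1) h)"
    proof (cases "Suc i < n")
      case False
      then have "2 * n - i = 2 * n - Suc i + 1"
        using that by linarith
      with False show ?thesis
        using that by (intro exI[of _ "2 * n - Suc i"]) (auto simp: f_def)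
    qed (auto simp: f_def intro: exI[of _ "Suc i"])
    then have "(\<lambda>h. f i h - f (Suc i) h) \<in> simple_roots ?L"
      unfolding type_D_def by auto
    then show ?thesis
      by (rule positive_combination_base[OF fin])
  qed
  have cross: "positive_combination (simple_roots ?L) (\<lambda>h. f p h + f q h)" if "p < q" "q < n" for p q
  proof -
    \<comment> \<open>Lower \<open>p\<close> and \<open>q\<close> to \<open>n - 2\<close> and \<open>n - 1\<close> by differences; the remainder is the last simple root.\<close>
    have "(\<lambda>h. eps (n - 1) h + eps n h) \<in> simple_roots ?L"
      by (simp add: type_D_def)
    then have "positive_combination (simple_roots ?L) (\<lambda>h. eps (n - 1) h + eps n h)"
      by (rule positive_combination_base[OF fin])
    also have "(\<lambda>h. eps (n - 1) h + eps n h) = (\<lambda>h. f (n - 2) h + f (n - 1) h)"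
      using assms by (auto simp: f_def Suc_diff_Suc numeral_2_eq_2)
    finally have "positive_combination (simple_roots ?L)
        (\<lambda>h. f p h - f (n - 2) h + (f q h - f (n - 1) h + (f (n - 2) h + f (n - 1) h)))"
      using that by (intro positive_combination_telescope_add step) auto
    then show ?thesis
      by (simp add: algebra_simps)
  qed
  show ?thesis
  proof (rule triangular_orthogonal[where f = f])
    show "\<exists>k>0. \<alpha> (grading (2 * n)) = of_nat k" if "\<alpha> \<in> simple_roots ?L" for \<alpha>
    proof -
      have "eps (n - 1) (grading (2 * n)) + eps n (grading (2 * n)) = (of_nat 4 :: 'k)"
        using assms by (simp add: eps_def grading_entry of_nat_diff)
      moreover have "eps i (grading (2 * n)) - eps (i + 1) (grading (2 * n)) = (of_nat 2 :: 'k)"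
        if "1 \<le> i" "i < n" for i
        using that by (simp add: eps_def grading_entry of_nat_diff)
      ultimately show ?thesis
        using that unfolding type_D_def by (auto intro: exI[of _ 2] exI[of _ 4])
    qed
    show "f i h = h $$ (i, i)" if h: "h \<in> cartan ?L" and i: "i < 2 * n" for h i
    proof -
      have "h $$ (2 * n - 1 - i, 2 * n - 1 - i) = - h $$ (i, i)"
        using cartan_so_reflect[of h "2 * n" i] h i by (simp add: type_D_def)
      then show ?thesis
        by (auto simp: f_def eps_def)
    qed
    fix a b assume ab: "a < b" "b < 2 * n" "a + b \<noteq> 2 * n - 1"
    consider "b < n" | "n \<le> a" | "a < n" "n \<le> b"
      by linarith
    then show "positive_combination (simple_roots ?L) (\<lambda>h. f a h - f b h)"
    proof cases
      case 3
      define q where "q = 2 * n - 1 - b"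
      have q: "q < n" "q \<noteq> a"
        using ab 3 by (auto simp: q_def)
      have "(\<lambda>h. f a h - f b h) = (\<lambda>h. f a h + f q h)"
        using 3 ab q by (auto simp: f_def q_def Suc_diff_Suc)
      then show ?thesis
        using cross[of a q] cross[of q a] q 3 by (cases "a < q") (auto simp: add.commute)
    next
      case 1
      show ?thesis
        by (rule positive_combination_telescope[OF ab(1)], rule step) (use 1 in linarith)+
    next
      case 2
      show ?thesis
        by (rule positive_combination_telescope[OF ab(1)], rule step) (use 2 ab in linarith)+
    qed
  qed (simp_all add: type_D_def)
qed

section \<open>Models built from quadratic operators\<close>

text \<open>The linear extension of operators attached to the matrix units.\<close>

definition gl_op :: "nat \<Rightarrow> (nat \<Rightarrow> nat \<Rightarrow> ('i \<Rightarrow> 'k) \<Rightarrow> 'i \<Rightarrow> 'k) \<Rightarrow> 'k::field mat \<Rightarrow> ('i \<Rightarrow> 'k) \<Rightarrow> 'i \<Rightarrow> 'k"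
  where "gl_op N E x f s = (\<Sum>a<N. \<Sum>b<N. x $$ (a, b) * E a b f s)"

lemma linear_op_sum:
  fixes T :: "('i \<Rightarrow> 'k::field) \<Rightarrow> 'i \<Rightarrow> 'k"
  assumes add: "\<And>f g s. T (\<lambda>s. f s + g s) s = T f s + T g s"
    and smult: "\<And>c f s. T (\<lambda>s. c * f s) s = c * T f s"
  shows "T (\<lambda>s. \<Sum>j\<in>J. c j * f j s) s = (\<Sum>j\<in>J. c j * T (f j) s)"
proof (induction J arbitrary: s rule: infinite_finite_induct)
  case (infinite J)
  then show ?case
    using smult[of 0 "\<lambda>s. 0" s] by simp
next
  case empty
  then show ?case
    using smult[of 0 "\<lambda>s. 0" s] by simp
qed (simp add: add smult)

text \<open>The hypothesis on commutators compares the action of \<open>x\<close> on an operator \<open>E c d\<close> with the bracket of \<open>x\<close> and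
  a matrix unit. For the general linear Lie algebra it holds for every matrix, for spinors only for
  matrices in the orthogonal Lie algebra; in this form both cases share the double sum over entries.\<close>

lemma gl_op_bracket:
  fixes E :: "nat \<Rightarrow> nat \<Rightarrow> ('i \<Rightarrow> 'k::field) \<Rightarrow> 'i \<Rightarrow> 'k"
  assumes x: "x \<in> carrier_mat N N" and y: "y \<in> carrier_mat N N"
    and add: "\<And>a b f g s. E a b (\<lambda>s. f s + g s) s = E a b f s + E a b g s"
    and smult: "\<And>a b c f s. E a b (\<lambda>s. c * f s) s = c * E a b f s"
    and comm: "\<And>c d s. c < N \<Longrightarrow> d < N \<Longrightarrow> gl_op N E x (E c d f) s =
      E c d (gl_op N E x f) s + (\<Sum>a<N. x $$ (a, c) * E a d f s) - (\<Sum>b<N. x $$ (d, b) * E c b f s)"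
  shows "gl_op N E (lie_bracket x y) f s =
    gl_op N E x (gl_op N E y f) s - gl_op N E y (gl_op N E x f) s"
proof -
  have lin: "E a b (\<lambda>s. \<Sum>c<N. \<Sum>d<N. y $$ (c, d) * g c d s) s = (\<Sum>c<N. \<Sum>d<N. y $$ (c, d) * E a b (g c d) s)"
    for a b g s
    using linear_op_sum[of "E a b", OF add smult, of "\<lambda>_. 1" "\<lambda>c s. \<Sum>d<N. y $$ (c, d) * g c d s" "{..<N}" s]
    by (simp add: linear_op_sum[of "E a b", OF add smult])
  have "gl_op N E x (gl_op N E y f) s =
      (\<Sum>a<N. \<Sum>b<N. \<Sum>c<N. \<Sum>d<N. y $$ (c, d) * (x $$ (a, b) * E a b (E c d f) s))"
    unfolding gl_op_def[of N E x] gl_op_def[of N E y, abs_def] lin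
    by (simp add: sum_distrib_left mult.left_commute)
  also have "\<dots> = (\<Sum>a<N. \<Sum>c<N. \<Sum>b<N. \<Sum>d<N. y $$ (c, d) * (x $$ (a, b) * E a b (E c d f) s))"
    by (intro sum.cong refl sum.swap)
  also have "\<dots> = (\<Sum>c<N. \<Sum>a<N. \<Sum>d<N. \<Sum>b<N. y $$ (c, d) * (x $$ (a, b) * E a b (E c d f) s))"
    by (subst sum.swap) (intro sum.cong refl sum.swap)
  also have "\<dots> = (\<Sum>c<N. \<Sum>d<N. y $$ (c, d) * gl_op N E x (E c d f) s)"
    unfolding gl_op_def sum_distrib_left by (intro sum.cong refl sum.swap)
  also have "\<dots> = (\<Sum>c<N. \<Sum>d<N. y $$ (c, d) * E c d (gl_op N E x f) s
      + (\<Sum>a<N. x $$ (a, c) * y $$ (c, d) * E a d f s) - (\<Sum>b<N. y $$ (c, d) * x $$ (d, b) * E c b f s))"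
    by (intro sum.cong refl) (simp add: comm algebra_simps sum_distrib_left)
  also have "\<dots> = gl_op N E y (gl_op N E x f) s
      + (\<Sum>c<N. \<Sum>d<N. \<Sum>a<N. x $$ (a, c) * y $$ (c, d) * E a d f s)
      - (\<Sum>c<N. \<Sum>d<N. \<Sum>b<N. y $$ (c, d) * x $$ (d, b) * E c b f s)"
    unfolding gl_op_def[of N E y] by (simp add: sum.distrib sum_subtractf)
  also have "(\<Sum>c<N. \<Sum>d<N. \<Sum>a<N. x $$ (a, c) * y $$ (c, d) * E a d f s) = gl_op N E (x * y) f s"
  proof -
    have "(\<Sum>c<N. \<Sum>d<N. \<Sum>a<N. x $$ (a, c) * y $$ (c, d) * E a d f s) =
        (\<Sum>c<N. \<Sum>a<N. \<Sum>d<N. x $$ (a, c) * y $$ (c, d) * E a d f s)"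
      by (intro sum.cong refl sum.swap)
    also have "\<dots> = (\<Sum>a<N. \<Sum>d<N. \<Sum>c<N. x $$ (a, c) * y $$ (c, d) * E a d f s)"
      by (subst sum.swap) (intro sum.cong refl sum.swap)
    also have "\<dots> = gl_op N E (x * y) f s"
      unfolding gl_op_def using x y
      by (intro sum.cong refl) (simp add: scalar_prod_def atLeast0LessThan sum_distrib_right)
    finally show ?thesis .
  qed
  also have "(\<Sum>c<N. \<Sum>d<N. \<Sum>b<N. y $$ (c, d) * x $$ (d, b) * E c b f s) = gl_op N E (y * x) f s"
  proof -
    have "(\<Sum>c<N. \<Sum>d<N. \<Sum>b<N. y $$ (c, d) * x $$ (d, b) * E c b f s) =
        (\<Sum>c<N. \<Sum>b<N. \<Sum>d<N. y $$ (c, d) * x $$ (d, b) * E c b f s)"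
      by (intro sum.cong refl sum.swap)
    also have "\<dots> = gl_op N E (y * x) f s"
      unfolding gl_op_def using x y
      by (intro sum.cong refl) (simp add: scalar_prod_def atLeast0LessThan sum_distrib_right)
    finally show ?thesis .
  qed
  finally have "gl_op N E x (gl_op N E y f) s - gl_op N E y (gl_op N E x f) s =
      gl_op N E (x * y) f s - gl_op N E (y * x) f s"
    by simp
  also have "\<dots> = gl_op N E (lie_bracket x y) f s"
  proof -
    have "lie_bracket x y $$ (a, b) = (x * y) $$ (a, b) - (y * x) $$ (a, b)" if "a < N" "b < N" for a b
      using that x y by (simp add: lie_bracket_def)
    then show ?thesis
      unfolding gl_op_def by (simp add: left_diff_distrib flip: sum_subtractf)
  qed
  finally show ?thesis ..
qed

text \<open>A multiplicity-free model whose operators extend operators \<open>E a b\<close> linearly, with the conditions on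
  the operators reduced to conditions on the \<open>E a b\<close>.\<close>

locale quadratic_model = triangular_datum L N
  for L :: "'k::field_char_0 lie_datum" and N :: nat +
  fixes I :: "'i set" and E :: "nat \<Rightarrow> nat \<Rightarrow> ('i \<Rightarrow> 'k) \<Rightarrow> 'i \<Rightarrow> 'k"
    and wt :: "'i \<Rightarrow> 'k weight" and top :: 'i and depth :: "'i \<Rightarrow> nat"
  assumes finite_index: "finite I" and top_index: "top \<in> I"
    and E_add: "E a b (\<lambda>s. f s + g s) s = E a b f s + E a b g s"
    and E_smult: "E a b (\<lambda>s. e * f s) s = e * E a b f s"
    and E_support: "a < N \<Longrightarrow> b < N \<Longrightarrow> (\<And>s. s \<notin> I \<Longrightarrow> f s = 0) \<Longrightarrow> s \<notin> I \<Longrightarrow> E a b f s = 0"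
    and E_comm: "x \<in> lie_algebra L \<Longrightarrow> c < N \<Longrightarrow> d < N \<Longrightarrow> gl_op N E x (E c d f) s =
      E c d (gl_op N E x f) s + (\<Sum>a<N. x $$ (a, c) * E a d f s) - (\<Sum>b<N. x $$ (d, b) * E c b f s)"
    and E_cartan: "h \<in> cartan L \<Longrightarrow> s \<in> I \<Longrightarrow> (\<Sum>a<N. h $$ (a, a) * E a a f s) = wt s h * f s"
    and E_top: "a < b \<Longrightarrow> b < N \<Longrightarrow> s \<in> I \<Longrightarrow> E a b (delta top) s = 0"
    and separated: "s \<in> I \<Longrightarrow> t \<in> I \<Longrightarrow> s \<noteq> t \<Longrightarrow> \<exists>h\<in>cartan L. wt s h \<noteq> wt t h"
    and descending: "s \<in> I \<Longrightarrow> s \<noteq> top \<Longrightarrow> \<exists>t\<in>I. depth t < depth s \<and>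
      (\<exists>x\<in>lie_algebra L. gl_op N E x (delta s) t \<noteq> 0) \<and>
      (\<exists>x\<in>lie_algebra L. gl_op N E x (delta t) s \<noteq> 0)"

sublocale quadratic_model \<subseteq> weight_model L N I "gl_op N E" wt top depth
proof
  show "finite I" "top \<in> I"
    by (rule finite_index, rule top_index)
  show "gl_op N E x (\<lambda>s. f s + g s) s = gl_op N E x f s + gl_op N E x g s" for x f g s
    by (simp add: gl_op_def E_add distrib_left sum.distrib)
  show "gl_op N E x (\<lambda>s. c * f s) s = c * gl_op N E x f s" for x c f s
    by (simp add: gl_op_def E_smult sum_distrib_left mult.left_commute)
  show "gl_op N E x f s = 0" if "\<And>s. s \<notin> I \<Longrightarrow> f s = 0" "s \<notin> I" for x f s
    unfolding gl_op_def using E_support[OF _ _ that] by (intro sum.neutral ballI) simp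
  show "gl_op N E (x + y) f s = gl_op N E x f s + gl_op N E y f s"
    if "x \<in> lie_algebra L" "y \<in> lie_algebra L" for x y f s
  proof -
    have "x \<in> carrier_mat N N" "y \<in> carrier_mat N N"
      using that carrier by auto
    then show ?thesis
      by (simp add: gl_op_def distrib_right sum.distrib)
  qed
  show "gl_op N E (c \<cdot>\<^sub>m x) f s = c * gl_op N E x f s" if "x \<in> lie_algebra L" for c x f s
  proof -
    have "x \<in> carrier_mat N N"
      using that carrier by auto
    then show ?thesis
      by (simp add: gl_op_def sum_distrib_left mult.assoc)
  qed
  show "gl_op N E (lie_bracket x y) f s = gl_op N E x (gl_op N E y f) s - gl_op N E y (gl_op N E x f) s"
    if "x \<in> lie_algebra L" "y \<in> lie_algebra L" for x y f s
    using that carrier by (intro gl_op_bracket E_add E_smult E_comm) auto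
  show "gl_op N E h f s = wt s h * f s" if h: "h \<in> cartan L" and s: "s \<in> I" for h f s
  proof -
    have "h \<in> carrier_mat N N" "diagonal_mat h"
      using h carrier by (auto simp: cartan_eq)
    then have off: "h $$ (a, b) = 0" if "a < N" "b < N" "a \<noteq> b" for a b
      using that by (auto simp: diagonal_mat_def)
    have "gl_op N E h f s = (\<Sum>a<N. \<Sum>b<N. if b = a then h $$ (a, a) * E a a f s else 0)"
      unfolding gl_op_def using off by (intro sum.cong refl) auto
    then show ?thesis
      using E_cartan[OF h s] by simp
  qed
  show "gl_op N E x (delta top) s = 0"
    if "x \<in> lie_algebra L" "strictly_upper x" "s \<in> I" for x s
  proof -
    have "x \<in> carrier_mat N N"
      using that carrier by auto
    then have "x $$ (a, b) * E a b (delta top) s = 0" if "a < N" "b < N" for a b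
      using \<open>strictly_upper x\<close> that \<open>s \<in> I\<close> E_top[of a b s] unfolding strictly_upper_def by auto
    then show ?thesis
      unfolding gl_op_def by (intro sum.neutral ballI) simp
  qed
qed (fact separated descending)+

section \<open>Oscillators\<close>

text \<open>Canonical commutation (\<open>\<epsilon> = 1\<close>) or anticommutation (\<open>\<epsilon> = - 1\<close>) relations for creation operators \<open>p\<close> and
  annihilation operators \<open>q\<close>.\<close>

locale oscillator =
  fixes p q :: "nat \<Rightarrow> ('i \<Rightarrow> 'k::field) \<Rightarrow> 'i \<Rightarrow> 'k" and \<epsilon> :: 'k
  assumes sign: "\<epsilon> * \<epsilon> = 1"
    and p_add: "p a (\<lambda>s. f s + g s) = (\<lambda>s. p a f s + p a g s)"
    and p_smult: "p a (\<lambda>s. e * f s) = (\<lambda>s. e * p a f s)"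
    and q_add: "q a (\<lambda>s. f s + g s) = (\<lambda>s. q a f s + q a g s)"
    and q_smult: "q a (\<lambda>s. e * f s) = (\<lambda>s. e * q a f s)"
    and qp: "q b (p c f) = (\<lambda>s. of_bool (b = c) * f s + \<epsilon> * p c (q b f) s)"
    and pp: "p a (p c f) = (\<lambda>s. \<epsilon> * p c (p a f) s)"
    and qq: "q a (q c f) = (\<lambda>s. \<epsilon> * q c (q a f) s)"
begin

definition E :: "nat \<Rightarrow> nat \<Rightarrow> ('i \<Rightarrow> 'k) \<Rightarrow> 'i \<Rightarrow> 'k" where
  "E a b f = p a (q b f)"

lemma E_add: "E a b (\<lambda>s. f s + g s) s = E a b f s + E a b g s"
  by (simp add: E_def p_add q_add)

lemma E_smult: "E a b (\<lambda>s. c * f s) s = c * E a b f s"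
  by (simp add: E_def p_smult q_smult)

text \<open>The sign \<open>\<epsilon>\<close> cancels in products of two quadratic operators, so bosons and fermions satisfy the same relations
  as the matrix units.\<close>

lemma E_commutator:
  "E a b (E c d f) s = E c d (E a b f) s + of_bool (b = c) * E a d f s - of_bool (a = d) * E c b f s"
proof -
  have "E a b (E c d f) s = of_bool (b = c) * E a d f s + \<epsilon> * p a (p c (q b (q d f))) s"
    unfolding E_def qp by (simp add: p_add p_smult)
  also have "\<epsilon> * p a (p c (q b (q d f))) s = \<epsilon> * p c (p a (q d (q b f))) s"
    by (subst pp, subst qq[of b d]) (simp add: p_smult sign flip: mult.assoc)
  also have "\<dots> = p c (\<lambda>s. \<epsilon> * p a (q d (q b f)) s) s"
    by (simp only: p_smult)
  also have "(\<lambda>s. \<epsilon> * p a (q d (q b f)) s) =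
      (\<lambda>s. q d (p a (q b f)) s + (- of_bool (a = d)) * q b f s)"
    unfolding qp by (auto simp: fun_eq_iff)
  also have "p c \<dots> s = E c d (E a b f) s - of_bool (a = d) * E c b f s"
    unfolding E_def p_add p_smult by simp
  finally show ?thesis
    by simp
qed

lemma E_comm:
  assumes "c < N" "d < N"
  shows "gl_op N E x (E c d f) s =
    E c d (gl_op N E x f) s + (\<Sum>a<N. x $$ (a, c) * E a d f s) - (\<Sum>b<N. x $$ (d, b) * E c b f s)"
proof -
  have lin: "E c d (gl_op N E x f) s = (\<Sum>a<N. \<Sum>b<N. x $$ (a, b) * E c d (E a b f) s)"
    unfolding gl_op_def
    using linear_op_sum[of "E c d", OF E_add E_smult, of "\<lambda>_. 1" "\<lambda>a s. \<Sum>b<N. x $$ (a, b) * E a b f s" "{..<N}" s]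
    by (simp add: linear_op_sum[of "E c d", OF E_add E_smult])
  have "gl_op N E x (E c d f) s = (\<Sum>a<N. \<Sum>b<N. x $$ (a, b) * E c d (E a b f) s
      + (if b = c then x $$ (a, b) * E a d f s else 0) - (if a = d then x $$ (a, b) * E c b f s else 0))"
    unfolding gl_op_def E_commutator[of _ _ c d] by (intro sum.cong refl) (auto simp: algebra_simps)
  also have "\<dots> = E c d (gl_op N E x f) s + (\<Sum>a<N. \<Sum>b<N. if b = c then x $$ (a, b) * E a d f s else 0)
      - (\<Sum>b<N. \<Sum>a<N. if a = d then x $$ (a, b) * E c b f s else 0)"
    unfolding lin by (subst (4) sum.swap) (simp only: sum.distrib sum_subtractf)
  finally show ?thesis
    using assms by simp
qed

end

subsection \<open>Bosons\<close>

text \<open>Functions on occupation numbers are the coefficients of polynomials; creation is multiplication by a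
  variable.\<close>

definition boson_create :: "nat \<Rightarrow> ((nat \<Rightarrow> nat) \<Rightarrow> 'k::field) \<Rightarrow> (nat \<Rightarrow> nat) \<Rightarrow> 'k" where
  "boson_create a f k = (if k a = 0 then 0 else f (k(a := k a - 1)))"

text \<open>The partial derivative, on coefficients.\<close>

definition boson_annihilate :: "nat \<Rightarrow> ((nat \<Rightarrow> nat) \<Rightarrow> 'k::field) \<Rightarrow> (nat \<Rightarrow> nat) \<Rightarrow> 'k" where
  "boson_annihilate a f k = of_nat (k a + 1) * f (k(a := k a + 1))"

interpretation boson: oscillator boson_create boson_annihilate 1
proof
  show "boson_annihilate b (boson_create c f) =
      (\<lambda>k. of_bool (b = c) * f k + 1 * boson_create c (boson_annihilate b f) k)" for b c and f :: "(nat \<Rightarrow> nat) \<Rightarrow> 'a"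
    by (rule ext, cases "b = c")
      (auto simp: boson_create_def boson_annihilate_def fun_upd_twist algebra_simps of_nat_diff)
qed (auto simp: boson_create_def boson_annihilate_def fun_upd_twist fun_eq_iff algebra_simps)

subsection \<open>Fermions\<close>

text \<open>The sign that moves the factor \<open>a\<close> to its place in an ordered exterior product; it makes the operators at
  different places anticommute.\<close>

definition fermion_sign :: "nat \<Rightarrow> nat set \<Rightarrow> 'k::field" where
  "fermion_sign a S = (- 1) ^ card {b \<in> S. b < a}"

definition fermion_create :: "nat \<Rightarrow> (nat set \<Rightarrow> 'k::field) \<Rightarrow> nat set \<Rightarrow> 'k" where
  "fermion_create a f S = (if a \<in> S then fermion_sign a S * f (S - {a}) else 0)"

definition fermion_annihilate :: "nat \<Rightarrow> (nat set \<Rightarrow> 'k::field) \<Rightarrow> nat set \<Rightarrow> 'k" where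
  "fermion_annihilate a f S = (if a \<in> S then 0 else fermion_sign a S * f (insert a S))"

lemma fermion_sign_square [simp]: "fermion_sign a S * fermion_sign a S = (1 :: 'k::field)"
  by (simp add: fermion_sign_def flip: power_add mult_2)

lemma fermion_sign_nonzero [simp]: "fermion_sign a S \<noteq> (0 :: 'k::field)"
  by (simp add: fermion_sign_def)

lemma fermion_sign_insert:
  assumes "b \<notin> S"
  shows "fermion_sign a (insert b S) = (if b < a then - fermion_sign a S else (fermion_sign a S :: 'k::field))"
proof -
  have "{c \<in> insert b S. c < a} = (if b < a then insert b {c \<in> S. c < a} else {c \<in> S. c < a})"
    by auto
  then show ?thesis
    using assms by (simp add: fermion_sign_def)
qed

lemma fermion_sign_remove:
  assumes "b \<in> S"
  shows "fermion_sign a (S - {b}) = (if b < a then - fermion_sign a S else (fermion_sign a S :: 'k::field))"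
  using fermion_sign_insert[of b "S - {b}" a, where 'k = 'k] assms by (auto simp: insert_absorb)

interpretation fermion: oscillator fermion_create fermion_annihilate "- 1"
proof
  fix a b c and f :: "nat set \<Rightarrow> 'a"
  have swap: "insert b (S - {c}) = insert b S - {c}" if "b \<noteq> c" for S b c
    using that by auto
  show "fermion_annihilate b (fermion_create c f) =
      (\<lambda>S. of_bool (b = c) * f S + (- 1) * fermion_create c (fermion_annihilate b f) S)"
  proof
    fix S
    show "fermion_annihilate b (fermion_create c f) S =
      of_bool (b = c) * f S + (- 1) * fermion_create c (fermion_annihilate b f) S"
    proof (cases "b = c")
      case True
      then show ?thesis
        by (cases "b \<in> S")
          (auto simp: fermion_create_def fermion_annihilate_def fermion_sign_insert fermion_sign_remove insert_absorb
            simp flip: mult.assoc)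
    next
      case False
      then show ?thesis
        by (auto simp: fermion_create_def fermion_annihilate_def fermion_sign_insert fermion_sign_remove swap
            algebra_simps)
    qed
  qed
  show "fermion_create a (fermion_create c f) = (\<lambda>S. - 1 * fermion_create c (fermion_create a f) S)"
    by (rule ext, cases a c rule: linorder_cases)
      (auto simp: fermion_create_def fermion_sign_remove algebra_simps Diff_insert2[symmetric] insert_commute)
  show "fermion_annihilate a (fermion_annihilate c f) = (\<lambda>S. - 1 * fermion_annihilate c (fermion_annihilate a f) S)"
    by (rule ext, cases a c rule: linorder_cases)
      (auto simp: fermion_annihilate_def fermion_sign_insert algebra_simps insert_commute)
qed (auto simp: fermion_create_def fermion_annihilate_def fun_eq_iff algebra_simps)

section \<open>Weights of symmetric and exterior powers\<close>

definition matrix_unit :: "nat \<Rightarrow> nat \<Rightarrow> nat \<Rightarrow> 'k::zero_neq_one mat" where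
  "matrix_unit N a b = mat N N (\<lambda>(i, j). of_bool (i = a \<and> j = b))"

lemma gl_op_matrix_unit:
  assumes "a < N" "b < N"
  shows "gl_op N E (matrix_unit N a b) f s = E a b f s"
proof -
  have "gl_op N E (matrix_unit N a b) f s = (\<Sum>i<N. \<Sum>j<N. if j = b then (if i = a then E a b f s else 0) else 0)"
    unfolding gl_op_def by (intro sum.cong refl) (auto simp: matrix_unit_def)
  then show ?thesis
    using assms by simp
qed

lemma matrix_unit_sl: "a \<noteq> b \<Longrightarrow> matrix_unit N a b \<in> sl N"
  by (auto simp: sl_def matrix_unit_def simp del: sum_of_bool_eq intro!: sum.neutral)

text \<open>The trace is the only linear relation among the diagonal entries of the Cartan subalgebra: testing with
  differences of two diagonal matrix units shows that the coefficients are constant.\<close>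

lemma sl_cartan_pairing:
  fixes c :: "nat \<Rightarrow> int"
  assumes sum: "(\<Sum>a<n + 1. c a) = 0" and a: "a < n + 1"
    and pairing: "\<And>h :: 'k::field_char_0 mat. h \<in> cartan (type_A n) \<Longrightarrow> (\<Sum>a<n + 1. of_int (c a) * h $$ (a, a)) = 0"
  shows "c a = 0"
proof -
  have eq: "c b = c a" if b: "b < n + 1" for b
  proof -
    define h :: "'k mat" where "h = mat_diag (n + 1) (\<lambda>i. of_bool (i = a) - of_bool (i = b))"
    have diag: "h $$ (i, i) = of_bool (i = a) - of_bool (i = b)" if "i < n + 1" for i
      using that by (simp add: h_def mat_diag_def)
    have ind: "(\<Sum>i<n + 1. g i * of_bool (i = e)) = g e" if "e < n + 1" for g :: "nat \<Rightarrow> 'k" and e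
    proof -
      have "(\<Sum>i<n + 1. g i * of_bool (i = e)) = (\<Sum>i<n + 1. if i = e then g i else 0)"
        by (intro sum.cong refl) auto
      then show ?thesis
        using that by (simp del: sum.lessThan_Suc)
    qed
    have tr: "(\<Sum>i<n + 1. g i * h $$ (i, i)) = g a - g b" for g
    proof -
      have "(\<Sum>i<n + 1. g i * h $$ (i, i)) = (\<Sum>i<n + 1. g i * of_bool (i = a) - g i * of_bool (i = b))"
        by (intro sum.cong refl) (simp add: diag right_diff_distrib)
      then show ?thesis
        using ind a b by (simp add: sum_subtractf del: sum.lessThan_Suc)
    qed
    have "h \<in> cartan (type_A n)"
      using tr[of "\<lambda>_. 1"] by (auto simp: type_A_def sl_def h_def diagonal_mat_def mat_diag_def simp del: sum.lessThan_Suc)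
    then have "(of_int (c a) :: 'k) = of_int (c b)"
      using pairing[of h] tr[of "\<lambda>i. of_int (c i)"] by simp
    then show ?thesis
      by simp
  qed
  have "(\<Sum>b<n + 1. c b) = (\<Sum>b<n + 1. c a)"
    by (intro sum.cong refl) (use eq in auto)
  then show ?thesis
    using sum by simp
qed

definition occupation_weight :: "nat \<Rightarrow> (nat \<Rightarrow> nat) \<Rightarrow> 'k::field weight" where
  "occupation_weight N k h = (\<Sum>a<N. of_nat (k a) * h $$ (a, a))"

text \<open>One particle moves from place \<open>i + 1\<close> to place \<open>i\<close>.\<close>

definition raises :: "nat \<Rightarrow> (nat \<Rightarrow> nat) \<Rightarrow> (nat \<Rightarrow> nat) \<Rightarrow> bool" where
  "raises n k l \<longleftrightarrow> (\<exists>i<n. \<forall>a<n + 1. l a + of_bool (a = Suc i) = k a + of_bool (a = i))"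

lemma occupation_weight_eqD:
  fixes k l :: "nat \<Rightarrow> nat" and d :: "nat \<Rightarrow> int"
  assumes sum: "(\<Sum>a<n + 1. k a) = (\<Sum>a<n + 1. l a)" and d: "(\<Sum>a<n + 1. d a) = 0"
    and eq: "\<And>h :: 'k::field_char_0 mat. h \<in> cartan (type_A n) \<Longrightarrow>
      occupation_weight (n + 1) l h - occupation_weight (n + 1) k h = (\<Sum>a<n + 1. of_int (d a) * h $$ (a, a))"
    and a: "a < n + 1"
  shows "int (l a) - int (k a) = d a"
proof -
  have "int (\<Sum>a<n + 1. k a) = int (\<Sum>a<n + 1. l a)"
    using sum by simp
  then have total: "(\<Sum>a<n + 1. int (l a) - int (k a) - d a) = 0"
    using d by (simp add: sum_subtractf del: sum.lessThan_Suc)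
  have pairing: "(\<Sum>a<n + 1. of_int (int (l a) - int (k a) - d a) * h $$ (a, a)) = 0"
    if "h \<in> cartan (type_A n)" for h :: "'k mat"
    using eq[OF that]
    by (simp add: occupation_weight_def left_diff_distrib sum_subtractf del: sum.lessThan_Suc)
  have "int (l a) - int (k a) - d a = 0"
    using sl_cartan_pairing[where c = "\<lambda>a. int (l a) - int (k a) - d a", OF total a pairing] .
  then show ?thesis
    by simp
qed

text \<open>States with the same number of particles have equal weights only if they are equal, so the equation of
  weights becomes an equation of occupation numbers.\<close>

lemma occupation_weight_covers_iff:
  fixes k l :: "nat \<Rightarrow> nat"
  assumes sum: "(\<Sum>a<n + 1. k a) = (\<Sum>a<n + 1. l a)"
  shows "(\<exists>\<alpha>\<in>simple_roots (type_A n :: 'k::field_char_0 lie_datum). \<forall>h\<in>cartan (type_A n).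
      occupation_weight (n + 1) l h - occupation_weight (n + 1) k h = \<alpha> h) \<longleftrightarrow> raises n k l"
proof -
  define \<alpha> :: "nat \<Rightarrow> 'k weight" where "\<alpha> i h = h $$ (i, i) - h $$ (Suc i, Suc i)" for i h
  define d :: "nat \<Rightarrow> nat \<Rightarrow> int" where "d i a = of_bool (a = i) - of_bool (a = Suc i)" for i a
  have roots: "simple_roots (type_A n :: 'k lie_datum) = \<alpha> ` {..<n}"
  proof (intro equalityI subsetI)
    fix x assume "x \<in> simple_roots (type_A n :: 'k lie_datum)"
    then obtain i where "1 \<le> i" "i \<le> n" "x = (\<lambda>h. eps i h - eps (i + 1) h)"
      by (auto simp: type_A_def)
    then show "x \<in> \<alpha> ` {..<n}"
      by (intro image_eqI[of _ _ "i - 1"]) (auto simp: \<alpha>_def eps_def)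
  next
    fix x assume "x \<in> \<alpha> ` {..<n}"
    then obtain i where "i < n" "x = \<alpha> i"
      by blast
    then show "x \<in> simple_roots (type_A n :: 'k lie_datum)"
      by (auto simp: type_A_def \<alpha>_def eps_def fun_eq_iff intro!: exI[of _ "Suc i"])
  qed
  have pick: "(\<Sum>a<n + 1. of_int (d i a) * g a) = g i - g (Suc i)" if "i < n" for i and g :: "nat \<Rightarrow> 'k"
  proof -
    have "(\<Sum>a<n + 1. of_int (d i a) * g a) = (\<Sum>a<n + 1. (if a = i then g a else 0) - (if a = Suc i then g a else 0))"
      by (intro sum.cong refl) (auto simp: d_def)
    then show ?thesis
      using that by (simp add: sum_subtractf del: sum.lessThan_Suc)
  qed
  have d0: "(\<Sum>a<n + 1. d i a) = 0" if "i < n" for i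
  proof -
    have "(of_int (\<Sum>a<n + 1. d i a) :: 'k) = 0"
      using pick[OF that, of "\<lambda>_. 1"] by (simp del: sum.lessThan_Suc)
    then show ?thesis
      by (simp only: of_int_eq_0_iff)
  qed
  have key: "(\<forall>h\<in>cartan (type_A n). occupation_weight (n + 1) l h - occupation_weight (n + 1) k h = \<alpha> i h) \<longleftrightarrow>
      (\<forall>a<n + 1. l a + of_bool (a = Suc i) = k a + of_bool (a = i))" if i: "i < n" for i
  proof -
    have pick_root: "(\<Sum>a<n + 1. of_int (d i a) * h $$ (a, a)) = \<alpha> i h" for h
      by (simp only: pick[OF i] \<alpha>_def)
    show ?thesis
    proof
      assume eq: "\<forall>h\<in>cartan (type_A n). occupation_weight (n + 1) l h - occupation_weight (n + 1) k h = \<alpha> i h"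
      show "\<forall>a<n + 1. l a + of_bool (a = Suc i) = k a + of_bool (a = i)"
      proof (intro allI impI)
        fix a assume a: "a < n + 1"
        have "int (l a) - int (k a) = d i a"
          by (rule occupation_weight_eqD[OF sum d0[OF i] _ a, where 'k = 'k])
            (use eq in \<open>simp only: pick_root\<close>)
        then show "l a + of_bool (a = Suc i) = k a + of_bool (a = i)"
          by (auto simp: d_def split: if_splits)
      qed
    next
      assume *: "\<forall>a<n + 1. l a + of_bool (a = Suc i) = k a + of_bool (a = i)"
      have "(of_nat (l a) :: 'k) = of_nat (k a) + of_int (d i a)" if "a < n + 1" for a
      proof -
        have "int (l a) = int (k a) + d i a"
          using *[rule_format, OF that] by (auto simp: d_def split: if_splits)
        then have "(of_int (int (l a)) :: 'k) = of_int (int (k a) + d i a)"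
          by simp
        then show ?thesis
          by simp
      qed
      then have "occupation_weight (n + 1) l h =
          (\<Sum>a<n + 1. (of_nat (k a) + of_int (d i a)) * h $$ (a, a))" for h :: "'k mat"
        unfolding occupation_weight_def by (intro sum.cong refl) simp
      then have "occupation_weight (n + 1) l h =
          occupation_weight (n + 1) k h + (\<Sum>a<n + 1. of_int (d i a) * h $$ (a, a))" for h :: "'k mat"
        unfolding occupation_weight_def by (simp only: distrib_right sum.distrib)
      then have "occupation_weight (n + 1) l h = occupation_weight (n + 1) k h + \<alpha> i h" for h
        by (simp only: pick_root)
      then show "\<forall>h\<in>cartan (type_A n). occupation_weight (n + 1) l h - occupation_weight (n + 1) k h = \<alpha> i h"
        by simp
    qed
  qed
  have "(\<exists>x\<in>\<alpha> ` {..<n}. P x) \<longleftrightarrow> (\<exists>i. i < n \<and> P (\<alpha> i))" for P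
    by blast
  then show ?thesis
    unfolding roots raises_def by (simp only:) (intro ex_cong1 conj_cong refl key)
qed

lemma occupation_weight_separated:
  fixes k l :: "nat \<Rightarrow> nat"
  assumes sum: "(\<Sum>a<n + 1. k a) = (\<Sum>a<n + 1. l a)" and ne: "a < n + 1" "k a \<noteq> l a"
  shows "\<exists>h\<in>cartan (type_A n :: 'k::field_char_0 lie_datum). occupation_weight (n + 1) k h \<noteq> occupation_weight (n + 1) l h"
proof (rule ccontr)
  assume "\<not> ?thesis"
  then have "int (l a) - int (k a) = 0"
    using ne(1) by (intro occupation_weight_eqD[OF sum, of "\<lambda>_. 0" a, where 'k = 'k]) auto
  then show False
    using ne(2) by simp
qed

lemma quadratic_model_type_A:
  fixes p q :: "nat \<Rightarrow> ('i \<Rightarrow> 'k::field_char_0) \<Rightarrow> 'i \<Rightarrow> 'k" and occ :: "'i \<Rightarrow> nat \<Rightarrow> nat"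
    and top :: 'i and depth :: "'i \<Rightarrow> nat"
  assumes osc: "oscillator p q \<epsilon>" and fin: "finite I" and top: "top \<in> I"
    and supp: "\<And>a b f s. a < n + 1 \<Longrightarrow> b < n + 1 \<Longrightarrow> (\<And>s. s \<notin> I \<Longrightarrow> f s = 0) \<Longrightarrow> s \<notin> I \<Longrightarrow> p a (q b f) s = 0"
    and number: "\<And>a f s. s \<in> I \<Longrightarrow> a < n + 1 \<Longrightarrow> p a (q a f) s = of_nat (occ s a) * f s"
    and total: "\<And>s. s \<in> I \<Longrightarrow> (\<Sum>a<n + 1. occ s a) = m"
    and distinct: "\<And>s t. s \<in> I \<Longrightarrow> t \<in> I \<Longrightarrow> s \<noteq> t \<Longrightarrow> \<exists>a<n + 1. occ s a \<noteq> occ t a"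
    and killed: "\<And>a b s. a < b \<Longrightarrow> b < n + 1 \<Longrightarrow> s \<in> I \<Longrightarrow> p a (q b (delta top)) s = 0"
    and desc: "\<And>s. s \<in> I \<Longrightarrow> s \<noteq> top \<Longrightarrow> \<exists>t\<in>I. depth t < depth s \<and> (\<exists>a<n + 1. \<exists>b<n + 1. a \<noteq> b \<and>
      p a (q b (delta s)) t \<noteq> 0 \<and> p b (q a (delta t)) s \<noteq> 0)"
  shows "quadratic_model (type_A n) (n + 1) I (oscillator.E p q) (\<lambda>s. occupation_weight (n + 1) (occ s)) top depth"
proof -
  interpret oscillator p q \<epsilon>
    by (rule osc)
  interpret triangular_datum "type_A n :: 'k lie_datum" "n + 1"
    by (rule triangular_type_A)
  show ?thesis
  proof
    fix s assume "s \<in> I" "s \<noteq> top"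
    then obtain t a b where t: "t \<in> I" "depth t < depth s" and ab: "a < n + 1" "b < n + 1" "a \<noteq> b"
      and nz: "p a (q b (delta s)) t \<noteq> 0" "p b (q a (delta t)) s \<noteq> 0"
      using desc by blast
    have "matrix_unit (n + 1) a b \<in> lie_algebra (type_A n :: 'k lie_datum)"
      "matrix_unit (n + 1) b a \<in> lie_algebra (type_A n :: 'k lie_datum)"
      using ab matrix_unit_sl[of a b] matrix_unit_sl[of b a] by (simp_all add: type_A_def)
    then show "\<exists>t\<in>I. depth t < depth s \<and>
        (\<exists>x\<in>lie_algebra (type_A n). gl_op (n + 1) E x (delta s) t \<noteq> 0) \<and>
        (\<exists>x\<in>lie_algebra (type_A n). gl_op (n + 1) E x (delta t) s \<noteq> 0)"
      using t ab nz by (intro bexI[of _ t] conjI bexI[of _ "matrix_unit (n + 1) a b"] bexI[of _ "matrix_unit (n + 1) b a"])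
        (simp_all add: gl_op_matrix_unit E_def)
  next
    fix s t assume st: "s \<in> I" "t \<in> I" "s \<noteq> t"
    then obtain a where a: "a < n + 1" "occ s a \<noteq> occ t a"
      using distinct by blast
    show "\<exists>h\<in>cartan (type_A n :: 'k lie_datum). occupation_weight (n + 1) (occ s) h \<noteq> occupation_weight (n + 1) (occ t) h"
      by (rule occupation_weight_separated[where k = "occ s" and l = "occ t", OF _ a]) (simp only: total st)
  next
    fix h s f assume "s \<in> I"
    then show "(\<Sum>a<n + 1. h $$ (a, a) * E a a f s) = occupation_weight (n + 1) (occ s) h * f s"
      unfolding occupation_weight_def sum_distrib_right
      by (intro sum.cong refl) (simp add: E_def number mult.commute mult.left_commute)
  next
    fix x c d f s assume "c < n + 1" "d < n + 1"
    then show "gl_op (n + 1) E x (E c d f) s = E c d (gl_op (n + 1) E x f) s +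
        (\<Sum>a<n + 1. x $$ (a, c) * E a d f s) - (\<Sum>b<n + 1. x $$ (d, b) * E c b f s)"
      by (rule E_comm)
  qed (use fin top supp killed E_add E_smult in \<open>auto simp: E_def\<close>)
qed

definition bosonic_states :: "nat \<Rightarrow> nat \<Rightarrow> (nat \<Rightarrow> nat) set" where
  "bosonic_states n m = {k. (\<forall>a>n. k a = 0) \<and> (\<Sum>a<n + 1. k a) = m}"

definition fermionic_states :: "nat \<Rightarrow> nat \<Rightarrow> nat set set" where
  "fermionic_states n m = {S. S \<subseteq> {..n} \<and> card S = m}"

lemma finite_bosonic_states: "finite (bosonic_states n m)"
proof (rule finite_subset)
  show "bosonic_states n m \<subseteq> {k. \<forall>a. (a \<in> {..n} \<longrightarrow> k a \<in> {..m}) \<and> (a \<notin> {..n} \<longrightarrow> k a = 0)}"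
  proof (intro subsetI CollectI allI conjI impI)
    fix k a assume k: "k \<in> bosonic_states n m"
    show "k a \<in> {..m}" if "a \<in> {..n}"
      using member_le_sum[of a "{..<n + 1}" k] k that by (auto simp: bosonic_states_def)
    show "k a = 0" if "a \<notin> {..n}"
      using k that by (auto simp: bosonic_states_def)
  qed
qed (intro finite_set_of_finite_funs; simp)

lemma sum_transfer:
  fixes k :: "nat \<Rightarrow> nat"
  assumes "a < N" "b < N" "k b > 0"
  shows "sum (\<lambda>i. ((k(b := k b - 1))(a := (k(b := k b - 1)) a + 1)) i) {..<N} = sum k {..<N}"
proof -
  have upd: "sum (l(c := e)) {..<N} + l c = sum l {..<N} + e" if "c < N" for c e and l :: "nat \<Rightarrow> nat"
    using that by (simp add: sum.remove[of "{..<N}" c] fun_upd_def)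
  show ?thesis
    using upd[OF assms(1), of "k(b := k b - 1)" "(k(b := k b - 1)) a + 1"] upd[OF assms(2), of k "k b - 1"] assms(3)
    by simp
qed

lemma boson_transfer_bosonic_states:
  assumes "a < n + 1" "b < n + 1" "k b > 0"
  shows "(k(b := k b - 1))(a := (k(b := k b - 1)) a + 1) \<in> bosonic_states n m \<longleftrightarrow> k \<in> bosonic_states n m"
proof -
  have "(\<forall>i>n. ((k(b := k b - 1))(a := (k(b := k b - 1)) a + 1)) i = 0) \<longleftrightarrow> (\<forall>i>n. k i = 0)"
    using assms by auto
  then show ?thesis
    using sum_transfer[of a "n + 1" b k] assms by (simp add: bosonic_states_def del: sum.lessThan_Suc)
qed

lemma boson_transfer:
  "boson_create a (boson_annihilate b f) k = (if k a = 0 then 0 else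
    of_nat ((k(a := k a - 1)) b + 1) * f ((k(a := k a - 1))(b := (k(a := k a - 1)) b + 1)))"
  by (simp add: boson_create_def boson_annihilate_def)

text \<open>The symmetric power. From any state other than the highest one a particle can be moved to place \<open>0\<close>, and
  back again.\<close>

proposition quadratic_model_bosons:
  "quadratic_model (type_A n :: 'k::field_char_0 lie_datum) (n + 1) (bosonic_states n m) boson.E
    (\<lambda>k. occupation_weight (n + 1) k)
    (\<lambda>a. if a = 0 then m else 0) (\<lambda>k. m - k 0)"
proof (rule quadratic_model_type_A[where occ = "\<lambda>k. k" and m = m, OF boson.oscillator_axioms])
  let ?top = "\<lambda>a :: nat. if a = 0 then m else 0"
  show "finite (bosonic_states n m)"
    by (rule finite_bosonic_states)
  show "?top \<in> bosonic_states n m"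
    by (simp add: bosonic_states_def del: sum.lessThan_Suc)
  show "boson_create a (boson_annihilate b f) k = 0"
    if "a < n + 1" "b < n + 1" "\<And>k. k \<notin> bosonic_states n m \<Longrightarrow> f k = 0" "k \<notin> bosonic_states n m"
    for a b k and f :: "(nat \<Rightarrow> nat) \<Rightarrow> 'k"
  proof (cases "k a = 0")
    case False
    then show ?thesis
      using that boson_transfer_bosonic_states[of b n a k m] unfolding boson_transfer by auto
  qed (simp add: boson_create_def)
  show "boson_create a (boson_annihilate a f) k = of_nat (k a) * f k" for a k and f :: "(nat \<Rightarrow> nat) \<Rightarrow> 'k"
    by (auto simp: boson_transfer)
  show "(\<Sum>a<n + 1. k a) = m" if "k \<in> bosonic_states n m" for k
    using that by (simp add: bosonic_states_def)
  show "\<exists>a<n + 1. k a \<noteq> l a" if kl: "k \<in> bosonic_states n m" "l \<in> bosonic_states n m" "k \<noteq> l" for k l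
  proof -
    obtain a where a: "k a \<noteq> l a"
      using kl by (auto simp: fun_eq_iff)
    then have "a < n + 1"
      using kl by (cases "a > n") (auto simp: bosonic_states_def)
    with a show ?thesis
      by blast
  qed
  show "boson_create a (boson_annihilate b (delta ?top)) k = (0 :: 'k)" if "a < b" for a b k
  proof -
    have "(k(a := k a - 1))(b := (k(a := k a - 1)) b + 1) \<noteq> ?top"
      using that by (auto simp: fun_eq_iff intro!: exI[of _ b])
    then show ?thesis
      by (auto simp: boson_transfer delta_def)
  qed
  fix k assume k: "k \<in> bosonic_states n m" "k \<noteq> ?top"
  have "\<exists>b. 0 < b \<and> b < n + 1 \<and> k b > 0"
  proof (rule ccontr)
    assume *: "\<not> ?thesis"
    then have pos: "k b = 0" if "b > 0" for b
    proof (cases "b > n")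
      case True
      then show ?thesis
        using k by (simp add: bosonic_states_def)
    next
      case False
      moreover have "\<not> (0 < b \<and> b < n + 1 \<and> k b > 0)"
        using * by blast
      ultimately show ?thesis
        using that by simp
    qed
    have "(\<Sum>a<n + 1. k a) = (\<Sum>a<n + 1. if a = 0 then k 0 else 0)"
      by (intro sum.cong refl) (auto simp: pos)
    then have "k 0 = m"
      using k by (simp add: bosonic_states_def del: sum.lessThan_Suc)
    then have "k b = ?top b" for b
      using pos[of b] by (cases "b = 0") auto
    then show False
      using k(2) by blast
  qed
  then obtain b where b: "0 < b" "b < n + 1" "k b > 0"
    by blast
  define t where "t = (k(b := k b - 1))(0 := (k(b := k b - 1)) 0 + 1)"
  have t: "t \<in> bosonic_states n m"
    unfolding t_def using b k boson_transfer_bosonic_states[of 0 n b k m] by simp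
  have "k 0 + k b \<le> (\<Sum>a<n + 1. k a)"
    using b sum_mono2[of "{..<n + 1}" "{0, b}" k] by simp
  then have "k 0 < m"
    using b k by (simp add: bosonic_states_def)
  moreover have "boson_create 0 (boson_annihilate b (delta k)) t \<noteq> (0 :: 'k)"
    "boson_create b (boson_annihilate 0 (delta t)) k \<noteq> (0 :: 'k)"
  proof -
    have "(t(0 := t 0 - 1))(b := (t(0 := t 0 - 1)) b + 1) = k" "t 0 \<noteq> 0"
      using b by (auto simp: t_def fun_eq_iff)
    then show "boson_create 0 (boson_annihilate b (delta k)) t \<noteq> (0 :: 'k)"
      unfolding boson_transfer by (simp add: delta_def del: of_nat_add of_nat_Suc)
    show "boson_create b (boson_annihilate 0 (delta t)) k \<noteq> (0 :: 'k)"
      using b unfolding boson_transfer t_def by (simp add: delta_def del: of_nat_add of_nat_Suc)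
  qed
  ultimately show "\<exists>t\<in>bosonic_states n m. m - t 0 < m - k 0 \<and> (\<exists>a<n + 1. \<exists>b<n + 1. a \<noteq> b \<and>
      boson_create a (boson_annihilate b (delta k)) t \<noteq> (0 :: 'k) \<and>
      boson_create b (boson_annihilate a (delta t)) k \<noteq> (0 :: 'k))"
    using t b by (intro bexI[of _ t] conjI exI[of _ 0] exI[of _ b]) (auto simp: t_def)
qed

lemma fermion_transfer:
  assumes "a \<noteq> b"
  shows "fermion_create a (fermion_annihilate b f) S = (if a \<in> S \<and> b \<notin> S
    then fermion_sign a S * fermion_sign b (S - {a}) * f (insert b (S - {a})) else 0)"
  using assms by (simp add: fermion_create_def fermion_annihilate_def)

lemma fermion_number:
  "fermion_create a (fermion_annihilate a f) S = of_bool (a \<in> S) * (f S :: 'k::field)"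
proof (cases "a \<in> S")
  case True
  then have "fermion_create a (fermion_annihilate a f) S = fermion_sign a S * fermion_sign a S * f S"
    by (simp add: fermion_create_def fermion_annihilate_def fermion_sign_remove insert_absorb)
  then show ?thesis
    using True by simp
qed (simp add: fermion_create_def)

lemma sum_fermionic_states:
  assumes "S \<in> fermionic_states n m"
  shows "(\<Sum>a<n + 1. of_bool (a \<in> S)) = m"
proof -
  have "{..<n + 1} \<inter> S = S"
    using assms by (auto simp: fermionic_states_def)
  then show ?thesis
    using assms by (simp add: sum_of_bool_eq fermionic_states_def del: sum.lessThan_Suc)
qed

text \<open>The exterior power. A subset other than the initial segment has an element outside of it, which can be
  exchanged with a missing one.\<close>

proposition quadratic_model_fermions:
  assumes m: "m \<le> n + 1"
  shows "quadratic_model (type_A n :: 'k::field_char_0 lie_datum) (n + 1) (fermionic_states n m) fermion.E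
    (\<lambda>S. occupation_weight (n + 1) (\<lambda>a. of_bool (a \<in> S)))
    {..<m} (\<lambda>S. card (S - {..<m}))"
proof (rule quadratic_model_type_A[where occ = "\<lambda>S a. of_bool (a \<in> S)" and m = m, OF fermion.oscillator_axioms])
  show "finite (fermionic_states n m)"
    by (rule finite_subset[of _ "Pow {..n}"]) (auto simp: fermionic_states_def)
  show "{..<m} \<in> fermionic_states n m"
    using m by (auto simp: fermionic_states_def)
  have fin: "finite S" if "S \<in> fermionic_states n m" for S
    using that finite_subset by (auto simp: fermionic_states_def)
  show "fermion_create a (fermion_annihilate b f) S = 0"
    if "a < n + 1" "b < n + 1" "\<And>S. S \<notin> fermionic_states n m \<Longrightarrow> f S = 0" "S \<notin> fermionic_states n m"
    for a b S and f :: "nat set \<Rightarrow> 'k"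
  proof (cases "a \<noteq> b \<and> a \<in> S \<and> b \<notin> S")
    case True
    have "insert b (S - {a}) \<notin> fermionic_states n m"
    proof
      assume *: "insert b (S - {a}) \<in> fermionic_states n m"
      then have "finite S"
        using fin by fastforce
      then have "card (insert b (S - {a})) = card S"
        using True card.remove[of S a] by simp
      then show False
        using * that by (auto simp: fermionic_states_def)
    qed
    then show ?thesis
      using that True by (simp add: fermion_transfer)
  next
    case False
    then show ?thesis
      using that by (cases "a = b") (auto simp: fermion_transfer fermion_number)
  qed
  show "fermion_create a (fermion_annihilate a f) S = of_nat (of_bool (a \<in> S)) * f S"
    for a S and f :: "nat set \<Rightarrow> 'k"
    by (simp add: fermion_number)
  show "(\<Sum>a<n + 1. of_bool (a \<in> S)) = m" if "S \<in> fermionic_states n m" for S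
    using that by (rule sum_fermionic_states)
  show "\<exists>a<n + 1. of_bool (a \<in> S) \<noteq> (of_bool (a \<in> T) :: nat)"
    if ST: "S \<in> fermionic_states n m" "T \<in> fermionic_states n m" "S \<noteq> T" for S T
  proof -
    obtain a where "a \<in> S \<longleftrightarrow> a \<notin> T"
      using ST(3) by blast
    then show ?thesis
      using ST(1,2) by (intro exI[of _ a]) (auto simp: fermionic_states_def)
  qed
  show "fermion_create a (fermion_annihilate b (delta {..<m})) S = (0 :: 'k)" if "a < b" for a b S
  proof -
    have "insert b (S - {a}) \<noteq> {..<m}"
      using that by (metis Diff_iff insert_iff lessThan_iff less_trans less_irrefl)
    then show ?thesis
      using that by (simp add: fermion_transfer delta_def)
  qed
  fix S assume S: "S \<in> fermionic_states n m" "S \<noteq> {..<m}"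
  have card: "card S = card {..<m}" and sub: "S \<subseteq> {..n}"
    using S by (auto simp: fermionic_states_def)
  have "\<not> S \<subseteq> {..<m}" "\<not> {..<m} \<subseteq> S"
    using S fin card card_subset_eq by (metis finite_lessThan)+
  then obtain a b where ab: "b \<in> S" "\<not> b < m" "a < m" "a \<notin> S"
    by auto
  define T where "T = insert a (S - {b})"
  have "card T = card S"
    using ab fin[OF S(1)] card.remove[of S b] by (simp add: T_def)
  then have T: "T \<in> fermionic_states n m"
    using S ab m by (auto simp: T_def fermionic_states_def)
  have "T - {..<m} \<subset> S - {..<m}"
    using ab by (auto simp: T_def)
  then have "card (T - {..<m}) < card (S - {..<m})"
    using fin[OF S(1)] by (intro psubset_card_mono) auto
  moreover have move: "insert b (T - {a}) = S" "insert a (S - {b}) = T" "a \<in> T" "b \<notin> T" "a \<noteq> b"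
    using ab by (auto simp: T_def)
  moreover have "fermion_create a (fermion_annihilate b (delta S)) T \<noteq> (0 :: 'k)"
    using move by (simp add: fermion_transfer delta_def)
  moreover have "fermion_create b (fermion_annihilate a (delta T)) S \<noteq> (0 :: 'k)"
    using move ab by (simp add: fermion_transfer delta_def)
  moreover have "a < n + 1" "b < n + 1"
    using ab m sub by auto
  ultimately show "\<exists>T\<in>fermionic_states n m. card (T - {..<m}) < card (S - {..<m}) \<and>
      (\<exists>a<n + 1. \<exists>b<n + 1. a \<noteq> b \<and>
        fermion_create a (fermion_annihilate b (delta S)) T \<noteq> (0 :: 'k) \<and>
        fermion_create b (fermion_annihilate a (delta T)) S \<noteq> (0 :: 'k))"
    using T by blast
qed

section \<open>Isomorphisms in type A\<close>

lemma weight_poset_iso_type_A: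
  fixes occ :: "'i \<Rightarrow> nat \<Rightarrow> nat" and occ' :: "'j \<Rightarrow> nat \<Rightarrow> nat"
    and lam lam' :: "'k::field_char_0 weight"
  assumes M: "quadratic_model (type_A n :: 'k lie_datum) (n + 1) I E (\<lambda>s. occupation_weight (n + 1) (occ s)) hi depth"
    and M': "quadratic_model (type_A n' :: 'k lie_datum) (n' + 1) I' E' (\<lambda>s. occupation_weight (n' + 1) (occ' s)) hi' depth'"
    and lam: "\<And>h. h \<in> cartan (type_A n) \<Longrightarrow> lam h = occupation_weight (n + 1) (occ hi) h"
    and lam': "\<And>h. h \<in> cartan (type_A n') \<Longrightarrow> lam' h = occupation_weight (n' + 1) (occ' hi') h"
    and total: "\<And>s. s \<in> I \<Longrightarrow> (\<Sum>a<n + 1. occ s a) = m"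
    and total': "\<And>s. s \<in> I' \<Longrightarrow> (\<Sum>a<n' + 1. occ' s a) = m'"
    and f: "bij_betw f I I'"
    and raise: "\<And>s t. s \<in> I \<Longrightarrow> t \<in> I \<Longrightarrow> raises n (occ s) (occ t) \<longleftrightarrow> raises n' (occ' (f s)) (occ' (f t))"
  shows "weight_poset (type_A n) lam \<simeq> weight_poset (type_A n') lam'"
proof -
  interpret M: quadratic_model "type_A n :: 'k lie_datum" "n + 1" I E "\<lambda>s. occupation_weight (n + 1) (occ s)" hi depth
    by (rule M)
  interpret M': quadratic_model "type_A n' :: 'k lie_datum" "n' + 1" I' E' "\<lambda>s. occupation_weight (n' + 1) (occ' s)" hi' depth'
    by (rule M')
  have W: "weights (type_A n) lam =
      (\<lambda>s. restrict (occupation_weight (n + 1) (occ s)) (cartan (type_A n))) ` I"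
    using lam by (rule M.weights_eq)
  have W': "weights (type_A n') lam' =
      (\<lambda>s. restrict (occupation_weight (n' + 1) (occ' s)) (cartan (type_A n'))) ` I'"
    using lam' by (rule M'.weights_eq)
  show ?thesis
  proof (rule weight_poset_iso[OF W W' M.restricted_weights_inj M'.restricted_weights_inj f])
    fix s t assume st: "s \<in> I" "t \<in> I"
    then have fst: "f s \<in> I'" "f t \<in> I'"
      using f by (auto simp: bij_betw_apply)
    have "(\<Sum>a<n + 1. occ s a) = (\<Sum>a<n + 1. occ t a)" "(\<Sum>a<n' + 1. occ' (f s) a) = (\<Sum>a<n' + 1. occ' (f t) a)"
      by (simp_all only: total total' st fst)
    then show "(restrict (occupation_weight (n + 1) (occ s)) (cartan (type_A n)),
          restrict (occupation_weight (n + 1) (occ t)) (cartan (type_A n))) \<in> covers (type_A n) lam \<longleftrightarrow>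
        (restrict (occupation_weight (n' + 1) (occ' (f s))) (cartan (type_A n')),
          restrict (occupation_weight (n' + 1) (occ' (f t))) (cartan (type_A n'))) \<in> covers (type_A n') lam'"
      using M.covers_iff[OF lam st] M'.covers_iff[OF lam' fst] raise[OF st]
      by (simp only: occupation_weight_covers_iff)
  qed
qed

lemma varpi_A_occupation:
  assumes "m \<le> n + 1"
  shows "varpi_A m (h :: 'k::field mat) = occupation_weight (n + 1) (\<lambda>a. of_bool (a \<in> {..<m})) h"
proof -
  have "varpi_A m h = (\<Sum>a<m. h $$ (a, a))"
    unfolding varpi_A_def eps_def by (rule sum.reindex_bij_witness[of _ Suc "\<lambda>i. i - 1"]) auto
  also have "\<dots> = (\<Sum>a<n + 1. if a \<in> {..<m} then h $$ (a, a) else 0)"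
    using assms by (intro sum.mono_neutral_cong_left) auto
  also have "\<dots> = occupation_weight (n + 1) (\<lambda>a. of_bool (a \<in> {..<m})) h"
    unfolding occupation_weight_def by (intro sum.cong refl) auto
  finally show ?thesis .
qed

lemma multiple_varpi_A_occupation:
  "(m \<odot> varpi_A 1) (h :: 'k::field mat) = occupation_weight (n + 1) (\<lambda>a. if a = 0 then m else 0) h"
proof -
  have "occupation_weight (n + 1) (\<lambda>a. if a = 0 then m else 0) h =
      (\<Sum>a<n + 1. if a = 0 then of_nat m * h $$ (0, 0) else 0)"
    unfolding occupation_weight_def by (intro sum.cong refl) auto
  then show ?thesis
    by (simp add: weight_mult_def varpi_A_def eps_def del: sum.lessThan_Suc)
qed

lemma raises_set_iff:
  assumes "U \<subseteq> {..n}" "V \<subseteq> {..n}"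
  shows "raises n (\<lambda>a. of_bool (a \<in> U)) (\<lambda>a. of_bool (a \<in> V)) \<longleftrightarrow>
    (\<exists>t. t \<notin> U \<and> Suc t \<in> U \<and> V = insert t (U - {Suc t}))"
proof
  assume "raises n (\<lambda>a. of_bool (a \<in> U)) (\<lambda>a. of_bool (a \<in> V))"
  then obtain t where t: "t < n" and eq: "\<And>a. a < n + 1 \<Longrightarrow>
      of_bool (a \<in> V) + of_bool (a = Suc t) = (of_bool (a \<in> U) + of_bool (a = t) :: nat)"
    unfolding raises_def by blast
  have "t \<notin> U" "t \<in> V"
    using eq[of t] t by (cases "t \<in> U"; cases "t \<in> V"; simp)+
  moreover have "Suc t \<in> U" "Suc t \<notin> V"
    using eq[of "Suc t"] t by (cases "Suc t \<in> U"; cases "Suc t \<in> V"; simp)+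
  moreover have "a \<in> V \<longleftrightarrow> a \<in> U" if "a \<noteq> t" "a \<noteq> Suc t" for a
  proof (cases "a < n + 1")
    case True
    then show ?thesis
      using eq[of a] that by (cases "a \<in> U"; cases "a \<in> V"; simp)
  next
    case False
    then show ?thesis
      using assms by auto
  qed
  ultimately have "a \<in> V \<longleftrightarrow> a \<in> insert t (U - {Suc t})" for a
    by (cases "a = t"; cases "a = Suc t"; simp)
  with \<open>t \<notin> U\<close> \<open>Suc t \<in> U\<close> show "\<exists>t. t \<notin> U \<and> Suc t \<in> U \<and> V = insert t (U - {Suc t})"
    by blast
next
  assume "\<exists>t. t \<notin> U \<and> Suc t \<in> U \<and> V = insert t (U - {Suc t})"
  then obtain t where t: "t \<notin> U" "Suc t \<in> U" "V = insert t (U - {Suc t})"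
    by blast
  then have "t < n"
    using assms by auto
  with t show "raises n (\<lambda>a. of_bool (a \<in> U)) (\<lambda>a. of_bool (a \<in> V))"
    unfolding raises_def by (intro exI[of _ t]) auto
qed

subsection \<open>Stars and bars\<close>

definition gaps_below :: "nat set \<Rightarrow> nat \<Rightarrow> nat" where
  "gaps_below U u = card {s. s < u \<and> s \<notin> U}"

text \<open>Elements of \<open>U\<close> are stars, the other places are bars; a gap is a run of stars, possibly
  empty, before, between or after the bars.\<close>

definition gap_counts :: "nat set \<Rightarrow> nat \<Rightarrow> nat" where
  "gap_counts U j = card {u \<in> U. gaps_below U u = j}"

lemma gaps_below_0 [simp]: "gaps_below U 0 = 0"
  by (simp add: gaps_below_def)

lemma gaps_below_Suc: "gaps_below U (Suc u) = gaps_below U u + of_bool (u \<notin> U)"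
proof -
  have "{s. s < Suc u \<and> s \<notin> U} = (if u \<in> U then {s. s < u \<and> s \<notin> U} else insert u {s. s < u \<and> s \<notin> U})"
    by (auto simp: less_Suc_eq)
  then show ?thesis
    by (simp add: gaps_below_def)
qed

lemma gaps_below_mono: "u \<le> v \<Longrightarrow> gaps_below U u \<le> gaps_below U v"
  by (induction v rule: dec_induct) (simp_all add: gaps_below_Suc)

lemma gaps_below_cong: "(\<And>s. s < u \<Longrightarrow> s \<in> U \<longleftrightarrow> s \<in> V) \<Longrightarrow> gaps_below U u = gaps_below V u"
  unfolding gaps_below_def by (intro arg_cong[where f = card]) auto

lemma gaps_below_total:
  assumes "U \<subseteq> {..<N}"
  shows "gaps_below U N + card U = N"
proof -
  have "{s. s < N \<and> s \<notin> U} = {..<N} - U"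
    by auto
  moreover have "card U \<le> N"
    using card_mono[OF _ assms] by simp
  ultimately show ?thesis
    using assms by (simp add: gaps_below_def card_Diff_subset finite_subset[OF assms])
qed

lemma sum_gap_counts:
  assumes "U \<subseteq> {..<n + m}" "card U = m"
  shows "(\<Sum>j<n + 1. gap_counts U j) = m" "j > n \<Longrightarrow> gap_counts U j = 0"
proof -
  have fin: "finite U"
    using assms finite_subset by blast
  have le: "gaps_below U u \<le> n" if "u \<in> U" for u
    using gaps_below_mono[of u "n + m" U] gaps_below_total[OF assms(1)] assms that by auto
  have "(\<Sum>j<n + 1. gap_counts U j) = (\<Sum>j<n + 1. \<Sum>u | u \<in> U \<and> gaps_below U u = j. 1)"
    by (simp add: gap_counts_def del: sum.lessThan_Suc)
  also have "\<dots> = (\<Sum>u\<in>U. 1)"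
    using fin le by (intro sum.group) (auto simp: less_Suc_eq_le)
  finally show "(\<Sum>j<n + 1. gap_counts U j) = m"
    using assms by simp
  show "gap_counts U j = 0" if "j > n"
  proof -
    have "gaps_below U u \<noteq> j" if "u \<in> U" for u
      using le[OF that] \<open>j > n\<close> by simp
    then have "{u \<in> U. gaps_below U u = j} = {}"
      by blast
    then show ?thesis
      unfolding gap_counts_def by (simp only: card.empty)
  qed
qed

lemma gap_counts_insert:
  assumes "U \<subseteq> {..<N}"
  shows "gap_counts (insert N U) j = gap_counts U j + of_bool (j = gaps_below U N)"
proof -
  have below: "gaps_below (insert N U) u = gaps_below U u" if "u \<le> N" for u
    using that by (intro gaps_below_cong) auto
  have "{u \<in> insert N U. gaps_below (insert N U) u = j} =
      (if j = gaps_below U N then insert N {u \<in> U. gaps_below U u = j} else {u \<in> U. gaps_below U u = j})"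
    using below assms by (auto simp: less_imp_le subset_iff)
  moreover have "finite {u \<in> U. gaps_below U u = j}" "N \<notin> U"
    using assms finite_subset[OF assms] by auto
  ultimately show ?thesis
    unfolding gap_counts_def by (cases "j = gaps_below U N") (simp_all only: if_True if_False, simp_all)
qed

text \<open>The last place is a star if and only if the last gap is nonempty; remove it and continue.\<close>

lemma gap_counts_inj:
  assumes "U \<subseteq> {..<N}" "V \<subseteq> {..<N}" "card U = card V" "gap_counts U = gap_counts V"
  shows "U = V"
  using assms
proof (induction N arbitrary: U V)
  case (Suc N)
  \<comment> \<open>The number of bars, that is, the number of the last gap.\<close>
  define \<beta> where "\<beta> = Suc N - card U"
  have last: "N \<in> W \<longleftrightarrow> gap_counts W \<beta> > 0" if W: "W \<subseteq> {..<Suc N}" "card W = card U" for W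
  proof -
    have tot: "gaps_below W N + of_bool (N \<notin> W) = \<beta>"
      using gaps_below_total[OF W(1)] W(2) by (simp add: gaps_below_Suc \<beta>_def)
    have fin: "finite W"
      using W(1) finite_subset by blast
    show ?thesis
    proof
      assume "N \<in> W"
      then have "N \<in> {u \<in> W. gaps_below W u = \<beta>}"
        using tot by simp
      then show "gap_counts W \<beta> > 0"
        unfolding gap_counts_def using fin by (subst card_gt_0_iff) auto
    next
      assume "gap_counts W \<beta> > 0"
      then obtain u where u: "u \<in> W" "gaps_below W u = \<beta>"
        unfolding gap_counts_def by (subst (asm) card_gt_0_iff) auto
      then have "gaps_below W u \<le> gaps_below W N"
        using W(1) by (intro gaps_below_mono) auto
      then show "N \<in> W"
        using tot u by (cases "N \<in> W") auto
    qed
  qed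
  have iff: "N \<in> U \<longleftrightarrow> N \<in> V"
    using last[of U] last[of V] Suc.prems by simp
  show ?case
  proof (cases "N \<in> U")
    case True
    then have NV: "N \<in> V"
      using iff by simp
    define U' V' where "U' = U - {N}" and "V' = V - {N}"
    have sub: "U' \<subseteq> {..<N}" "V' \<subseteq> {..<N}" and ins: "U = insert N U'" "V = insert N V'"
      using Suc.prems True NV by (auto simp: U'_def V'_def less_Suc_eq)
    have notin: "N \<notin> U'" "N \<notin> V'" "finite U'" "finite V'"
      using sub finite_subset by auto
    then have card: "card U' = card V'"
      using Suc.prems(3) by (simp add: ins)
    then have "gaps_below U' N = gaps_below V' N"
      using gaps_below_total[OF sub(1)] gaps_below_total[OF sub(2)] by simp
    then have "gap_counts U' j = gap_counts V' j" for j
      using fun_cong[OF Suc.prems(4), of j] gap_counts_insert[OF sub(1), of j] gap_counts_insert[OF sub(2), of j]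
      by (simp add: ins)
    then have "U' = V'"
      using Suc.IH[OF sub card] by blast
    then show ?thesis
      by (simp add: ins)
  next
    case False
    then have "U \<subseteq> {..<N}" "V \<subseteq> {..<N}"
      using Suc.prems iff less_Suc_eq by auto
    then show ?thesis
      using Suc by blast
  qed
qed simp

lemma gap_counts_surj:
  assumes "k \<in> bosonic_states n m"
  shows "\<exists>U. U \<subseteq> {..<n + m} \<and> card U = m \<and> gap_counts U = k"
  using assms
proof (induction "n + m" arbitrary: n m k)
  case 0
  then have "k = gap_counts {}"
    by (auto simp: bosonic_states_def gap_counts_def fun_eq_iff) (metis gr0I)
  then show ?case
    using 0 by (intro exI[of _ "{}"]) auto
next
  case (Suc N)
  have k: "\<And>a. a > n \<Longrightarrow> k a = 0" "(\<Sum>a<n. k a) + k n = m"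
    using Suc.prems by (auto simp: bosonic_states_def)
  show ?case
  proof (cases "k n = 0")
    case True
    have "n \<noteq> 0"
    proof
      assume "n = 0"
      then show False
        using k True Suc.hyps(2) by simp
    qed
    then obtain n' where n': "n = Suc n'"
      using not0_implies_Suc by blast
    have "k \<in> bosonic_states n' m"
      using k True unfolding bosonic_states_def n'
      by (auto simp: less_Suc_eq) (metis Suc_lessI)
    then obtain U where "U \<subseteq> {..<n' + m}" "card U = m" "gap_counts U = k"
      using Suc.hyps(1)[of n' m k] Suc.hyps(2) n' by auto
    then show ?thesis
      using n' by (intro exI[of _ U]) auto
  next
    case False
    then obtain m' where m': "m = Suc m'"
      using k(2) by (cases m) auto
    have "k(n := k n - 1) \<in> bosonic_states n m'"
      using k False by (auto simp: bosonic_states_def m')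
    then obtain U where U: "U \<subseteq> {..<n + m'}" "card U = m'" "gap_counts U = k(n := k n - 1)"
      using Suc.hyps(1)[of n m' "k(n := k n - 1)"] Suc.hyps(2) m' by auto
    have "gaps_below U (n + m') = n"
      using gaps_below_total[OF U(1)] U(2) by simp
    then have "gap_counts (insert (n + m') U) = k"
      using gap_counts_insert[OF U(1)] U(3) False by (auto simp: fun_eq_iff)
    moreover have "card (insert (n + m') U) = m"
      using U m' finite_subset[OF U(1)] by (subst card_insert_disjoint) auto
    moreover have "insert (n + m') U \<subseteq> {..<n + m}"
      using U(1) m' by auto
    ultimately show ?thesis
      by blast
  qed
qed

text \<open>Moving a star down across the bar \<open>t\<close> puts it into the preceding gap and leaves the numbers of bars below
  all other stars unchanged.\<close>

lemma gap_counts_move: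
  assumes fin: "finite U" and t: "t \<notin> U" "Suc t \<in> U"
  shows "gap_counts (insert t (U - {Suc t})) a + of_bool (a = Suc (gaps_below U t)) =
    gap_counts U a + of_bool (a = gaps_below U t)"
proof -
  define W where "W = U - {Suc t}"
  define V where "V = insert t W"
  have le: "gaps_below V u = gaps_below U u" if "u \<le> t" for u
    using that by (intro gaps_below_cong) (auto simp: V_def W_def)
  have ge: "gaps_below V u = gaps_below U u" if "Suc (Suc t) \<le> u" for u
    using that
  proof (induction u rule: dec_induct)
    case base
    show ?case
      using t le[of t] by (simp add: gaps_below_Suc V_def W_def)
  next
    case (step u)
    then show ?case
      by (auto simp: gaps_below_Suc V_def W_def)
  qed
  have same: "gaps_below V u = gaps_below U u" if "u \<in> W" for u
    using that le[of u] ge[of u] t by (cases "u \<le> t") (auto simp: W_def not_le less_eq_Suc_le le_Suc_eq)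
  let ?F = "{u \<in> W. gaps_below U u = a}"
  have F: "finite ?F" "t \<notin> ?F" "Suc t \<notin> ?F"
    using fin t by (auto simp: W_def)
  have "{u \<in> U. gaps_below U u = a} = (if a = Suc (gaps_below U t) then insert (Suc t) ?F else ?F)"
    using t by (auto simp: W_def gaps_below_Suc)
  then have "gap_counts U a = card ?F + of_bool (a = Suc (gaps_below U t))"
    unfolding gap_counts_def using F
    by (cases "a = Suc (gaps_below U t)") (simp_all only: if_True if_False, simp_all)
  moreover have "{u \<in> V. gaps_below V u = a} = (if a = gaps_below U t then insert t ?F else ?F)"
    using same le[of t] by (auto simp: V_def)
  then have "gap_counts V a = card ?F + of_bool (a = gaps_below U t)"
    unfolding gap_counts_def using F
    by (cases "a = gaps_below U t") (simp_all only: if_True if_False, simp_all)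
  ultimately show ?thesis
    by (simp add: V_def W_def)
qed

lemma gap_counts_bij:
  assumes "n + m \<ge> 1"
  shows "bij_betw gap_counts (fermionic_states (n + m - 1) m) (bosonic_states n m)"
proof -
  have "{..n + m - 1} = {..<n + m}"
    using assms by auto
  then have states: "fermionic_states (n + m - 1) m = {U. U \<subseteq> {..<n + m} \<and> card U = m}"
    by (simp add: fermionic_states_def)
  show ?thesis
    unfolding bij_betw_def states
  proof (intro conjI inj_onI)
    fix U V assume "U \<in> {U. U \<subseteq> {..<n + m} \<and> card U = m}" "V \<in> {U. U \<subseteq> {..<n + m} \<and> card U = m}"
      "gap_counts U = gap_counts V"
    then show "U = V"
      using gap_counts_inj[of U "n + m" V] by auto
  next
    show "gap_counts ` {U. U \<subseteq> {..<n + m} \<and> card U = m} = bosonic_states n m"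
    proof (intro equalityI subsetI)
      fix k assume "k \<in> gap_counts ` {U. U \<subseteq> {..<n + m} \<and> card U = m}"
      then show "k \<in> bosonic_states n m"
        using sum_gap_counts[of _ n m] by (auto simp: bosonic_states_def simp del: sum.lessThan_Suc)
    next
      fix k assume "k \<in> bosonic_states n m"
      then show "k \<in> gap_counts ` {U. U \<subseteq> {..<n + m} \<and> card U = m}"
        using gap_counts_surj[of k n m] by blast
    qed
  qed
qed

text \<open>Moving a star across a bar moves a particle between gaps. Conversely, suppose that a particle moves from gap \<open>i + 1\<close> to gap \<open>i\<close>. The lowest star of gap \<open>i + 1\<close> stands
  directly above a bar, and moving it across that bar yields a subset with the same numbers of stars as
  \<open>V\<close>, hence \<open>V\<close> itself.\<close>

lemma raises_gap_counts:
  assumes U: "U \<in> fermionic_states (n + m - 1) m" and V: "V \<in> fermionic_states (n + m - 1) m"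
    and nm: "n + m \<ge> 1"
  shows "raises (n + m - 1) (\<lambda>a. of_bool (a \<in> U)) (\<lambda>a. of_bool (a \<in> V)) \<longleftrightarrow>
    raises n (gap_counts U) (gap_counts V)"
proof -
  have fin: "finite U"
    using U finite_subset by (auto simp: fermionic_states_def)
  have sub: "U \<subseteq> {..<n + m}" "card U = m"
    using U nm by (auto simp: fermionic_states_def)
  have set_iff: "raises (n + m - 1) (\<lambda>a. of_bool (a \<in> U)) (\<lambda>a. of_bool (a \<in> V)) \<longleftrightarrow>
      (\<exists>t. t \<notin> U \<and> Suc t \<in> U \<and> V = insert t (U - {Suc t}))"
    using U V by (intro raises_set_iff) (auto simp: fermionic_states_def)
  show ?thesis
    unfolding set_iff
  proof
    assume "\<exists>t. t \<notin> U \<and> Suc t \<in> U \<and> V = insert t (U - {Suc t})"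
    then obtain t where t: "t \<notin> U" "Suc t \<in> U" "V = insert t (U - {Suc t})"
      by blast
    have "gaps_below U (Suc t) \<le> gaps_below U (n + m)"
      using t sub by (intro gaps_below_mono) auto
    then have "gaps_below U t < n"
      using t gaps_below_total[OF sub(1)] sub(2) by (simp add: gaps_below_Suc)
    then show "raises n (gap_counts U) (gap_counts V)"
      unfolding raises_def using gap_counts_move[OF fin t(1,2)] t(3) by (intro exI[of _ "gaps_below U t"]) simp
  next
    assume "raises n (gap_counts U) (gap_counts V)"
    then obtain i where i: "i < n" and eq: "\<And>a. a < n + 1 \<Longrightarrow>
        gap_counts V a + of_bool (a = Suc i) = gap_counts U a + of_bool (a = i)"
      unfolding raises_def by blast
    have "gap_counts U (Suc i) > 0"
      using eq[of "Suc i"] i by simp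
    then obtain u0 where "u0 \<in> U \<and> gaps_below U u0 = Suc i"
      unfolding gap_counts_def by (subst (asm) card_gt_0_iff) auto
    then obtain u where u: "u \<in> U" "gaps_below U u = Suc i"
      and least: "\<And>v. v < u \<Longrightarrow> \<not> (v \<in> U \<and> gaps_below U v = Suc i)"
      using exists_least_iff[of "\<lambda>u. u \<in> U \<and> gaps_below U u = Suc i"] by blast
    then obtain t where t: "u = Suc t"
      by (cases u) auto
    have tU: "t \<notin> U"
      using least[of t] u t by (auto simp: gaps_below_Suc)
    then have below: "gaps_below U t = i"
      using u t by (simp add: gaps_below_Suc)
    define V' where "V' = insert t (U - {Suc t})"
    have "card V' = card U"
      using fin tU u t card.remove[of U "Suc t"] by (simp add: V'_def)
    then have V': "V' \<in> fermionic_states (n + m - 1) m"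
      using sub u t by (auto simp: V'_def fermionic_states_def)
    have "gap_counts V' a = gap_counts V a" for a
    proof (cases "a < n + 1")
      case True
      then show ?thesis
        using eq[of a] gap_counts_move[OF fin tU, of a] u t below by (simp add: V'_def)
    next
      case False
      then show ?thesis
        using bij_betw_apply[OF gap_counts_bij[OF nm] V'] bij_betw_apply[OF gap_counts_bij[OF nm] V]
        by (simp add: bosonic_states_def)
    qed
    then have "V' = V"
      using gap_counts_bij[OF nm] V V' by (auto simp: bij_betw_def inj_on_def fun_eq_iff)
    then show "\<exists>t. t \<notin> U \<and> Suc t \<in> U \<and> V = insert t (U - {Suc t})"
      using tU u t V'_def by blast
  qed
qed

lemma symmetric_power_iso_exterior_power:
  assumes "n \<ge> 1" "m \<ge> 1"
  shows "weight_poset (type_A n :: 'k::field_char_0 lie_datum) (m \<odot> varpi_A 1) \<simeq>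
    weight_poset (type_A (n + m - 1)) (varpi_A m)"
proof -
  have "weight_poset (type_A (n + m - 1) :: 'k lie_datum) (varpi_A m) \<simeq> weight_poset (type_A n) (m \<odot> varpi_A 1)"
  proof (rule weight_poset_iso_type_A[OF _ quadratic_model_bosons])
    show "quadratic_model (type_A (n + m - 1) :: 'k lie_datum) (n + m - 1 + 1) (fermionic_states (n + m - 1) m) fermion.E
        (\<lambda>S. occupation_weight (n + m - 1 + 1) (\<lambda>a. of_bool (a \<in> S))) {..<m} (\<lambda>S. card (S - {..<m}))"
      by (rule quadratic_model_fermions) (use assms in simp)
    show "bij_betw gap_counts (fermionic_states (n + m - 1) m) (bosonic_states n m)"
      using assms by (intro gap_counts_bij) simp
    show "varpi_A m h = occupation_weight (n + m - 1 + 1) (\<lambda>a. of_bool (a \<in> {..<m})) h" for h :: "'k mat"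
      by (rule varpi_A_occupation) (use assms in simp)
    show "(m \<odot> varpi_A 1) h = occupation_weight (n + 1) (\<lambda>a. if a = 0 then m else 0) h" for h :: "'k mat"
      by (rule multiple_varpi_A_occupation)
    show "(\<Sum>a<n + m - 1 + 1. of_bool (a \<in> S)) = m" if "S \<in> fermionic_states (n + m - 1) m" for S
      using that by (rule sum_fermionic_states)
    show "(\<Sum>a<n + 1. k a) = m" if "k \<in> bosonic_states n m" for k
      using that by (simp add: bosonic_states_def)
    show "raises (n + m - 1) (\<lambda>a. of_bool (a \<in> S)) (\<lambda>a. of_bool (a \<in> T)) \<longleftrightarrow>
        raises n (gap_counts S) (gap_counts T)"
      if "S \<in> fermionic_states (n + m - 1) m" "T \<in> fermionic_states (n + m - 1) m" for S T
      using that assms by (intro raises_gap_counts) auto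
  qed
  then show ?thesis
    by (rule poset_iso_sym)
qed

subsection \<open>Duality of exterior powers\<close>

text \<open>The complement of the reflected subset: complement and reflection each reverse the order.\<close>

definition dual_state :: "nat \<Rightarrow> nat set \<Rightarrow> nat set" where
  "dual_state n S = {a. a \<le> n \<and> n - a \<notin> S}"

lemma dual_state_involution:
  "S \<subseteq> {..n} \<Longrightarrow> dual_state n (dual_state n S) = S"
  by (auto simp: dual_state_def)

lemma dual_state_mem:
  assumes "S \<in> fermionic_states n m" "m + m' = n + 1"
  shows "dual_state n S \<in> fermionic_states n m'"
proof -
  have "bij_betw (\<lambda>a. n - a) (dual_state n S) ({..n} - S)"
    by (rule bij_betwI[where g = "\<lambda>a. n - a"]) (auto simp: dual_state_def)
  then have "card (dual_state n S) = card ({..n} - S)"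
    by (rule bij_betw_same_card)
  also have "\<dots> = m'"
    using assms finite_subset[of S "{..n}"] by (subst card_Diff_subset) (auto simp: fermionic_states_def)
  finally show ?thesis
    by (auto simp: fermionic_states_def dual_state_def)
qed

lemma raises_dual_state:
  assumes "raises n (\<lambda>a. of_bool (a \<in> S)) (\<lambda>a. of_bool (a \<in> T))"
  shows "raises n (\<lambda>a. of_bool (a \<in> dual_state n S)) (\<lambda>a. of_bool (a \<in> dual_state n T))"
proof -
  obtain i where i: "i < n" and eq: "\<And>a. a < n + 1 \<Longrightarrow>
      of_bool (a \<in> T) + of_bool (a = Suc i) = (of_bool (a \<in> S) + of_bool (a = i) :: nat)"
    using assms unfolding raises_def by blast
  have "of_bool (a \<in> dual_state n T) + of_bool (a = Suc (n - Suc i)) =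
      (of_bool (a \<in> dual_state n S) + of_bool (a = n - Suc i) :: nat)" if "a < n + 1" for a
  proof -
    have "a = Suc (n - Suc i) \<longleftrightarrow> n - a = i" "a = n - Suc i \<longleftrightarrow> n - a = Suc i"
      using i that by linarith+
    moreover have "of_bool (n - a \<in> T) + of_bool (n - a = Suc i) =
        (of_bool (n - a \<in> S) + of_bool (n - a = i) :: nat)"
      by (rule eq) simp
    ultimately show ?thesis
      using that
      by (cases "n - a \<in> S"; cases "n - a \<in> T"; cases "n - a = i"; simp add: dual_state_def)
  qed
  then show ?thesis
    unfolding raises_def using i by (intro exI[of _ "n - Suc i"]) simp
qed

lemma exterior_power_duality:
  assumes "m + m' = n + 1"
  shows "weight_poset (type_A n :: 'k::field_char_0 lie_datum) (varpi_A m) \<simeq>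
    weight_poset (type_A n) (varpi_A m')"
proof (rule weight_poset_iso_type_A)
  show "quadratic_model (type_A n :: 'k lie_datum) (n + 1) (fermionic_states n m) fermion.E
      (\<lambda>S. occupation_weight (n + 1) (\<lambda>a. of_bool (a \<in> S))) {..<m} (\<lambda>S. card (S - {..<m}))"
    "quadratic_model (type_A n :: 'k lie_datum) (n + 1) (fermionic_states n m') fermion.E
      (\<lambda>S. occupation_weight (n + 1) (\<lambda>a. of_bool (a \<in> S))) {..<m'} (\<lambda>S. card (S - {..<m'}))"
    by (rule quadratic_model_fermions, use assms in simp)+
  have inv: "dual_state n (dual_state n S) = S" if "S \<in> fermionic_states n l" for S l
    using that by (intro dual_state_involution) (simp add: fermionic_states_def)
  show "bij_betw (dual_state n) (fermionic_states n m) (fermionic_states n m')"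
    by (rule bij_betwI[where g = "dual_state n"])
      (use assms dual_state_mem[of _ n] inv in \<open>auto simp: add.commute\<close>)
  show "raises n (\<lambda>a. of_bool (a \<in> S)) (\<lambda>a. of_bool (a \<in> T)) \<longleftrightarrow>
      raises n (\<lambda>a. of_bool (a \<in> dual_state n S)) (\<lambda>a. of_bool (a \<in> dual_state n T))"
    if "S \<in> fermionic_states n m" "T \<in> fermionic_states n m" for S T
    using raises_dual_state[of n S T] raises_dual_state[of n "dual_state n S" "dual_state n T"] that
    by (auto simp: inv)
  show "varpi_A m h = occupation_weight (n + 1) (\<lambda>a. of_bool (a \<in> {..<m})) h"
    "varpi_A m' h = occupation_weight (n + 1) (\<lambda>a. of_bool (a \<in> {..<m'})) h" for h :: "'k mat"
    by (rule varpi_A_occupation, use assms in simp)+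
  show "(\<Sum>a<n + 1. of_bool (a \<in> S)) = l" if "S \<in> fermionic_states n l" for S l
    using that by (rule sum_fermionic_states)
  then show "(\<Sum>a<n + 1. of_bool (a \<in> S)) = m'" if "S \<in> fermionic_states n m'" for S
    using that .
qed

section \<open>Spin representations\<close>

subsection \<open>Clifford operators represent the orthogonal Lie algebra\<close>

text \<open>Operators that satisfy the Clifford relations of the antidiagonal form, scaled such that the
  anticommutator of two vectors is their product under the form.\<close>

locale clifford =
  fixes N :: nat and \<gamma> :: "nat \<Rightarrow> ('i \<Rightarrow> 'k::field_char_0) \<Rightarrow> 'i \<Rightarrow> 'k"
  assumes \<gamma>_add: "\<gamma> a (\<lambda>s. f s + g s) = (\<lambda>s. \<gamma> a f s + \<gamma> a g s)"
    and \<gamma>_smult: "\<gamma> a (\<lambda>s. e * f s) = (\<lambda>s. e * \<gamma> a f s)"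
    and anticommute: "a < N \<Longrightarrow> b < N \<Longrightarrow> \<gamma> a (\<gamma> b f) s + \<gamma> b (\<gamma> a f) s = of_bool (a + b = N - 1) * f s"
begin

definition E :: "nat \<Rightarrow> nat \<Rightarrow> ('i \<Rightarrow> 'k) \<Rightarrow> 'i \<Rightarrow> 'k" where
  "E a b f s = \<gamma> a (\<gamma> (N - 1 - b) f) s / 2"

lemma E_add: "E a b (\<lambda>s. f s + g s) s = E a b f s + E a b g s"
  by (simp add: E_def \<gamma>_add add_divide_distrib)

lemma E_smult: "E a b (\<lambda>s. e * f s) s = e * E a b f s"
  by (simp add: E_def \<gamma>_smult)

lemma E_eq: "E a b f = (\<lambda>s. (1 / 2) * \<gamma> a (\<gamma> (N - 1 - b) f) s)"
  by (simp add: E_def fun_eq_iff)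

lemma \<gamma>_zero: "\<gamma> a (\<lambda>s. 0) = (\<lambda>s. 0)"
  using \<gamma>_smult[of a 0 "\<lambda>s. 0"] by simp

lemma \<gamma>_sum: "\<gamma> a (\<lambda>s. \<Sum>j\<in>J. c j * f j s) s = (\<Sum>j\<in>J. c j * \<gamma> a (f j) s)"
  by (rule linear_op_sum) (simp_all add: \<gamma>_add \<gamma>_smult)

lemma \<gamma>_swap:
  assumes "a < N" "b < N"
  shows "\<gamma> a (\<gamma> b f) = (\<lambda>s. of_bool (a + b = N - 1) * f s + (- 1) * \<gamma> b (\<gamma> a f) s)"
  using anticommute[OF assms, of f] by (auto simp: fun_eq_iff algebra_simps)

lemma E_\<gamma>:
  assumes "a < N" "b < N" "c < N"
  shows "E a b (\<gamma> c f) s = \<gamma> c (E a b f) s + of_bool (b = c) * \<gamma> a f s / 2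
    - of_bool (a = N - 1 - c) * \<gamma> (N - 1 - b) f s / 2"
proof -
  let ?b = "N - 1 - b"
  have b: "?b < N" "?b + c = N - 1 \<longleftrightarrow> b = c" "a + c = N - 1 \<longleftrightarrow> a = N - 1 - c"
    using assms by auto
  have "\<gamma> a (\<gamma> ?b (\<gamma> c f)) s = of_bool (b = c) * \<gamma> a f s - \<gamma> a (\<gamma> c (\<gamma> ?b f)) s"
    unfolding \<gamma>_swap[OF b(1) assms(3), of f] b(2) \<gamma>_add \<gamma>_smult by simp
  also have "\<gamma> a (\<gamma> c (\<gamma> ?b f)) s = of_bool (a = N - 1 - c) * \<gamma> ?b f s - \<gamma> c (\<gamma> a (\<gamma> ?b f)) s"
    unfolding \<gamma>_swap[OF assms(1,3)] b(3) by simp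
  moreover have "\<gamma> c (E a b f) s = \<gamma> c (\<gamma> a (\<gamma> ?b f)) s / 2"
    unfolding E_eq \<gamma>_smult by simp
  ultimately show ?thesis
    by (simp add: E_def diff_divide_distrib)
qed

lemma gl_op_smult: "gl_op N E x (\<lambda>s. e * f s) s = e * gl_op N E x f s"
  by (simp add: gl_op_def E_smult sum_distrib_left mult.left_commute)

text \<open>The commutator with the operators \<open>\<gamma>\<close> is the natural representation on vectors. The two terms of
  the commutator formula agree because \<open>x\<close> is skew under reflection in the antidiagonal.\<close>

lemma gl_op_\<gamma>:
  assumes x: "x \<in> so N" and c: "c < N"
  shows "gl_op N E x (\<gamma> c f) s = \<gamma> c (gl_op N E x f) s + (\<Sum>a<N. x $$ (a, c) * \<gamma> a f s)"
proof -
  have lin: "\<gamma> c (gl_op N E x f) s = (\<Sum>a<N. \<Sum>b<N. x $$ (a, b) * \<gamma> c (E a b f) s)"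
    unfolding gl_op_def
    using \<gamma>_sum[of c "\<lambda>_. 1" "\<lambda>a s. \<Sum>b<N. x $$ (a, b) * E a b f s" "{..<N}" s] by (simp add: \<gamma>_sum)
  have "gl_op N E x (\<gamma> c f) s = (\<Sum>a<N. \<Sum>b<N. x $$ (a, b) * \<gamma> c (E a b f) s
      + (if b = c then x $$ (a, b) * \<gamma> a f s / 2 else 0)
      - (if a = N - 1 - c then x $$ (a, b) * \<gamma> (N - 1 - b) f s / 2 else 0))"
    unfolding gl_op_def by (intro sum.cong refl) (use c in \<open>auto simp: E_\<gamma> algebra_simps\<close>)
  also have "\<dots> = \<gamma> c (gl_op N E x f) s + (\<Sum>a<N. \<Sum>b<N. if b = c then x $$ (a, b) * \<gamma> a f s / 2 else 0)
      - (\<Sum>b<N. \<Sum>a<N. if a = N - 1 - c then x $$ (a, b) * \<gamma> (N - 1 - b) f s / 2 else 0)"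
    unfolding lin by (subst (4) sum.swap) (simp only: sum.distrib sum_subtractf)
  also have "\<dots> = \<gamma> c (gl_op N E x f) s + (\<Sum>a<N. x $$ (a, c) * \<gamma> a f s / 2)
      - (\<Sum>b<N. x $$ (N - 1 - c, b) * \<gamma> (N - 1 - b) f s / 2)"
    using c by simp
  also have "(\<Sum>b<N. x $$ (N - 1 - c, b) * \<gamma> (N - 1 - b) f s / 2) = (\<Sum>a<N. - (x $$ (a, c) * \<gamma> a f s / 2))"
  proof (rule sum.reindex_bij_witness[of _ "\<lambda>a. N - 1 - a" "\<lambda>a. N - 1 - a"])
    fix b assume b: "b \<in> {..<N}"
    have "x $$ (N - 1 - c, b) = - x $$ (N - 1 - b, N - 1 - (N - 1 - c))"
    proof -
      have "N - 1 - c < N" "b < N"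
        using b c by auto
      then show ?thesis
        using x unfolding so_iff by blast
    qed
    then show "- (x $$ (N - 1 - b, c) * \<gamma> (N - 1 - b) f s / 2) = x $$ (N - 1 - c, b) * \<gamma> (N - 1 - b) f s / 2"
      using c by simp
  qed auto
  finally show ?thesis
    by (simp add: sum_negf flip: sum_divide_distrib)
qed

lemma E_comm:
  assumes x: "x \<in> so N" and c: "c < N" and d: "d < N"
  shows "gl_op N E x (E c d f) s =
    E c d (gl_op N E x f) s + (\<Sum>a<N. x $$ (a, c) * E a d f s) - (\<Sum>b<N. x $$ (d, b) * E c b f s)"
proof -
  let ?d = "N - 1 - d"
  have d': "?d < N"
    using d by simp
  have "gl_op N E x (E c d f) s = gl_op N E x (\<gamma> c (\<gamma> ?d f)) s / 2"
    unfolding E_eq[of c d f] gl_op_smult by simp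
  also have "gl_op N E x (\<gamma> c (\<gamma> ?d f)) s =
      \<gamma> c (gl_op N E x (\<gamma> ?d f)) s + (\<Sum>a<N. x $$ (a, c) * \<gamma> a (\<gamma> ?d f) s)"
    by (rule gl_op_\<gamma>[OF x c])
  also have "gl_op N E x (\<gamma> ?d f) = (\<lambda>s. \<gamma> ?d (gl_op N E x f) s + (\<Sum>a<N. x $$ (a, ?d) * \<gamma> a f s))"
    using gl_op_\<gamma>[OF x d'] by (simp add: fun_eq_iff)
  also have "\<gamma> c (\<lambda>s. \<gamma> ?d (gl_op N E x f) s + (\<Sum>a<N. x $$ (a, ?d) * \<gamma> a f s)) s =
      \<gamma> c (\<gamma> ?d (gl_op N E x f)) s + (\<Sum>a<N. x $$ (a, ?d) * \<gamma> c (\<gamma> a f) s)"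
    unfolding \<gamma>_add by (simp add: \<gamma>_sum)
  also have "(\<Sum>a<N. x $$ (a, ?d) * \<gamma> c (\<gamma> a f) s) = (\<Sum>b<N. - (x $$ (d, b) * \<gamma> c (\<gamma> (N - 1 - b) f) s))"
  proof (rule sum.reindex_bij_witness[of _ "\<lambda>a. N - 1 - a" "\<lambda>a. N - 1 - a"])
    fix a assume a: "a \<in> {..<N}"
    then have "x $$ (a, ?d) = - x $$ (N - 1 - ?d, N - 1 - a)"
      using x d' unfolding so_iff by blast
    then show "- (x $$ (d, N - 1 - a) * \<gamma> c (\<gamma> (N - 1 - (N - 1 - a)) f) s) = x $$ (a, ?d) * \<gamma> c (\<gamma> a f) s"
      using a d by simp
  qed auto
  finally have total: "gl_op N E x (E c d f) s = (\<gamma> c (\<gamma> ?d (gl_op N E x f)) s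
      + (\<Sum>b<N. - (x $$ (d, b) * \<gamma> c (\<gamma> (N - 1 - b) f) s)) + (\<Sum>a<N. x $$ (a, c) * \<gamma> a (\<gamma> ?d f) s)) / 2" .
  have "E c d (gl_op N E x f) s = \<gamma> c (\<gamma> ?d (gl_op N E x f)) s / 2"
    by (rule E_def)
  moreover have "(\<Sum>a<N. x $$ (a, c) * E a d f s) = (\<Sum>a<N. x $$ (a, c) * \<gamma> a (\<gamma> ?d f) s) / 2"
    "(\<Sum>b<N. x $$ (d, b) * E c b f s) = (\<Sum>b<N. x $$ (d, b) * \<gamma> c (\<gamma> (N - 1 - b) f) s) / 2"
    by (simp_all add: E_def sum_divide_distrib)
  ultimately show ?thesis
    unfolding total by (simp only: sum_negf add_divide_distrib) simp
qed

text \<open>A product of two operators \<open>\<gamma>\<close> that anticommute comes from the root vector that is a skew difference of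
  two matrix units.\<close>

lemma pair_operator:
  assumes "a < N" "b < N" "a \<noteq> b" "a + b \<noteq> N - 1"
  shows "\<exists>x\<in>so N. \<forall>f s. gl_op N E x f s = \<gamma> a (\<gamma> b f) s"
proof -
  define x :: "'k mat" where "x = matrix_unit N a (N - 1 - b) - matrix_unit N b (N - 1 - a)"
  have ent: "x $$ (i, j) = of_bool (i = a \<and> j = N - 1 - b) - of_bool (i = b \<and> j = N - 1 - a)"
    if "i < N" "j < N" for i j
    using that by (simp add: x_def matrix_unit_def)
  have "x \<in> so N"
    unfolding so_iff
  proof (intro conjI allI impI)
    fix i j assume ij: "i < N" "j < N"
    have "N - 1 - j = a \<longleftrightarrow> j = N - 1 - a" "N - 1 - i = N - 1 - b \<longleftrightarrow> i = b"
      "N - 1 - j = b \<longleftrightarrow> j = N - 1 - b" "N - 1 - i = N - 1 - a \<longleftrightarrow> i = a"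
      using ij assms(1,2) by linarith+
    then show "x $$ (i, j) = - x $$ (N - 1 - j, N - 1 - i)"
      using ij by (simp add: ent conj_commute)
  qed (auto simp: x_def matrix_unit_def intro!: minus_carrier_mat)
  moreover have "gl_op N E x f s = \<gamma> a (\<gamma> b f) s" for f s
  proof -
    have "gl_op N E x f s = (\<Sum>i<N. \<Sum>j<N. matrix_unit N a (N - 1 - b) $$ (i, j) * E i j f s
        - matrix_unit N b (N - 1 - a) $$ (i, j) * E i j f s)"
      unfolding gl_op_def by (intro sum.cong refl) (simp add: ent matrix_unit_def left_diff_distrib)
    also have "\<dots> = gl_op N E (matrix_unit N a (N - 1 - b)) f s - gl_op N E (matrix_unit N b (N - 1 - a)) f s"
      unfolding gl_op_def by (simp only: sum_subtractf)
    also have "\<dots> = E a (N - 1 - b) f s - E b (N - 1 - a) f s"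
      using assms(1,2) by (simp add: gl_op_matrix_unit)
    also have "\<dots> = \<gamma> a (\<gamma> b f) s"
      using assms anticommute[of a b f s] by (simp add: E_def field_simps eq_neg_iff_add_eq_0)
    finally show ?thesis .
  qed
  ultimately show ?thesis
    by blast
qed

end

subsection \<open>The spinor operators\<close>

text \<open>Creation operators in the first half, the dual annihilation operators in the second half. In odd
  dimension the middle vector must square to one half; adding half of the creation operator achieves this without
  a square root of two, at the price of one more place, and puts types \<open>B\<close> and \<open>D\<close> on the same space.\<close>

definition spin_gamma :: "nat \<Rightarrow> nat \<Rightarrow> (nat set \<Rightarrow> 'k::field_char_0) \<Rightarrow> nat set \<Rightarrow> 'k" where
  "spin_gamma N a f S =
    (if 2 * a + 1 < N then fermion_create a f S
     else if 2 * a + 1 = N then fermion_annihilate a f S + fermion_create a f S / 2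
     else fermion_annihilate (N - 1 - a) f S)"

lemma fermion_anticommute:
  "fermion_create a (fermion_create b f) S + fermion_create b (fermion_create a f) S = (0 :: 'k::field)"
  "fermion_annihilate a (fermion_annihilate b f) S + fermion_annihilate b (fermion_annihilate a f) S = (0 :: 'k)"
  "fermion_annihilate a (fermion_create b f) S + fermion_create b (fermion_annihilate a f) S = (of_bool (a = b) * f S :: 'k)"
  by (subst fermion.pp[of a b], simp, subst fermion.qq[of a b], simp, subst fermion.qp[of a b], simp)

lemma clifford_spin_gamma: "clifford N (spin_gamma N :: nat \<Rightarrow> (nat set \<Rightarrow> 'k::field_char_0) \<Rightarrow> nat set \<Rightarrow> 'k)"
proof
  fix a b and f :: "nat set \<Rightarrow> 'k" and S
  assume ab: "a < N" "b < N"
  note linear = fermion.p_add fermion.q_add fermion.p_smult fermion.q_smult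
  have half: "fermion_create c (\<lambda>S. f S / 2) = (\<lambda>S. fermion_create c f S / 2)"
    "fermion_annihilate c (\<lambda>S. f S / 2) = (\<lambda>S. fermion_annihilate c f S / 2)" for c and f :: "nat set \<Rightarrow> 'k"
    using fermion.p_smult[of c "1 / 2" f] fermion.q_smult[of c "1 / 2" f] by simp_all
  have low: "spin_gamma N c = fermion_create c" if "2 * c + 1 < N" for c
    using that by (simp add: spin_gamma_def fun_eq_iff)
  have high: "spin_gamma N c = fermion_annihilate (N - 1 - c)" if "2 * c + 1 > N" for c
    using that by (simp add: spin_gamma_def fun_eq_iff)
  have mid: "spin_gamma N c = (\<lambda>f S. fermion_annihilate c f S + fermion_create c f S / 2)" if "2 * c + 1 = N" for c
    using that by (simp add: spin_gamma_def fun_eq_iff)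
  have pp: "fermion_create a (fermion_create b f) S = - fermion_create b (fermion_create a f) S" for a b
    using fermion_anticommute(1)[of a b f S] by (simp add: eq_neg_iff_add_eq_0)
  have qq: "fermion_annihilate a (fermion_annihilate b f) S = - fermion_annihilate b (fermion_annihilate a f) S" for a b
    using fermion_anticommute(2)[of a b f S] by (simp add: eq_neg_iff_add_eq_0)
  have qp: "fermion_annihilate a (fermion_create b f) S = of_bool (a = b) * f S - fermion_create b (fermion_annihilate a f) S" for a b
    using fermion_anticommute(3)[of a b f S] by (simp add: algebra_simps)
  have pp0: "fermion_create a (fermion_create a f) S = 0" "fermion_annihilate a (fermion_annihilate a f) S = 0" for a
    using fermion_anticommute(1,2)[of a a f S] by (simp_all flip: mult_2)
  consider "2 * a + 1 < N" "2 * b + 1 < N" | "2 * a + 1 < N" "2 * b + 1 = N" | "2 * a + 1 < N" "2 * b + 1 > N"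
    | "2 * a + 1 = N" "2 * b + 1 < N" | "2 * a + 1 = N" "2 * b + 1 = N" | "2 * a + 1 = N" "2 * b + 1 > N"
    | "2 * a + 1 > N" "2 * b + 1 < N" | "2 * a + 1 > N" "2 * b + 1 = N" | "2 * a + 1 > N" "2 * b + 1 > N"
    using linorder_less_linear[of "2 * a + 1" N] linorder_less_linear[of "2 * b + 1" N] by blast
  then show "spin_gamma N a (spin_gamma N b f) S + spin_gamma N b (spin_gamma N a f) S = of_bool (a + b = N - 1) * f S"
  proof cases
    case 1
    then show ?thesis
      by (simp add: low pp[of a b])
  next
    case 2
    then have "a \<noteq> b" "a + b \<noteq> N - 1"
      by auto
    then show ?thesis
      using 2 by (simp add: low mid linear half pp[of a b] qp)
  next
    case 3
    then have "a + b = N - 1 \<longleftrightarrow> N - 1 - b = a"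
      using ab by auto
    then show ?thesis
      using 3 by (simp add: low high qp)
  next
    case 4
    then have "a \<noteq> b" "a + b \<noteq> N - 1"
      by auto
    then show ?thesis
      using 4 by (simp add: low mid linear half pp[of a b] qp)
  next
    case 5
    then have b: "b = a" and N: "a + a = N - 1"
      by auto
    show ?thesis
      unfolding b using 5(1) N by (simp add: mid linear half pp0 qp field_simps)
  next
    case 6
    then have "a \<noteq> N - 1 - b" "a + b \<noteq> N - 1"
      using ab by auto
    then show ?thesis
      using 6 by (simp add: high mid linear half qq[of a] qp)
  next
    case 7
    then have "a + b = N - 1 \<longleftrightarrow> N - 1 - a = b"
      using ab by auto
    then show ?thesis
      using 7 by (simp add: low high qp)
  next
    case 8
    then have "b \<noteq> N - 1 - a" "a + b \<noteq> N - 1"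
      using ab by auto
    then show ?thesis
      using 8 by (simp add: high mid linear half qq[of b] qp)
  next
    case 9
    then have "a + b \<noteq> N - 1"
      using ab by linarith
    then show ?thesis
      using 9 fermion_anticommute(2)[of "N - 1 - a" "N - 1 - b" f S] by (simp add: high)
  qed
qed (auto simp: spin_gamma_def fun_eq_iff fermion.p_add fermion.q_add fermion.p_smult fermion.q_smult
    add_divide_distrib algebra_simps)

text \<open>Each Clifford operator changes the parity, so the quadratic operators preserve it. For \<open>e = M\<close> the full
  subset is among the states.\<close>

definition parity_states :: "nat \<Rightarrow> nat \<Rightarrow> nat set set" where
  "parity_states M e = {S. S \<subseteq> {..<M} \<and> even (card S + e)}"

lemma parity_states_insert:
  assumes "a < M" "a \<notin> S"
  shows "insert a S \<in> parity_states M e \<longleftrightarrow> S \<in> parity_states M (Suc e)"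
proof (cases "S \<subseteq> {..<M}")
  case True
  then have "finite S"
    using finite_subset by blast
  then show ?thesis
    using True assms by (auto simp: parity_states_def)
next
  case False
  then show ?thesis
    using assms by (auto simp: parity_states_def)
qed

lemma fermion_parity:
  assumes f: "\<And>S. S \<notin> parity_states M e \<Longrightarrow> f S = (0 :: 'k::field)" and a: "a < M"
    and S: "S \<notin> parity_states M (Suc e)"
  shows "fermion_create a f S = 0" "fermion_annihilate a f S = 0"
proof -
  have "f (S - {a}) = 0" if "a \<in> S"
  proof (rule f)
    have "insert a (S - {a}) = S"
      using that by auto
    then have "S - {a} \<notin> parity_states M (Suc (Suc e))"
      using S parity_states_insert[OF a, of "S - {a}" "Suc e"] by auto
    then show "S - {a} \<notin> parity_states M e"
      by (simp add: parity_states_def)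
  qed
  then show "fermion_create a f S = 0"
    by (simp add: fermion_create_def)
  have "f (insert a S) = 0" if "a \<notin> S"
    using that S parity_states_insert[OF a that, of e] by (intro f) simp
  then show "fermion_annihilate a f S = 0"
    by (simp add: fermion_annihilate_def)
qed

lemma spin_gamma_parity:
  assumes "\<And>S. S \<notin> parity_states ((N + 1) div 2) e \<Longrightarrow> f S = (0 :: 'k::field_char_0)" "a < N"
    and "S \<notin> parity_states ((N + 1) div 2) (Suc e)"
  shows "spin_gamma N a f S = 0"
proof -
  have idx: "a < (N + 1) div 2" if "2 * a + 1 \<le> N"
    using that by linarith
  have idx': "N - 1 - a < (N + 1) div 2" if "2 * a + 1 > N"
    using that assms(2) by linarith
  show ?thesis
    using fermion_parity[OF assms(1) _ assms(3)] idx idx' unfolding spin_gamma_def by auto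
qed

text \<open>In odd dimension \<open>r\<close> does not count the middle place, on which the Cartan subalgebra acts by zero.\<close>

definition spin_weight :: "nat \<Rightarrow> nat set \<Rightarrow> 'k::field weight" where
  "spin_weight r S h = (\<Sum>a<r. (of_bool (a \<in> S) - 1 / 2) * h $$ (a, a))"

lemma sum_fold:
  fixes F :: "nat \<Rightarrow> 'k::field"
  assumes "\<And>a. 2 * a + 1 = N \<Longrightarrow> F a = 0"
  shows "(\<Sum>a<N. F a) = (\<Sum>a<N div 2. F a + F (N - 1 - a))"
proof -
  have "(\<Sum>a<N. F a) = (\<Sum>a\<in>{..<N div 2} \<union> {N - N div 2..<N}. F a)"
  proof (rule sum.mono_neutral_right)
    show "\<forall>i\<in>{..<N} - ({..<N div 2} \<union> {N - N div 2..<N}). F i = 0"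
    proof
      fix i assume "i \<in> {..<N} - ({..<N div 2} \<union> {N - N div 2..<N})"
      then have "2 * i + 1 = N"
        by auto
      then show "F i = 0"
        by (rule assms)
    qed
  qed auto
  also have "\<dots> = (\<Sum>a<N div 2. F a) + (\<Sum>a\<in>{N - N div 2..<N}. F a)"
    by (rule sum.union_disjoint) auto
  also have "(\<Sum>a\<in>{N - N div 2..<N}. F a) = (\<Sum>a<N div 2. F (N - 1 - a))"
    by (rule sum.reindex_bij_witness[of _ "\<lambda>a. N - 1 - a" "\<lambda>a. N - 1 - a"]) auto
  finally show ?thesis
    by (simp add: sum.distrib)
qed

lemma so_cartan_pairing:
  fixes c :: "nat \<Rightarrow> 'k::field_char_0"
  assumes a: "a < N div 2"
    and zero: "\<And>h. h \<in> so N \<Longrightarrow> diagonal_mat h \<Longrightarrow> (\<Sum>i<N div 2. c i * h $$ (i, i)) = 0"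
  shows "c a = 0"
proof -
  define h :: "'k mat" where "h = mat_diag N (\<lambda>i. of_bool (i = a) - of_bool (i = N - 1 - a))"
  have "h \<in> so N"
    unfolding so_iff
  proof (intro conjI allI impI)
    fix i j assume ij: "i < N" "j < N"
    have "N - 1 - j = N - 1 - i \<longleftrightarrow> i = j" "N - 1 - j = a \<longleftrightarrow> j = N - 1 - a" "N - 1 - j = N - 1 - a \<longleftrightarrow> j = a"
      using ij a by linarith+
    then show "h $$ (i, j) = - h $$ (N - 1 - j, N - 1 - i)"
      using ij by (auto simp: h_def mat_diag_def)
  qed (simp add: h_def mat_diag_def)
  moreover have "diagonal_mat h"
    by (simp add: h_def diagonal_mat_def mat_diag_def)
  ultimately have "(\<Sum>i<N div 2. c i * h $$ (i, i)) = 0"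
    by (rule zero)
  moreover have "(\<Sum>i<N div 2. c i * h $$ (i, i)) = (\<Sum>i<N div 2. if i = a then c i else 0)"
    by (intro sum.cong refl) (use a in \<open>auto simp: h_def mat_diag_def\<close>)
  ultimately show ?thesis
    using a by simp
qed

lemma spin_weight_diff_iff:
  fixes L :: "'k::field_char_0 lie_datum"
  assumes cartan: "cartan L = {h \<in> so N. diagonal_mat h}"
  shows "(\<forall>h\<in>cartan L. spin_weight (N div 2) T h - spin_weight (N div 2) S h =
      (\<Sum>a<N div 2. of_int (c a) * h $$ (a, a))) \<longleftrightarrow>
    (\<forall>a<N div 2. of_bool (a \<in> T) - of_bool (a \<in> S) = c a)"
proof -
  define e :: "nat \<Rightarrow> int" where "e a = of_bool (a \<in> T) - of_bool (a \<in> S) - c a" for a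
  have diff: "spin_weight (N div 2) T h - spin_weight (N div 2) S h - (\<Sum>a<N div 2. of_int (c a) * h $$ (a, a)) =
      (\<Sum>a<N div 2. of_int (e a) * h $$ (a, a))" for h :: "'k mat"
    unfolding spin_weight_def e_def by (simp add: algebra_simps sum_subtractf sum.distrib)
  show ?thesis
  proof
    assume *: "\<forall>h\<in>cartan L. spin_weight (N div 2) T h - spin_weight (N div 2) S h =
      (\<Sum>a<N div 2. of_int (c a) * h $$ (a, a))"
    have "(of_int (e a) :: 'k) = 0" if "a < N div 2" for a
      using that
    proof (rule so_cartan_pairing)
      fix h :: "'k mat" assume "h \<in> so N" "diagonal_mat h"
      then have "spin_weight (N div 2) T h - spin_weight (N div 2) S h =
          (\<Sum>a<N div 2. of_int (c a) * h $$ (a, a))"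
        using * cartan by blast
      then show "(\<Sum>a<N div 2. of_int (e a) * h $$ (a, a)) = 0"
        using diff[of h] by simp
    qed
    then have zero: "e a = 0" if "a < N div 2" for a
      using that by (simp only: of_int_eq_0_iff)
    show "\<forall>a<N div 2. of_bool (a \<in> T) - of_bool (a \<in> S) = c a"
    proof (intro allI impI)
      fix a assume "a < N div 2"
      then show "of_bool (a \<in> T) - of_bool (a \<in> S) = c a"
        using zero[of a] unfolding e_def by linarith
    qed
  next
    assume "\<forall>a<N div 2. of_bool (a \<in> T) - of_bool (a \<in> S) = c a"
    then have zero: "(\<Sum>a<N div 2. of_int (e a) * h $$ (a, a)) = 0" for h :: "'k mat"
      by (intro sum.neutral) (simp add: e_def)
    show "\<forall>h\<in>cartan L. spin_weight (N div 2) T h - spin_weight (N div 2) S h =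
      (\<Sum>a<N div 2. of_int (c a) * h $$ (a, a))"
    proof
      fix h :: "'k mat"
      show "spin_weight (N div 2) T h - spin_weight (N div 2) S h = (\<Sum>a<N div 2. of_int (c a) * h $$ (a, a))"
        using diff[of h] zero[of h] by simp
    qed
  qed
qed

text \<open>Membership of the middle place, invisible to the weight in odd dimension, is determined by the parity.\<close>

lemma parity_state_determined:
  assumes S: "S \<in> parity_states ((N + 1) div 2) e" and T: "T \<in> parity_states ((N + 1) div 2) e"
    and ne: "S \<noteq> T"
  shows "\<exists>a<N div 2. a \<in> S \<longleftrightarrow> a \<notin> T"
proof (rule ccontr)
  assume "\<not> ?thesis"
  then have same: "a \<in> S \<longleftrightarrow> a \<in> T" if "a < N div 2" for a
    using that by blast
  let ?c = "N div 2"
  have M: "(N + 1) div 2 \<le> Suc ?c"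
    by linarith
  have split: "a < (N + 1) div 2 \<Longrightarrow> a < ?c \<or> a = ?c" for a
    by linarith
  have sub: "S \<subseteq> {..<(N + 1) div 2}" "T \<subseteq> {..<(N + 1) div 2}" "finite S" "finite T"
    using S T finite_subset by (auto simp: parity_states_def)
  have rest: "S - {?c} = T - {?c}"
    using same split sub by blast
  then have "(?c \<in> S) \<noteq> (?c \<in> T)"
    using ne by blast
  moreover have False if "P \<in> parity_states ((N + 1) div 2) e" "Q \<in> parity_states ((N + 1) div 2) e"
    "P - {?c} = Q - {?c}" "?c \<in> P" "?c \<notin> Q" for P Q
  proof -
    have "finite P"
      using that(1) finite_subset by (auto simp: parity_states_def)
    moreover have "Q = P - {?c}"
      using that by auto
    ultimately have "card P = Suc (card Q)"
      using card.remove[of P ?c] that(4) by simp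
    then show False
      using that(1,2) by (auto simp: parity_states_def)
  qed
  ultimately show False
    using S T rest by metis
qed

lemma spin_gamma_create:
  assumes "2 * c + 1 \<le> N" "c \<in> T"
  shows "spin_gamma N c f T = 0 \<longleftrightarrow> f (T - {c}) = (0 :: 'k::field_char_0)"
  using assms by (auto simp: spin_gamma_def fermion_create_def fermion_annihilate_def)

lemma spin_gamma_annihilate:
  assumes "2 * c + 1 \<le> N" "c \<notin> S"
  shows "spin_gamma N (N - 1 - c) f S = 0 \<longleftrightarrow> f (insert c S) = (0 :: 'k::field_char_0)"
proof -
  have "2 * (N - 1 - c) + 1 = N \<longleftrightarrow> 2 * c + 1 = N" "\<not> 2 * (N - 1 - c) + 1 < N"
    "N - 1 - (N - 1 - c) = c" "2 * c + 1 = N \<Longrightarrow> N - 1 - c = c"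
    using assms(1) by linarith+
  then show ?thesis
    using assms(2) by (auto simp: spin_gamma_def fermion_create_def fermion_annihilate_def)
qed

text \<open>Both spinor modules at once, for odd and for even \<open>N\<close>. The parity ensures that a state other than the
  full subset misses at least two places; a pair of creation operators fills them and a pair of
  annihilation operators empties them again.\<close>

proposition quadratic_model_spin:
  fixes L :: "'k::field_char_0 lie_datum"
  assumes tri: "triangular_datum L N" and L: "lie_algebra L = so N"
    and cartan: "cartan L = {h \<in> so N. diagonal_mat h}"
  defines "M \<equiv> (N + 1) div 2"
  shows "quadratic_model L N (parity_states M M) (clifford.E N (spin_gamma N))
    (spin_weight (N div 2)) {..<M} (\<lambda>S. M - card S)"
proof -
  interpret triangular_datum L N
    by (rule tri)
  interpret clifford N "spin_gamma N :: nat \<Rightarrow> (nat set \<Rightarrow> 'k) \<Rightarrow> nat set \<Rightarrow> 'k"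
    by (rule clifford_spin_gamma)
  let ?I = "parity_states M M"
  have top_zero: "spin_gamma N a (delta {..<M}) = (\<lambda>s. 0 :: 'k)" if "2 * a + 1 < N" for a
  proof
    fix S
    have "a \<in> {..<M}"
      using that by (simp add: M_def)
    then have "S - {a} \<noteq> {..<M}"
      by auto
    then show "spin_gamma N a (delta {..<M}) S = (0 :: 'k)"
      using that by (simp add: spin_gamma_def fermion_create_def delta_def)
  qed
  show ?thesis
  proof
    show "finite ?I"
      by (rule finite_subset[of _ "Pow {..<M}"]) (auto simp: parity_states_def)
    show "{..<M} \<in> ?I"
      by (simp add: parity_states_def)
    show "E a b f S = 0" if "a < N" "b < N" "\<And>S. S \<notin> ?I \<Longrightarrow> f S = 0" "S \<notin> ?I" for a b f S
    proof -
      have "spin_gamma N (N - 1 - b) f T = 0" if "T \<notin> parity_states M (Suc M)" for T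
        using spin_gamma_parity[of N M f "N - 1 - b" T] that \<open>b < N\<close> \<open>\<And>S. S \<notin> ?I \<Longrightarrow> f S = 0\<close>
        by (simp add: M_def)
      moreover have "S \<notin> parity_states M (Suc (Suc M))"
        using \<open>S \<notin> ?I\<close> by (simp add: parity_states_def)
      ultimately have "spin_gamma N a (spin_gamma N (N - 1 - b) f) S = 0"
        using spin_gamma_parity[of N "Suc M" "spin_gamma N (N - 1 - b) f" a S] \<open>a < N\<close>
        by (simp add: M_def)
      then show ?thesis
        by (simp add: E_def)
    qed
    show "(\<Sum>a<N. h $$ (a, a) * E a a f S) = spin_weight (N div 2) S h * f S" if h: "h \<in> cartan L" for h S f
    proof -
      have reflect: "h $$ (N - 1 - a, N - 1 - a) = - h $$ (a, a)" if "a < N" for a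
        using cartan_so_reflect[of h N a] h cartan that by simp
      have "(\<Sum>a<N. h $$ (a, a) * E a a f S) =
          (\<Sum>a<N div 2. h $$ (a, a) * E a a f S + h $$ (N - 1 - a, N - 1 - a) * E (N - 1 - a) (N - 1 - a) f S)"
      proof (rule sum_fold)
        fix a assume a: "2 * a + 1 = N"
        then have "N - 1 - a = a"
          by linarith
        then have "h $$ (a, a) + h $$ (a, a) = 0"
          using reflect[of a] a by (simp add: eq_neg_iff_add_eq_0)
        then show "h $$ (a, a) * E a a f S = 0"
          by (simp flip: mult_2)
      qed
      also have "\<dots> = (\<Sum>a<N div 2. (of_bool (a \<in> S) - 1 / 2) * h $$ (a, a) * f S)"
      proof (intro sum.cong refl)
        fix a assume "a \<in> {..<N div 2}"
        then have a: "2 * a + 1 < N" "a < N" "\<not> 2 * (N - 1 - a) + 1 < N" "2 * (N - 1 - a) + 1 \<noteq> N" "N - 1 - (N - 1 - a) = a"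
          by auto
        then have "spin_gamma N a = (fermion_create a :: (nat set \<Rightarrow> 'k) \<Rightarrow> nat set \<Rightarrow> 'k)"
          "spin_gamma N (N - 1 - a) = (fermion_annihilate a :: (nat set \<Rightarrow> 'k) \<Rightarrow> nat set \<Rightarrow> 'k)"
          by (simp_all add: spin_gamma_def fun_eq_iff)
        then have ops: "E a a f S = of_bool (a \<in> S) * f S / 2"
          "E (N - 1 - a) (N - 1 - a) f S = (f S - of_bool (a \<in> S) * f S) / 2"
          using fermion_anticommute(3)[of a a f S] a(5)
          by (simp_all add: E_def fermion_number algebra_simps)
        show "h $$ (a, a) * E a a f S + h $$ (N - 1 - a, N - 1 - a) * E (N - 1 - a) (N - 1 - a) f S =
            (of_bool (a \<in> S) - 1 / 2) * h $$ (a, a) * f S"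
          unfolding ops reflect[OF a(2)] by (simp add: field_simps)
      qed
      finally show ?thesis
        by (simp add: spin_weight_def sum_distrib_right)
    qed
    show "E a b (delta {..<M}) S = 0" if ab: "a < b" "b < N" for a b S
    proof (cases "2 * a + 1 < N")
      case True
      have "spin_gamma N a (spin_gamma N (N - 1 - b) (delta {..<M})) S = (0 :: 'k)"
        using \<gamma>_swap[of a "N - 1 - b" "delta {..<M}"] ab top_zero[OF True] by (simp add: \<gamma>_zero)
      then show ?thesis
        by (simp add: E_def)
    next
      case False
      then have "2 * (N - 1 - b) + 1 < N"
        using ab by linarith
      then show ?thesis
        by (simp add: E_def top_zero \<gamma>_zero)
    qed
    show "\<exists>h\<in>cartan L. spin_weight (N div 2) S h \<noteq> spin_weight (N div 2) T h"
      if ST: "S \<in> ?I" "T \<in> ?I" "S \<noteq> T" for S T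
    proof (rule ccontr)
      assume "\<not> ?thesis"
      then have "\<forall>h\<in>cartan L. spin_weight (N div 2) T h - spin_weight (N div 2) S h =
          (\<Sum>a<N div 2. of_int 0 * h $$ (a, a))"
        by simp
      then have "\<forall>a<N div 2. of_bool (a \<in> T) - of_bool (a \<in> S) = (0 :: int)"
        using spin_weight_diff_iff[OF cartan, of T S "\<lambda>_. 0"] by simp
      moreover obtain a where "a < N div 2" "a \<in> S \<longleftrightarrow> a \<notin> T"
        using parity_state_determined[of S N M T] ST unfolding M_def by blast
      ultimately show False
        by (cases "a \<in> S") auto
    qed
    fix S assume S: "S \<in> ?I" "S \<noteq> {..<M}"
    have sub: "S \<subset> {..<M}" and fin: "finite S"
      using S finite_subset by (auto simp: parity_states_def)
    then obtain a where a: "a < M" "a \<notin> S"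
      by blast
    \<comment> \<open>By parity, one missing place entails a second one.\<close>
    have "insert a S \<noteq> {..<M}"
    proof
      assume *: "insert a S = {..<M}"
      then have "insert a S \<in> ?I"
        by (simp add: parity_states_def)
      then show False
        using S(1) fin a(2) by (simp add: parity_states_def)
    qed
    then obtain b where b: "b < M" "b \<notin> S" "b \<noteq> a"
      using sub a by blast
    define T where "T = insert a (insert b S)"
    have card: "card T = Suc (Suc (card S))"
      using a b fin by (simp add: T_def)
    have T: "T \<in> ?I"
      using S(1) card a b by (auto simp: parity_states_def T_def)
    have "card T \<le> M"
      using card_mono[of "{..<M}" T] T by (simp add: parity_states_def)
    then have depth: "M - card T < M - card S"
      using card by simp
    have idx: "2 * a + 1 \<le> N" "2 * b + 1 \<le> N"
      using a b by (auto simp: M_def)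
    have "a + b \<noteq> N - 1" "N - 1 - a + (N - 1 - b) \<noteq> N - 1" "N - 1 - a \<noteq> N - 1 - b"
      using idx b(3) by linarith+
    then obtain x y where x: "x \<in> so N" "\<And>f s. gl_op N E x f s = spin_gamma N a (spin_gamma N b f) s"
      and y: "y \<in> so N" "\<And>f s. gl_op N E y f s = spin_gamma N (N - 1 - b) (spin_gamma N (N - 1 - a) f) s"
      using pair_operator[of a b] pair_operator[of "N - 1 - b" "N - 1 - a"] idx b(3)
      by (auto simp: add.commute)
    have "gl_op N E x (delta S) T \<noteq> 0"
    proof -
      have "T - {a} - {b} = S" "b \<in> T - {a}" "a \<in> T"
        using a b by (auto simp: T_def)
      then show ?thesis
        using idx by (simp add: x(2) spin_gamma_create delta_def)
    qed
    moreover have "gl_op N E y (delta T) S \<noteq> 0"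
    proof -
      have "a \<notin> insert b S"
        using a b by simp
      then show ?thesis
        unfolding y(2) spin_gamma_annihilate[OF idx(2) b(2)]
        by (subst spin_gamma_annihilate[OF idx(1)]) (simp_all add: delta_def T_def)
    qed
    ultimately show "\<exists>T\<in>?I. M - card T < M - card S \<and>
        (\<exists>x\<in>lie_algebra L. gl_op N E x (delta S) T \<noteq> 0) \<and> (\<exists>x\<in>lie_algebra L. gl_op N E x (delta T) S \<noteq> 0)"
      unfolding L using T depth x(1) y(1) by blast
  qed (use E_add E_smult E_comm L in auto)
qed

subsection \<open>Comparison of the two spin posets\<close>

lemma varpi_spin_weight:
  assumes "r \<le> M"
  shows "varpi_spin r h = spin_weight r {..<M} (h :: 'k::field_char_0 mat)"
proof -
  have "(\<Sum>i=1..r. eps i h) = (\<Sum>a<r. h $$ (a, a))"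
    unfolding eps_def by (rule sum.reindex_bij_witness[of _ Suc "\<lambda>i. i - 1"]) auto
  also have "\<dots> / 2 = (\<Sum>a<r. (of_bool (a \<in> {..<M}) - 1 / 2) * h $$ (a, a))"
    unfolding sum_divide_distrib using assms by (intro sum.cong refl) auto
  finally show ?thesis
    by (simp add: varpi_spin_def spin_weight_def)
qed

lemma sum_basis:
  fixes g :: "nat \<Rightarrow> 'k::field"
  assumes "i < r"
  shows "(\<Sum>a<r. of_int (of_bool (a = i)) * g a) = g i"
proof -
  have "(\<Sum>a<r. of_int (of_bool (a = i)) * g a) = (\<Sum>a<r. if a = i then g a else 0)"
    by (intro sum.cong refl) auto
  then show ?thesis
    using assms by simp
qed

lemma sum_basis_pair:
  fixes g :: "nat \<Rightarrow> 'k::field"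
  assumes "i < r" "j < r"
  shows "(\<Sum>a<r. of_int (of_bool (a = i) - of_bool (a = j)) * g a) = g i - g j"
    "(\<Sum>a<r. of_int (of_bool (a = i) + of_bool (a = j)) * g a) = g i + g j"
proof -
  show "(\<Sum>a<r. of_int (of_bool (a = i) - of_bool (a = j)) * g a) = g i - g j"
    "(\<Sum>a<r. of_int (of_bool (a = i) + of_bool (a = j)) * g a) = g i + g j"
    using sum_basis[OF assms(1), of g] sum_basis[OF assms(2), of g]
    by (simp_all add: left_diff_distrib distrib_right sum_subtractf sum.distrib)
qed

lemma covers_type_B_iff:
  assumes n: "1 \<le> n"
  shows "(\<exists>\<alpha>\<in>simple_roots (type_B n :: 'k::field_char_0 lie_datum). \<forall>h\<in>cartan (type_B n).
      spin_weight n T h - spin_weight n S h = \<alpha> h) \<longleftrightarrow>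
    (\<exists>i. Suc i < n \<and> (\<forall>a<n. of_bool (a \<in> T) - of_bool (a \<in> S) = (of_bool (a = i) - of_bool (a = Suc i) :: int))) \<or>
    (\<forall>a<n. of_bool (a \<in> T) - of_bool (a \<in> S) = (of_bool (a = n - 1) :: int))"
proof -
  let ?L = "type_B n :: 'k lie_datum"
  have half: "(2 * n + 1) div 2 = n"
    by simp
  have cartan: "cartan ?L = {h \<in> so (2 * n + 1). diagonal_mat h}"
    by (simp add: type_B_def)
  note iff = spin_weight_diff_iff[OF cartan, unfolded half, of T S]
  have short: "(\<forall>h\<in>cartan ?L. spin_weight n T h - spin_weight n S h = eps n h) \<longleftrightarrow>
      (\<forall>a<n. of_bool (a \<in> T) - of_bool (a \<in> S) = (of_bool (a = n - 1) :: int))"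
    unfolding iff[symmetric] using n by (subst sum_basis) (auto simp: eps_def)
  have long: "(\<forall>h\<in>cartan ?L. spin_weight n T h - spin_weight n S h = eps (Suc i) h - eps (Suc i + 1) h) \<longleftrightarrow>
      (\<forall>a<n. of_bool (a \<in> T) - of_bool (a \<in> S) = (of_bool (a = i) - of_bool (a = Suc i) :: int))"
    if "Suc i < n" for i
    unfolding iff[symmetric] using that by (subst sum_basis_pair(1)) (auto simp: eps_def)
  have roots: "simple_roots ?L = {(\<lambda>h. eps (Suc i) h - eps (Suc i + 1) h) | i. Suc i < n} \<union> {eps n}"
    unfolding type_B_def by (auto, metis Suc_le_D Suc_eq_plus1)
  have "(\<exists>\<alpha>\<in>simple_roots ?L. P \<alpha>) \<longleftrightarrow> (\<exists>i. Suc i < n \<and> P (\<lambda>h. eps (Suc i) h - eps (Suc i + 1) h)) \<or> P (eps n)" for P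
    unfolding roots by blast
  then show ?thesis
    by (simp only: short long cong: conj_cong)
qed

lemma covers_type_D_iff:
  assumes n: "1 \<le> n"
  shows "(\<exists>\<alpha>\<in>simple_roots (type_D (n + 1) :: 'k::field_char_0 lie_datum). \<forall>h\<in>cartan (type_D (n + 1)).
      spin_weight (n + 1) T h - spin_weight (n + 1) S h = \<alpha> h) \<longleftrightarrow>
    (\<exists>i<n. \<forall>a<n + 1. of_bool (a \<in> T) - of_bool (a \<in> S) = (of_bool (a = i) - of_bool (a = Suc i) :: int)) \<or>
    (\<forall>a<n + 1. of_bool (a \<in> T) - of_bool (a \<in> S) = (of_bool (a = n - 1) + of_bool (a = n) :: int))"
proof -
  let ?L = "type_D (n + 1) :: 'k lie_datum"
  have half: "2 * (n + 1) div 2 = n + 1"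
    by simp
  have cartan: "cartan ?L = {h \<in> so (2 * (n + 1)). diagonal_mat h}"
    by (simp add: type_D_def)
  note iff = spin_weight_diff_iff[OF cartan, unfolded half, of T S]
  have last: "(\<forall>h\<in>cartan ?L. spin_weight (n + 1) T h - spin_weight (n + 1) S h = eps n h + eps (n + 1) h) \<longleftrightarrow>
      (\<forall>a<n + 1. of_bool (a \<in> T) - of_bool (a \<in> S) = (of_bool (a = n - 1) + of_bool (a = n) :: int))"
    unfolding iff[symmetric] using n by (subst sum_basis_pair(2)) (auto simp: eps_def)
  have long: "(\<forall>h\<in>cartan ?L. spin_weight (n + 1) T h - spin_weight (n + 1) S h = eps (Suc i) h - eps (Suc i + 1) h) \<longleftrightarrow>
      (\<forall>a<n + 1. of_bool (a \<in> T) - of_bool (a \<in> S) = (of_bool (a = i) - of_bool (a = Suc i) :: int))"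
    if "i < n" for i
    unfolding iff[symmetric] using that by (subst sum_basis_pair(1)) (auto simp: eps_def)
  have roots: "simple_roots ?L = {(\<lambda>h. eps (Suc i) h - eps (Suc i + 1) h) | i. i < n} \<union> {\<lambda>h. eps n h + eps (n + 1) h}"
    unfolding type_D_def by (auto, metis Suc_le_D Suc_eq_plus1 Suc_less_eq)
  have "(\<exists>\<alpha>\<in>simple_roots ?L. P \<alpha>) \<longleftrightarrow>
      (\<exists>i<n. P (\<lambda>h. eps (Suc i) h - eps (Suc i + 1) h)) \<or> P (\<lambda>h. eps n h + eps (n + 1) h)" for P
    unfolding roots by blast
  then show ?thesis
    by (simp only: last long cong: conj_cong)
qed

text \<open>A simple root of type \<open>B\<close> has coordinate sum \<open>0\<close> on the places below \<open>n\<close>, or \<open>1\<close> if it is the short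
  root. Since the sum over all places is even, \<open>d n\<close> vanishes in the first case and is
  \<open>1\<close> or \<open>- 1\<close> in the second; these are the last two simple roots of type \<open>D\<close>.\<close>

lemma spin_covers_agree:
  assumes n: "1 \<le> n" and S: "S \<in> parity_states (n + 1) e" and T: "T \<in> parity_states (n + 1) e"
  defines "d \<equiv> \<lambda>a. of_bool (a \<in> T) - of_bool (a \<in> S) :: int"
  shows "(\<exists>i. Suc i < n \<and> (\<forall>a<n. d a = of_bool (a = i) - of_bool (a = Suc i))) \<or>
      (\<forall>a<n. d a = of_bool (a = n - 1)) \<longleftrightarrow>
    (\<exists>i<n. \<forall>a<n + 1. d a = of_bool (a = i) - of_bool (a = Suc i)) \<or>
      (\<forall>a<n + 1. d a = of_bool (a = n - 1) + of_bool (a = n))"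
    (is "?B \<longleftrightarrow> ?D")
proof
  have card: "(\<Sum>a<n + 1. of_bool (a \<in> U)) = int (card U)" if "U \<in> parity_states (n + 1) e" for U
  proof -
    have "{..<n + 1} \<inter> U = U"
      using that by (auto simp: parity_states_def)
    then show ?thesis
      by (simp add: sum_of_bool_eq del: sum.lessThan_Suc)
  qed
  have "(\<Sum>a<n + 1. d a) = int (card T) - int (card S)"
    unfolding d_def using card[OF S] card[OF T] by (simp add: sum_subtractf del: sum.lessThan_Suc)
  moreover have "even (int (card T) - int (card S))"
    using S T by (auto simp: parity_states_def)
  ultimately have parity: "even ((\<Sum>a<n. d a) + d n)"
    by simp
  have range: "d n = - 1 \<or> d n = 0 \<or> d n = 1"
    by (auto simp: d_def)
  assume ?B
  then show ?D
  proof
    assume "\<exists>i. Suc i < n \<and> (\<forall>a<n. d a = of_bool (a = i) - of_bool (a = Suc i))"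
    then obtain i where i: "Suc i < n" "\<And>a. a < n \<Longrightarrow> d a = of_bool (a = i) - of_bool (a = Suc i)"
      by blast
    have "(\<Sum>a<n. d a) = (\<Sum>a<n. (if a = i then 1 else 0) - (if a = Suc i then 1 else 0))"
      by (intro sum.cong refl) (use i in auto)
    also have "\<dots> = 0"
      using i(1) by (simp add: sum_subtractf)
    finally have "d n = 0"
      using parity range by auto
    then have "\<forall>a<n + 1. d a = of_bool (a = i) - of_bool (a = Suc i)"
      using i by (auto simp: less_Suc_eq)
    then show ?D
      using i(1) by (intro disjI1 exI[of _ i]) auto
  next
    assume *: "\<forall>a<n. d a = of_bool (a = n - 1)"
    have "(\<Sum>a<n. d a) = (\<Sum>a<n. if a = n - 1 then 1 else 0)"
      by (intro sum.cong refl) (use * in auto)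
    also have "\<dots> = 1"
      using n by simp
    finally have "d n = - 1 \<or> d n = 1"
      using parity range by auto
    then show ?D
    proof
      assume "d n = - 1"
      then have "\<forall>a<n + 1. d a = of_bool (a = n - 1) - of_bool (a = Suc (n - 1))"
        using * n by (auto simp: less_Suc_eq)
      then show ?D
        using n by (intro disjI1 exI[of _ "n - 1"]) auto
    next
      assume "d n = 1"
      then have "\<forall>a<n + 1. d a = of_bool (a = n - 1) + of_bool (a = n)"
        using * n by (auto simp: less_Suc_eq)
      then show ?D
        by blast
    qed
  qed
next
  assume ?D
  then show ?B
  proof
    assume "\<exists>i<n. \<forall>a<n + 1. d a = of_bool (a = i) - of_bool (a = Suc i)"
    then obtain i where i: "i < n" "\<And>a. a < n + 1 \<Longrightarrow> d a = of_bool (a = i) - of_bool (a = Suc i)"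
      by blast
    show ?B
    proof (cases "Suc i < n")
      case True
      moreover have "\<forall>a<n. d a = of_bool (a = i) - of_bool (a = Suc i)"
        using i(2) by simp
      ultimately show ?thesis
        by blast
    next
      case False
      then have "i = n - 1"
        using i by simp
      then have "\<forall>a<n. d a = of_bool (a = n - 1)"
        using i by auto
      then show ?thesis
        by blast
    qed
  next
    assume "\<forall>a<n + 1. d a = of_bool (a = n - 1) + of_bool (a = n)"
    then have "\<forall>a<n. d a = of_bool (a = n - 1)"
      by auto
    then show ?B
      by blast
  qed
qed

lemma spin_iso_half_spin:
  assumes n: "1 \<le> n"
  shows "weight_poset (type_B n :: 'k::field_char_0 lie_datum) (varpi_spin n) \<simeq>
    weight_poset (type_D (n + 1)) (varpi_spin (n + 1))"
proof -
  let ?B = "type_B n :: 'k lie_datum" and ?D = "type_D (n + 1) :: 'k lie_datum"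
  have half: "(2 * n + 1) div 2 = n" "(2 * n + 1 + 1) div 2 = n + 1"
    "2 * (n + 1) div 2 = n + 1" "(2 * (n + 1) + 1) div 2 = n + 1"
    by simp_all
  have tri: "triangular_datum ?B (2 * n + 1)" "triangular_datum ?D (2 * (n + 1))"
    by (rule triangular_type_B triangular_type_D, use n in simp)+
  have alg: "lie_algebra ?B = so (2 * n + 1)" "cartan ?B = {h \<in> so (2 * n + 1). diagonal_mat h}"
    "lie_algebra ?D = so (2 * (n + 1))" "cartan ?D = {h \<in> so (2 * (n + 1)). diagonal_mat h}"
    by (simp_all add: type_B_def type_D_def)
  interpret B: quadratic_model ?B "2 * n + 1" "parity_states (n + 1) (n + 1)"
    "clifford.E (2 * n + 1) (spin_gamma (2 * n + 1))" "spin_weight n" "{..<n + 1}" "\<lambda>S. n + 1 - card S"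
    using quadratic_model_spin[OF tri(1) alg(1,2)] unfolding half .
  interpret D: quadratic_model ?D "2 * (n + 1)" "parity_states (n + 1) (n + 1)"
    "clifford.E (2 * (n + 1)) (spin_gamma (2 * (n + 1)))" "spin_weight (n + 1)" "{..<n + 1}" "\<lambda>S. n + 1 - card S"
    using quadratic_model_spin[OF tri(2) alg(3,4)] unfolding half .
  have lam: "varpi_spin n h = spin_weight n {..<n + 1} h" "varpi_spin (n + 1) h = spin_weight (n + 1) {..<n + 1} h"
    for h :: "'k mat"
    by (rule varpi_spin_weight, simp)+
  show ?thesis
  proof (rule weight_poset_iso[OF _ _ B.restricted_weights_inj D.restricted_weights_inj bij_betw_id])
    show "weights ?B (varpi_spin n) = (\<lambda>S. restrict (spin_weight n S) (cartan ?B)) ` parity_states (n + 1) (n + 1)"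
      by (rule B.weights_eq) (rule lam)
    show "weights ?D (varpi_spin (n + 1)) = (\<lambda>S. restrict (spin_weight (n + 1) S) (cartan ?D)) ` parity_states (n + 1) (n + 1)"
      by (rule D.weights_eq) (rule lam)
    fix S T assume ST: "S \<in> parity_states (n + 1) (n + 1)" "T \<in> parity_states (n + 1) (n + 1)"
    show "(restrict (spin_weight n S) (cartan ?B), restrict (spin_weight n T) (cartan ?B)) \<in> covers ?B (varpi_spin n) \<longleftrightarrow>
        (restrict (spin_weight (n + 1) (id S)) (cartan ?D), restrict (spin_weight (n + 1) (id T)) (cartan ?D))
          \<in> covers ?D (varpi_spin (n + 1))"
      unfolding B.covers_iff[OF lam(1) ST] D.covers_iff[OF lam(2) ST] id_apply
        covers_type_B_iff[OF n] covers_type_D_iff[OF n] by (rule spin_covers_agree[OF n ST])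
  qed
qed

section \<open>The isomorphisms\<close>

theorem theorem2p1:
  shows
    "(\<forall>n m. 1 \<le> n \<longrightarrow> 1 \<le> m \<longrightarrow>
        weight_poset (type_A n :: 'k::{alg_closed_field, field_char_0} lie_datum) (m \<odot> varpi_A 1)
          \<simeq> weight_poset (type_A (n + m - 1)) (varpi_A n) \<and>
        weight_poset (type_A (n + m - 1) :: 'k lie_datum) (varpi_A n)
          \<simeq> weight_poset (type_A (n + m - 1)) (varpi_A m) \<and>
        weight_poset (type_A (n + m - 1) :: 'k lie_datum) (varpi_A m)
          \<simeq> weight_poset (type_A m) (n \<odot> varpi_A 1)) \<and>
     (\<forall>n. 1 \<le> n \<longrightarrow>
        weight_poset (type_A 2 :: 'k lie_datum) (n \<odot> varpi_A 1)
          \<simeq> weight_poset (type_A n) (2 \<odot> varpi_A 1) \<and>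
        weight_poset (type_A n :: 'k lie_datum) (2 \<odot> varpi_A 1)
          \<simeq> weight_poset (type_A (n + 1)) (varpi_A 2)) \<and>
     (\<forall>n. 2 \<le> n \<longrightarrow>
        weight_poset (type_B n :: 'k lie_datum) (varpi_spin n)
          \<simeq> weight_poset (type_D (n + 1)) (varpi_spin (n + 1)))"
proof -
  have sym_ext: "weight_poset (type_A n :: 'k lie_datum) (m \<odot> varpi_A 1) \<simeq> weight_poset (type_A (n + m - 1)) (varpi_A m)"
    if "1 \<le> n" "1 \<le> m" for n m
    using that by (rule symmetric_power_iso_exterior_power)
  have dual: "weight_poset (type_A (n + m - 1) :: 'k lie_datum) (varpi_A n) \<simeq> weight_poset (type_A (n + m - 1)) (varpi_A m)"
    if "1 \<le> n" for n m
    using that by (intro exterior_power_duality) simp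
  have first: "weight_poset (type_A n :: 'k lie_datum) (m \<odot> varpi_A 1) \<simeq> weight_poset (type_A (n + m - 1)) (varpi_A n)"
    if "1 \<le> n" "1 \<le> m" for n m
    using sym_ext[OF that] poset_iso_sym[OF dual[OF that(1)]] by (rule poset_iso_trans)
  have last: "weight_poset (type_A (n + m - 1) :: 'k lie_datum) (varpi_A m) \<simeq> weight_poset (type_A m) (n \<odot> varpi_A 1)"
    if "1 \<le> n" "1 \<le> m" for n m
    using poset_iso_sym[OF first[OF that(2,1)]] by (simp add: add.commute)
  have two: "weight_poset (type_A n :: 'k lie_datum) (2 \<odot> varpi_A 1) \<simeq> weight_poset (type_A (n + 1)) (varpi_A 2)"
    "weight_poset (type_A (n + 1) :: 'k lie_datum) (varpi_A 2) \<simeq> weight_poset (type_A 2) (n \<odot> varpi_A 1)"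
    if "1 \<le> n" for n
    using sym_ext[OF that, of 2] last[OF that, of 2] by simp_all
  have "weight_poset (type_A 2 :: 'k lie_datum) (n \<odot> varpi_A 1) \<simeq> weight_poset (type_A n) (2 \<odot> varpi_A 1)"
    if "1 \<le> n" for n
    using poset_iso_sym[OF two(2)[OF that]] poset_iso_sym[OF two(1)[OF that]] by (rule poset_iso_trans)
  moreover have "weight_poset (type_B n :: 'k lie_datum) (varpi_spin n) \<simeq>
      weight_poset (type_D (n + 1)) (varpi_spin (n + 1))" if "2 \<le> n" for n
    using that by (intro spin_iso_half_spin) simp
  ultimately show ?thesis
    using first dual last two(1) by blast
qed

end
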